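(* Let $\mathcal{B} \subset \mathcal{A}$ be a regular inclusion of simple unital $C^*$-algebras such that there exists a finite-index conditional expectation from $\mathcal{A}$ onto $\mathcal{B}$, and let $E_0 : \mathcal{A} \to \mathcal{B}$ be the unique minimal conditional expectation. Then the following hold: (1) $E_0 : \mathcal{A} \to \mathcal{B}$ admits a two-sided orthonormal quasi-basis; (2) $\tau_0 := (E_0)|_{\mathcal{C}_{\mathcal{A}}(\mathcal{B})} : \mathcal{C}_{\mathcal{A}}(\mathcal{B}) \to \mathbb{C}$ is the (unique) Markov trace for the (connected) inclusion $\mathbb{C} \subseteq \mathcal{C}_{\mathcal{A}}(\mathcal{B})$ with modulus $\dim(\mathcal{C}_{\mathcal{A}}(\mathcal{B}))$; and (3) $[\mathcal{A}:\mathcal{B}]_0 = |W(\mathcal{B} \subset \mathcal{A})| \, \dim(\mathcal{C}_{\mathcal{A}}(\mathcal{B}))$. In particular, $[\mathcal{A}:\mathcal{B}]_0$ is an integer, $|W(\mathcal{B} \subset \mathcal{A})| \leq [\mathcal{A}:\mathcal{B}]_0$, and if, in addition, $\mathcal{B} \subset \mathcal{A}$ is irreducible, then $[\mathcal{A}:\mathcal{B}]_0 = |W_0(\mathcal{B} \subset \mathcal{A})|$.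
   Context: Inclusions of unital $C^*$-algebras have a common unit; $\mathcal{U}(\cdot)$ denotes the unitary group. Let $E: \mathcal{A} \to \mathcal{B}$ be a conditional expectation. A finite set $\{\lambda_i\} \subset \mathcal{A}$ is a right quasi-basis for $E$ if $x = \sum_i E(x\lambda_i)\lambda_i^*$ for all $x \in \mathcal{A}$, and a left quasi-basis if $x = \sum_i E(x\lambda_i^* )\lambda_i$ for all $x \in \mathcal{A}$; it is two-sided if it is both. A right (resp. left) quasi-basis is orthonormal if $E(\lambda_i^*\lambda_j) = \delta_{i,j}$ (resp. $E(\lambda_i\lambda_j^* ) = \delta_{i,j}$) for all $i,j$; a two-sided orthonormal quasi-basis is one that is orthonormal both as a right and as a left quasi-basis. $E$ has finite index if it admits a right quasi-basis, and then its Watatani index is $\mathrm{Ind}_W(E) = \sum_i \lambda_i\lambda_i^*$ for any right quasi-basis (it is independent of the choice, lies in the center of $\mathcal{A}$, and so is a scalar when $\mathcal{A}$ is simple). For an inclusion $\mathcal{B} \subset \mathcal{A}$ of simple unital $C^*$-algebras admitting a finite-index conditional expectation, there is a unique conditional expectation $E_0 : \mathcal{A} \to \mathcal{B}$ with smallest Watatani index (Watatani), called the minimal conditional expectation, and $[\mathcal{A}:\mathcal{B}]_0 := \mathrm{Ind}_W(E_0)$. The centralizer is $\mathcal{C}_{\mathcal{A}}(\mathcal{B}) = \{x \in \mathcal{A} : xb = bx \ \forall b \in \mathcal{B}\} = \mathcal{B}' \cap \mathcal{A}$; in the present setting it is finite-dimensional, and $E_0$ restricts to a faithful tracial state $\tau_0$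 on it. The inclusion is irreducible if $\mathcal{C}_{\mathcal{A}}(\mathcal{B}) = \mathbb{C}$. The normalizer is $\mathcal{N}_{\mathcal{A}}(\mathcal{B}) = \{u \in \mathcal{U}(\mathcal{A}) : u\mathcal{B}u^* = \mathcal{B}\}$, and the inclusion is regular if $\mathcal{N}_{\mathcal{A}}(\mathcal{B})$ generates $\mathcal{A}$ as a $C^*$-algebra. The Weyl group is $W_0(\mathcal{B} \subset \mathcal{A}) = \mathcal{N}_{\mathcal{A}}(\mathcal{B})/\mathcal{U}(\mathcal{B})$ and the generalized Weyl group is $W(\mathcal{B} \subset \mathcal{A}) = \mathcal{N}_{\mathcal{A}}(\mathcal{B})/\big(\mathcal{U}(\mathcal{B})\,\mathcal{U}(\mathcal{C}_{\mathcal{A}}(\mathcal{B}))\big)$. For a unital inclusion $Q \subset P$ of finite-dimensional $C^*$-algebras with inclusion matrix $\Lambda$, a tracial state $\tau$ on $P$ with (column) trace vector $\bar t$ (the values of $\tau$ on minimal projections of the simple summands of $P$) is a Markov trace for $Q \subset P$ with modulus $\beta > 0$ if $\Lambda^t\Lambda\bar t = \beta\bar t$. For $\mathbb{C} \subset P \cong \bigoplus_{i=1}^k M_{n_i}(\mathbb{C})$, $\Lambda = [n_1, \dots, n_k]$. *)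

theory Defs
  imports "HOL-Analysis.Analysis" "HOL-Algebra.Coset"
begin

section \<open>Unital $C^*$-algebras\<close>

text \<open>
  The ambient algebra is a type of the following class; by \<^class>\<open>real_normed_algebra_1\<close> it
  satisfies \<open>norm 1 = 1\<close>, so the zero algebra is excluded. Subalgebras are sets.
\<close>

class cstar_algebra = real_normed_algebra_1 + banach +
  fixes scaleC :: "complex \<Rightarrow> 'a \<Rightarrow> 'a" (infixr \<open>*\<^sub>C\<close> 75)
    and star :: "'a \<Rightarrow> 'a" (\<open>_\<^sup>\<star>\<close> [1000] 1000)
  assumes scaleC_add_right: "a *\<^sub>C (x + y) = a *\<^sub>C x + a *\<^sub>C y"
    and scaleC_add_left: "(a + b) *\<^sub>C x = a *\<^sub>C x + b *\<^sub>C x"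
    and scaleC_scaleC: "a *\<^sub>C (b *\<^sub>C x) = (a * b) *\<^sub>C x"
    and scaleC_one: "1 *\<^sub>C x = x"
    and scaleR_scaleC: "r *\<^sub>R x = complex_of_real r *\<^sub>C x"
    and mult_scaleC_left: "(a *\<^sub>C x) * y = a *\<^sub>C (x * y)"
    and mult_scaleC_right: "x * (a *\<^sub>C y) = a *\<^sub>C (x * y)"
    and norm_scaleC: "norm (a *\<^sub>C x) = cmod a * norm x"
    and star_add: "(x + y)\<^sup>\<star> = x\<^sup>\<star> + y\<^sup>\<star>"
    and star_scaleC: "(a *\<^sub>C x)\<^sup>\<star> = cnj a *\<^sub>C x\<^sup>\<star>"
    and star_mult: "(x * y)\<^sup>\<star> = y\<^sup>\<star> * x\<^sup>\<star>"
    and star_star: "(x\<^sup>\<star>)\<^sup>\<star> = x"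
    and cstar_identity: "norm (x\<^sup>\<star> * x) = (norm x)\<^sup>2"

global_interpretation complex_vector: vector_space "scaleC :: complex \<Rightarrow> 'a \<Rightarrow> 'a::cstar_algebra"
  by unfold_locales (simp_all add: scaleC_add_right scaleC_add_left scaleC_scaleC scaleC_one)

definition unital_cstar_subalgebra :: "'a::cstar_algebra set \<Rightarrow> bool" where
  "unital_cstar_subalgebra S \<longleftrightarrow>
     1 \<in> S \<and> complex_vector.subspace S \<and> (\<forall>x\<in>S. \<forall>y\<in>S. x * y \<in> S) \<and> (\<forall>x\<in>S. x\<^sup>\<star> \<in> S) \<and> closed S"

definition closed_ideal :: "'a::cstar_algebra set \<Rightarrow> 'a set \<Rightarrow> bool" where
  "closed_ideal S I \<longleftrightarrow>
     I \<subseteq> S \<and> complex_vector.subspace I \<and> (\<forall>s\<in>S. \<forall>x\<in>I. s * x \<in> I \<and> x * s \<in> I) \<and> closed I"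

definition simple_cstar_algebra :: "'a::cstar_algebra set \<Rightarrow> bool" where
  "simple_cstar_algebra S \<longleftrightarrow> (\<forall>I. closed_ideal S I \<longrightarrow> I = {0} \<or> I = S)"

definition cstar_positive :: "'a::cstar_algebra \<Rightarrow> bool" where
  "cstar_positive x \<longleftrightarrow> (\<exists>y. x = y\<^sup>\<star> * y)"

definition cstar_le :: "'a::cstar_algebra \<Rightarrow> 'a \<Rightarrow> bool" where
  "cstar_le x y \<longleftrightarrow> cstar_positive (y - x)"

definition scalars :: "'a::cstar_algebra set" where
  "scalars = range (\<lambda>c. c *\<^sub>C 1)"

section \<open>Conditional expectations and the Watatani index\<close>

definition conditional_expectation :: "'a::cstar_algebra set \<Rightarrow> ('a \<Rightarrow> 'a) \<Rightarrow> bool" where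
  "conditional_expectation B E \<longleftrightarrow>
     Vector_Spaces.linear (*\<^sub>C) (*\<^sub>C) E \<and> range E = B \<and> (\<forall>b\<in>B. E b = b) \<and>
     (\<forall>b\<in>B. \<forall>c\<in>B. \<forall>x. E (b * x * c) = b * E x * c) \<and>
     (\<forall>x. cstar_positive x \<longrightarrow> cstar_positive (E x))"

definition right_quasi_basis :: "('a::cstar_algebra \<Rightarrow> 'a) \<Rightarrow> 'a set \<Rightarrow> bool" where
  "right_quasi_basis E L \<longleftrightarrow> finite L \<and> (\<forall>x. x = (\<Sum>l\<in>L. E (x * l) * l\<^sup>\<star>))"

definition left_quasi_basis :: "('a::cstar_algebra \<Rightarrow> 'a) \<Rightarrow> 'a set \<Rightarrow> bool" where
  "left_quasi_basis E L \<longleftrightarrow> finite L \<and> (\<forall>x. x = (\<Sum>l\<in>L. E (x * l\<^sup>\<star>) * l))"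

definition right_orthonormal_quasi_basis :: "('a::cstar_algebra \<Rightarrow> 'a) \<Rightarrow> 'a set \<Rightarrow> bool" where
  "right_orthonormal_quasi_basis E L \<longleftrightarrow>
     right_quasi_basis E L \<and> (\<forall>l\<in>L. \<forall>m\<in>L. E (l\<^sup>\<star> * m) = (if l = m then 1 else 0))"

definition left_orthonormal_quasi_basis :: "('a::cstar_algebra \<Rightarrow> 'a) \<Rightarrow> 'a set \<Rightarrow> bool" where
  "left_orthonormal_quasi_basis E L \<longleftrightarrow>
     left_quasi_basis E L \<and> (\<forall>l\<in>L. \<forall>m\<in>L. E (l * m\<^sup>\<star>) = (if l = m then 1 else 0))"

definition two_sided_orthonormal_quasi_basis :: "('a::cstar_algebra \<Rightarrow> 'a) \<Rightarrow> 'a set \<Rightarrow> bool" where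
  "two_sided_orthonormal_quasi_basis E L \<longleftrightarrow>
     right_orthonormal_quasi_basis E L \<and> left_orthonormal_quasi_basis E L"

definition finite_index :: "('a::cstar_algebra \<Rightarrow> 'a) \<Rightarrow> bool" where
  "finite_index E \<longleftrightarrow> (\<exists>L. right_quasi_basis E L)"

text \<open>
  For a conditional expectation the sum below does not depend on the quasi-basis \<open>L\<close>, so the
  description is proper whenever \<open>E\<close> has finite index.
\<close>

definition watatani_index :: "('a::cstar_algebra \<Rightarrow> 'a) \<Rightarrow> 'a" where
  "watatani_index E = (THE c. \<exists>L. right_quasi_basis E L \<and> c = (\<Sum>l\<in>L. l * l\<^sup>\<star>))"

definition minimal_conditional_expectation :: "'a::cstar_algebra set \<Rightarrow> ('a \<Rightarrow> 'a) \<Rightarrow> bool" where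
  "minimal_conditional_expectation B E \<longleftrightarrow>
     conditional_expectation B E \<and> finite_index E \<and>
     (\<forall>F. conditional_expectation B F \<and> finite_index F \<longrightarrow>
        cstar_le (watatani_index E) (watatani_index F))"

text \<open>
  When the ambient algebra is simple, the Watatani index of the minimal expectation is a positive
  scalar; the following is that scalar as a real number.
\<close>

definition minimal_index :: "'a::cstar_algebra set \<Rightarrow> real" where
  "minimal_index B =
     (THE r. \<exists>E. minimal_conditional_expectation B E \<and> watatani_index E = of_real r)"

section \<open>Centralizer, normalizer and Weyl groups\<close>

definition unitary_group :: "'a::cstar_algebra set \<Rightarrow> 'a set" where
  "unitary_group S = {u\<in>S. u\<^sup>\<star> * u = 1 \<and> u * u\<^sup>\<star> = 1}"

definition centralizer :: "'a::cstar_algebra set \<Rightarrow> 'a set" where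
  "centralizer B = {x. \<forall>b\<in>B. x * b = b * x}"

definition irreducible_inclusion :: "'a::cstar_algebra set \<Rightarrow> bool" where
  "irreducible_inclusion B \<longleftrightarrow> centralizer B = scalars"

definition normalizer :: "'a::cstar_algebra set \<Rightarrow> 'a set" where
  "normalizer B = {u \<in> unitary_group UNIV. (\<lambda>b. u * b * u\<^sup>\<star>) ` B = B}"

definition regular_inclusion :: "'a::cstar_algebra set \<Rightarrow> bool" where
  "regular_inclusion B \<longleftrightarrow> unital_cstar_subalgebra hull normalizer B = UNIV"

definition normalizer_group :: "'a::cstar_algebra set \<Rightarrow> 'a monoid" where
  "normalizer_group B = \<lparr>carrier = normalizer B, mult = (*), one = 1\<rparr>"

definition Weyl_group :: "'a::cstar_algebra set \<Rightarrow> 'a set monoid" where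
  "Weyl_group B = normalizer_group B Mod unitary_group B"

definition generalized_Weyl_group :: "'a::cstar_algebra set \<Rightarrow> 'a set monoid" where
  "generalized_Weyl_group B =
     normalizer_group B Mod
       (unitary_group B <#>\<^bsub>normalizer_group B\<^esub> unitary_group (centralizer B))"

section \<open>Markov traces on finite-dimensional $C^*$-algebras\<close>

definition finite_dimensional_cstar_subalgebra :: "'a::cstar_algebra set \<Rightarrow> bool" where
  "finite_dimensional_cstar_subalgebra P \<longleftrightarrow>
     unital_cstar_subalgebra P \<and> (\<exists>S. finite S \<and> P = complex_vector.span S)"

definition projection_in :: "'a::cstar_algebra set \<Rightarrow> 'a \<Rightarrow> bool" where
  "projection_in P p \<longleftrightarrow> p \<in> P \<and> p\<^sup>\<star> = p \<and> p * p = p"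

definition minimal_projection :: "'a::cstar_algebra set \<Rightarrow> 'a \<Rightarrow> bool" where
  "minimal_projection P p \<longleftrightarrow>
     projection_in P p \<and> p \<noteq> 0 \<and> (\<forall>q. projection_in P q \<and> q * p = q \<longrightarrow> q = 0 \<or> q = p)"

text \<open>
  The simple summands of \<open>P\<close> are the algebras \<open>z P\<close> with \<open>z\<close> a minimal projection of the center;
  they are indexed here by these \<open>z\<close>.
\<close>

definition simple_summands :: "'a::cstar_algebra set \<Rightarrow> 'a set" where
  "simple_summands P = {z. minimal_projection (P \<inter> centralizer P) z}"

definition projection_rank :: "'a::cstar_algebra set \<Rightarrow> 'a \<Rightarrow> nat" where
  "projection_rank P e =
     (THE n. \<exists>S. finite S \<and> (\<forall>p\<in>S. minimal_projection P p) \<and>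
        (\<forall>p\<in>S. \<forall>q\<in>S. p \<noteq> q \<longrightarrow> p * q = 0) \<and> \<Sum>S = e \<and> card S = n)"

text \<open>
  The entry at the summands \<open>y\<close> of \<open>Q\<close> and \<open>z\<close> of \<open>P\<close> is the multiplicity of \<open>y Q\<close> in \<open>z P\<close>, that
  is, the rank in \<open>z P\<close> of \<open>e z\<close> for a minimal projection \<open>e\<close> of \<open>y Q\<close>. For \<open>Q = scalars\<close> the only row
  is \<open>y = 1\<close>, with \<open>e = 1\<close>, and its entry at \<open>z\<close> is the \<open>n\<close> with \<open>z P\<close> isomorphic to the
  \<open>n\<close> by \<open>n\<close> matrices.
\<close>

definition inclusion_matrix :: "'a::cstar_algebra set \<Rightarrow> 'a set \<Rightarrow> 'a \<Rightarrow> 'a \<Rightarrow> nat" where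
  "inclusion_matrix Q P y z =
     (THE n. \<exists>e. minimal_projection Q e \<and> e * y = e \<and> projection_rank P (e * z) = n)"

text \<open>Connectedness of the Bratteli diagram, the bipartite graph with adjacency matrix
  \<^const>\<open>inclusion_matrix\<close>.\<close>

definition connected_inclusion :: "'a::cstar_algebra set \<Rightarrow> 'a set \<Rightarrow> bool" where
  "connected_inclusion Q P \<longleftrightarrow>
     (let V = Inl ` simple_summands Q \<union> Inr ` simple_summands P;
          R = {(Inl y, Inr z) | y z. y \<in> simple_summands Q \<and> z \<in> simple_summands P \<and>
                 inclusion_matrix Q P y z \<noteq> 0}
      in \<forall>u\<in>V. \<forall>v\<in>V. (u, v) \<in> (R \<union> R\<inverse>)\<^sup>*)"

definition tracial_state :: "'a::cstar_algebra set \<Rightarrow> ('a \<Rightarrow> complex) \<Rightarrow> bool" where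
  "tracial_state P \<tau> \<longleftrightarrow>
     (\<forall>x\<in>P. \<forall>y\<in>P. \<tau> (x + y) = \<tau> x + \<tau> y) \<and> (\<forall>c. \<forall>x\<in>P. \<tau> (c *\<^sub>C x) = c * \<tau> x) \<and>
     (\<forall>x\<in>P. \<tau> (x\<^sup>\<star> * x) \<in> \<real>\<^sub>\<ge>\<^sub>0) \<and> \<tau> 1 = 1 \<and> (\<forall>x\<in>P. \<forall>y\<in>P. \<tau> (x * y) = \<tau> (y * x))"

definition trace_vector :: "'a::cstar_algebra set \<Rightarrow> ('a \<Rightarrow> complex) \<Rightarrow> 'a \<Rightarrow> complex" where
  "trace_vector P \<tau> z = (THE c. \<exists>p. minimal_projection P p \<and> p * z = p \<and> \<tau> p = c)"

definition Markov_trace ::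
  "'a::cstar_algebra set \<Rightarrow> 'a set \<Rightarrow> ('a \<Rightarrow> complex) \<Rightarrow> real \<Rightarrow> bool" where
  "Markov_trace Q P \<tau> \<beta> \<longleftrightarrow>
     finite_dimensional_cstar_subalgebra Q \<and> finite_dimensional_cstar_subalgebra P \<and> Q \<subseteq> P \<and>
     tracial_state P \<tau> \<and> \<beta> > 0 \<and>
     (\<forall>z\<in>simple_summands P.
        (\<Sum>w\<in>simple_summands P.
           (\<Sum>y\<in>simple_summands Q.
              of_nat (inclusion_matrix Q P y z) * of_nat (inclusion_matrix Q P y w))
           * trace_vector P \<tau> w)
        = of_real \<beta> * trace_vector P \<tau> z)"

end

theory Submission
  imports Defs
begin

text \<open>
  Let \<open>C\<close> be the centralizer of \<open>B\<close>. Since \<open>B\<close> has trivial centre, an expectation \<open>E\<close> restricts to a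
  scalar-valued state \<open>\<phi>\<close> on \<open>C\<close>, and \<open>E (u c v\<^sup>\<star>) = 0\<close> for \<open>c\<close> in \<open>C\<close> and normalizers \<open>u\<close>, \<open>v\<close> in different
  classes of the generalized Weyl group \<open>W\<close>. Finite index makes the norm equivalent to the one of the
  \<open>B\<close>-valued inner product, which forces \<open>C\<close> to be finite-dimensional and \<open>W\<close> to be finite. By regularity
  the products \<open>k w\<close>, with \<open>k\<close> in a \<open>\<phi>\<close>-orthonormal basis \<open>K\<close> of \<open>C\<close> and \<open>w\<close> representing the classes, form
  a quasi-basis.

  Let \<open>n = dim C\<close> and let \<open>\<tau>\<close> be the normalized trace of the left regular representation of \<open>C\<close>; it is
  invariant under normalizers. With \<open>D = (\<Sum>k\<in>K. k k\<^sup>\<star>)\<close> one has \<open>n \<tau> = \<phi> (_ D)\<close>, and applying \<open>\<tau>\<close> to the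
  scalar index of \<open>E\<close> gives the value \<open>card W * \<tau> D\<close>. Now \<open>n \<tau> D = \<phi> (D\<^sup>2) \<ge> (\<phi> D)\<^sup>2 = n\<^sup>2\<close>, with equality only
  for \<open>D = n\<close>, that is, \<open>\<phi> = \<tau>\<close>. As \<open>x \<mapsto> (1/n) (\<Sum>k\<in>K. E (k x k\<^sup>\<star>))\<close> is an expectation restricting to \<open>\<tau>\<close>,
  the minimal expectation restricts to \<open>\<tau>\<close> and has index \<open>card W * n\<close>. Finally \<open>\<tau>\<close> is the Markov trace,
  because left multiplication by a minimal projection \<open>p\<close> has trace \<open>dim (p C)\<close>, the rank of the summand of \<open>p\<close>.
\<close>

section \<open>Involution and norm\<close>

text \<open>Positivity is handled through norms instead of spectra: a selfadjoint \<open>a\<close>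
  is a square exactly when \<open>norm (r *\<^sub>R 1 - a) \<le> r\<close> for some
  \<open>r\<close>, so cone arguments become triangle inequalities. Square roots are built together
  with the clause that they commute with everything that commutes with the element, which takes the
  place of functional calculus.

  The main obstacle is that the minimal expectation is known only through an inequality between
  indices, and its restriction \<phi> is a priori neither tracial nor invariant under normalizers.
  Left orthonormality and left expansion hold for any \<phi>, so they come first and already
  determine the index. That index is a sum of conjugates \<open>w\<^sup>\<star> * _ * w\<close>; it
  is tested against \<tau> rather than \<phi>, because \<tau> absorbs the conjugations and is
  intrinsic to \<open>C\<close>. The same test then evaluates two expectations, the minimal one and
  the one restricting to \<tau>, and comparing the two values is all that minimality has to deliver.
  Only after \<phi> = \<tau> is established does the same set become a right quasi-basis
  too.\<close>

lemma scaleC_zero_left [simp]: "0 *\<^sub>C (x::'a::cstar_algebra) = 0"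
  by (rule complex_vector.scale_zero_left)

lemma scaleC_zero_right [simp]: "c *\<^sub>C (0::'a::cstar_algebra) = 0"
  by (rule complex_vector.scale_zero_right)

declare scaleC_one [simp]

lemma star_zero [simp]: "(0::'a::cstar_algebra)\<^sup>\<star> = 0"
  using star_scaleC[of 0 "0::'a"] by simp

lemma star_minus [simp]: "(- x)\<^sup>\<star> = - (x::'a::cstar_algebra)\<^sup>\<star>"
  using star_add[of x "- x"] by (simp add: eq_neg_iff_add_eq_0 add.commute)

lemma star_diff: "(x - y)\<^sup>\<star> = (x::'a::cstar_algebra)\<^sup>\<star> - y\<^sup>\<star>"
  using star_add[of x "- y"] by simp

lemma star_one [simp]: "(1::'a::cstar_algebra)\<^sup>\<star> = 1"
  by (metis mult_1 mult_1_right star_mult star_star)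

lemma star_scaleR [simp]: "(r *\<^sub>R x)\<^sup>\<star> = r *\<^sub>R (x::'a::cstar_algebra)\<^sup>\<star>"
  by (simp add: scaleR_scaleC star_scaleC)

declare star_star [simp]

lemma star_of_real [simp]: "(of_real r :: 'a::cstar_algebra)\<^sup>\<star> = of_real r"
  by (simp add: of_real_def)

lemma star_sum: "(sum f A)\<^sup>\<star> = (\<Sum>i\<in>A. (f i :: 'a::cstar_algebra)\<^sup>\<star>)"
  by (induction A rule: infinite_finite_induct) (simp_all add: star_add)

lemma star_eq_0_iff [simp]: "(x::'a::cstar_algebra)\<^sup>\<star> = 0 \<longleftrightarrow> x = 0"
  by (metis star_star star_zero)

lemma star_power: "((x::'a::cstar_algebra) ^ n)\<^sup>\<star> = x\<^sup>\<star> ^ n"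
  by (induction n) (simp_all add: star_mult power_commutes)

lemma norm_star [simp]: "norm (x\<^sup>\<star>) = norm (x::'a::cstar_algebra)"
proof -
  have le: "norm y \<le> norm (y\<^sup>\<star>)" for y :: 'a
  proof (cases "y = 0")
    case False
    have "norm y * norm y \<le> norm (y\<^sup>\<star>) * norm y"
      using norm_mult_ineq[of "y\<^sup>\<star>" y] by (simp add: cstar_identity power2_eq_square)
    then show ?thesis using False by simp
  qed simp
  show ?thesis using le[of x] le[of "x\<^sup>\<star>"] by simp
qed

lemma cstar_identity': "norm (x * x\<^sup>\<star>) = (norm (x::'a::cstar_algebra))\<^sup>2"
  using cstar_identity[of "x\<^sup>\<star>"] by simp

lemma star_mult_self_eq_0_iff: "x\<^sup>\<star> * x = 0 \<longleftrightarrow> (x::'a::cstar_algebra) = 0"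
  by (metis cstar_identity mult_zero_right norm_eq_zero power_eq_0_iff)

lemma norm_selfadjoint_square: "(h::'a::cstar_algebra)\<^sup>\<star> = h \<Longrightarrow> norm (h * h) = (norm h)\<^sup>2"
  by (metis cstar_identity)

lemma bounded_linear_star: "bounded_linear (star :: 'a::cstar_algebra \<Rightarrow> 'a)"
  by (rule bounded_linear_intro[where K=1]) (simp_all add: star_add)

lemma bounded_linear_scaleC: "bounded_linear (scaleC c :: 'a::cstar_algebra \<Rightarrow> 'a)"
  by (rule bounded_linear_intro[where K="cmod c"])
    (simp_all add: scaleC_add_right norm_scaleC scaleR_scaleC scaleC_scaleC mult.commute)

section \<open>Square roots and the positive cone\<close>

text \<open>The iteration \<open>s \<leftarrow> (x + s\<^sup>2) / 2\<close> converges to \<open>1 - sqrt (1 - x)\<close>, because its steps are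
  dominated by those of the same iteration started for the real number 1.\<close>

primrec sqrt_iter :: "'a::real_normed_algebra_1 \<Rightarrow> nat \<Rightarrow> 'a" where
  "sqrt_iter x 0 = 0"
| "sqrt_iter x (Suc n) = (1/2) *\<^sub>R (x + sqrt_iter x n * sqrt_iter x n)"

lemma sqrt_iter_real_bounds: "0 \<le> sqrt_iter (1::real) n \<and> sqrt_iter (1::real) n \<le> 1"
proof (induction n)
  case (Suc n)
  then have "sqrt_iter 1 n * sqrt_iter 1 n \<le> (1::real)" by (simp add: mult_le_one)
  then show ?case by simp
qed simp

text \<open>Both bounds go through one induction: a difference of squares splits as
  \<open>u * (u - v) + (u - v) * v\<close> without commutativity, so the next step is controlled by
  sizes times the previous step. The real iteration satisfies the same identity and is therefore a
  majorant.\<close>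

lemma sqrt_iter_bounds:
  fixes x :: "'a::cstar_algebra"
  assumes "norm x \<le> 1"
  shows "norm (sqrt_iter x n) \<le> sqrt_iter 1 n \<and>
    norm (sqrt_iter x (Suc n) - sqrt_iter x n) \<le> sqrt_iter 1 (Suc n) - sqrt_iter (1::real) n"
proof (induction n)
  case 0
  show ?case using assms by simp
next
  case (Suc n)
  let ?s = "sqrt_iter x" and ?r = "sqrt_iter (1::real)"
  have "norm (?s n * ?s n) \<le> ?r n * ?r n"
    using Suc norm_mult_ineq[of "?s n" "?s n"] mult_mono[of "norm (?s n)" "?r n" "norm (?s n)" "?r n"]
      sqrt_iter_real_bounds[of n] by (meson order_trans norm_ge_zero)
  then have 1: "norm (?s (Suc n)) \<le> ?r (Suc n)"
    using norm_triangle_ineq[of x "?s n * ?s n"] assms by simp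
  have square_step: "u * u - v * v = u * (u - v) + (u - v) * v" for u v :: "'b::ring"
    by (simp add: algebra_simps)
  let ?d = "?s (Suc n) - ?s n" and ?e = "?r (Suc n) - ?r n"
  have split: "?s (Suc (Suc n)) - ?s (Suc n) = (1/2) *\<^sub>R (?s (Suc n) * ?d + ?d * ?s n)"
    unfolding square_step[symmetric] sqrt_iter.simps(2)[of x "Suc n"]
    by (subst (3) sqrt_iter.simps(2)) (simp del: sqrt_iter.simps add: algebra_simps)
  have splitr: "?r (Suc (Suc n)) - ?r (Suc n) = (1/2) * (?r (Suc n) * ?e + ?e * ?r n)"
    unfolding square_step[symmetric] sqrt_iter.simps(2)[of 1 "Suc n"]
    by (subst (3) sqrt_iter.simps(2)) (simp del: sqrt_iter.simps add: algebra_simps)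
  have d: "norm ?d \<le> ?e" using Suc by blast
  have "norm (?s (Suc n) * ?d) \<le> ?r (Suc n) * ?e"
    by (rule order_trans[OF norm_mult_ineq mult_mono[OF 1 d]]) (use sqrt_iter_real_bounds[of "Suc n"] in blast, simp)
  moreover have "norm (?d * ?s n) \<le> ?e * ?r n"
    by (rule order_trans[OF norm_mult_ineq mult_mono[OF d]])
      (use Suc d norm_ge_zero[of ?d] in \<open>linarith, linarith, simp\<close>)
  ultimately have "norm (?s (Suc n) * ?d + ?d * ?s n) \<le> ?r (Suc n) * ?e + ?e * ?r n"
    by (intro order_trans[OF norm_triangle_ineq] add_mono)
  then have "norm (?s (Suc (Suc n)) - ?s (Suc n)) \<le> ?r (Suc (Suc n)) - ?r (Suc n)"
    unfolding split splitr by simp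
  with 1 show ?case by blast
qed

text \<open>Telescoping bounds each gap by the matching gap of the real majorant, which is
  increasing and bounded by 1, hence Cauchy.\<close>

lemma sqrt_iter_convergent:
  fixes x :: "'a::cstar_algebra"
  assumes "norm x \<le> 1"
  shows "convergent (sqrt_iter x)"
proof -
  let ?s = "sqrt_iter x" and ?r = "sqrt_iter (1::real)"
  have inc: "incseq ?r"
    using sqrt_iter_bounds[OF assms] norm_ge_zero by (smt (verit, best) incseq_SucI)
  have dist: "norm (?s (n + k) - ?s n) \<le> ?r (n + k) - ?r n" for n k
  proof (induction k)
    case (Suc k)
    have "norm (?s (n + Suc k) - ?s n) \<le> norm (?s (Suc (n + k)) - ?s (n + k)) + norm (?s (n + k) - ?s n)"
      using norm_triangle_ineq[of "?s (Suc (n + k)) - ?s (n + k)" "?s (n + k) - ?s n"]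
      by (simp del: sqrt_iter.simps)
    then show ?case using Suc sqrt_iter_bounds[OF assms, of "n + k"] by (simp del: sqrt_iter.simps)
  qed simp
  have "Cauchy ?r"
    using sqrt_iter_real_bounds
    by (intro convergent_Cauchy Bseq_mono_convergent BseqI'[of _ 1]) (auto intro: incseqD[OF inc])
  have "Cauchy ?s"
  proof (rule CauchyI')
    fix e :: real assume "e > 0"
    then obtain M where M: "\<forall>m\<ge>M. \<forall>n\<ge>M. norm (?r m - ?r n) < e"
      using \<open>Cauchy ?r\<close> CauchyD by blast
    show "\<exists>M. \<forall>m\<ge>M. \<forall>n>m. dist (?s m) (?s n) < e"
    proof (intro exI allI impI)
      fix m n assume "M \<le> m" "m < n"
      then obtain k where "n = m + k" using less_imp_add_positive by blast
      then show "dist (?s m) (?s n) < e"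
        using dist[of m k] M \<open>M \<le> m\<close> by (smt (verit) dist_commute dist_norm le_add1 order_trans real_norm_def)
    qed
  qed
  then show ?thesis by (rule Cauchy_convergent)
qed

text \<open>Commutation holds for every iterate and survives the limit. The bound on
  \<open>1 - s\<close> later certifies that the root is itself positive.\<close>

lemma sqrt_one_minus_exists:
  fixes x :: "'a::cstar_algebra"
  assumes sa: "x\<^sup>\<star> = x" and le: "norm x \<le> 1"
  obtains s where "s\<^sup>\<star> = s" "s * s = 1 - x" "norm (1 - s) \<le> 1" "\<And>y. y * x = x * y \<Longrightarrow> y * s = s * y"
proof -
  obtain l where l: "sqrt_iter x \<longlonglongrightarrow> l"
    using sqrt_iter_convergent[OF le] by (auto simp: convergent_def)
  have "(\<lambda>n. sqrt_iter x (Suc n)) \<longlonglongrightarrow> (1/2) *\<^sub>R (x + l * l)"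
    using l by (auto intro!: tendsto_intros)
  then have fixpoint: "l = (1/2) *\<^sub>R (x + l * l)"
    using l LIMSEQ_Suc LIMSEQ_unique by blast
  have sa_n: "(sqrt_iter x n)\<^sup>\<star> = sqrt_iter x n" for n
    by (induction n) (simp_all add: star_add star_mult sa)
  have "(\<lambda>n. (sqrt_iter x n)\<^sup>\<star>) \<longlonglongrightarrow> l\<^sup>\<star>"
    by (rule bounded_linear.tendsto[OF bounded_linear_star l])
  then have lsa: "l\<^sup>\<star> = l" using l LIMSEQ_unique by (simp add: sa_n) blast
  have comm: "y * l = l * y" if y: "y * x = x * y" for y
  proof -
    have c: "y * sqrt_iter x n = sqrt_iter x n * y" for n
    proof (induction n)
      case (Suc n)
      have "y * (sqrt_iter x n * sqrt_iter x n) = sqrt_iter x n * sqrt_iter x n * y"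
        by (metis Suc mult.assoc)
      then show ?case using y by (simp add: algebra_simps)
    qed simp
    have "(\<lambda>n. y * sqrt_iter x n) \<longlonglongrightarrow> y * l" "(\<lambda>n. sqrt_iter x n * y) \<longlonglongrightarrow> l * y"
      using l by (auto intro!: tendsto_intros)
    then show ?thesis using LIMSEQ_unique c by simp
  qed
  have "2 *\<^sub>R l = x + l * l" by (subst fixpoint) simp
  then have square: "(1 - l) * (1 - l) = 1 - x" by (simp add: algebra_simps scaleR_2)
  have comm': "y * (1 - l) = (1 - l) * y" if "y * x = x * y" for y
    by (simp add: right_diff_distrib left_diff_distrib comm[OF that])
  have "norm l \<le> 1"
  proof (rule LIMSEQ_le_const2)
    show "(\<lambda>n. norm (sqrt_iter x n)) \<longlonglongrightarrow> norm l" using l by (rule tendsto_norm)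
    show "\<exists>N. \<forall>n\<ge>N. norm (sqrt_iter x n) \<le> 1"
      using sqrt_iter_bounds[OF le] sqrt_iter_real_bounds order_trans by blast
  qed
  then show thesis using that[OF _ square _ comm'] lsa by (simp add: star_diff)
qed

text \<open>Squares of selfadjoint elements, at first sight a smaller cone than
  \<open>cstar_positive\<close>. Closure under sums is accessible here by norm estimates; the two
  cones are identified in \<open>cstar_positive_iff_spos\<close>.\<close>

definition spos :: "'a::cstar_algebra \<Rightarrow> bool" where
  "spos a \<longleftrightarrow> (\<exists>s. s\<^sup>\<star> = s \<and> a = s * s)"

lemma spos_selfadjoint: "spos a \<Longrightarrow> a\<^sup>\<star> = a"
  by (auto simp: spos_def star_mult)

lemma spos_scaleR: "spos a \<Longrightarrow> r \<ge> 0 \<Longrightarrow> spos (r *\<^sub>R a)"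
proof -
  assume "spos a" "r \<ge> 0"
  then obtain s where "s\<^sup>\<star> = s" "a = s * s" by (auto simp: spos_def)
  then show ?thesis unfolding spos_def
    by (intro exI[of _ "sqrt r *\<^sub>R s"]) (simp add: \<open>r \<ge> 0\<close>)
qed

text \<open>The element \<open>u = h + \<i> *\<^sub>C g\<close> satisfies
  \<open>u\<^sup>\<star> * u = h * h + g * g\<close> by commutation, and \<open>h\<close> is its
  real part, so \<open>norm h \<le> norm u\<close>.\<close>

lemma norm_le_of_commuting_squares:
  fixes h g :: "'a::cstar_algebra"
  assumes "h\<^sup>\<star> = h" "g\<^sup>\<star> = g" "h * g = g * h" "norm (h * h + g * g) \<le> r"
  shows "(norm h)\<^sup>2 \<le> r"
proof -
  define u where "u = h + \<i> *\<^sub>C g"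
  have us: "u\<^sup>\<star> = h - \<i> *\<^sub>C g"
    using assms by (simp add: u_def star_add star_scaleC)
  have "u\<^sup>\<star> * u = h * h + g * g"
    unfolding us unfolding u_def using assms
    by (simp add: algebra_simps mult_scaleC_left mult_scaleC_right scaleC_scaleC scaleC_add_right)
  then have nu: "(norm u)\<^sup>2 \<le> r" using cstar_identity[of u] assms by simp
  have "2 *\<^sub>R h = u + u\<^sup>\<star>" unfolding us unfolding u_def by (simp add: scaleR_2)
  then have "2 * norm h \<le> norm u + norm (u\<^sup>\<star>)"
    by (metis norm_scaleR norm_triangle_ineq abs_numeral)
  then have "norm h \<le> norm u" by simp
  then show ?thesis using nu power_mono[of "norm h" "norm u" 2] norm_ge_zero[of h] by linarith
qed

text \<open>For selfadjoint \<open>a\<close> the norm hypothesis says that the spectrum lies between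
  0 and \<open>2 * r\<close>. Dividing by \<open>r\<close> gives the form \<open>1 - x\<close> with
  \<open>norm x \<le> 1\<close>; the remaining case forces \<open>r = 0\<close> and
  \<open>a = 0\<close>.\<close>

lemma sqrt_exists_of_norm_le:
  fixes a :: "'a::cstar_algebra"
  assumes sa: "a\<^sup>\<star> = a" and le: "norm (r *\<^sub>R 1 - a) \<le> r"
  obtains s where "s\<^sup>\<star> = s" "s * s = a" "norm (sqrt r *\<^sub>R 1 - s) \<le> sqrt r"
    "\<And>y. y * a = a * y \<Longrightarrow> y * s = s * y"
proof (cases "r > 0")
  case True
  define x where "x = 1 - (1/r) *\<^sub>R a"
  have "x = (1/r) *\<^sub>R (r *\<^sub>R 1 - a)" using True by (simp add: x_def algebra_simps)
  then have "norm x \<le> 1" using le True by (simp add: divide_simps)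
  moreover have "x\<^sup>\<star> = x" by (simp add: x_def star_diff sa)
  ultimately obtain s where s: "s\<^sup>\<star> = s" "s * s = 1 - x" "norm (1 - s) \<le> 1"
      "\<And>y. y * x = x * y \<Longrightarrow> y * s = s * y"
    using sqrt_one_minus_exists by blast
  show thesis
  proof (rule that[of "sqrt r *\<^sub>R s"])
    show "(sqrt r *\<^sub>R s) * (sqrt r *\<^sub>R s) = a" using True by (simp add: s x_def)
    show "y * sqrt r *\<^sub>R s = sqrt r *\<^sub>R s * y" if "y * a = a * y" for y
      using s(4)[of y] that by (simp add: x_def algebra_simps)
    have "sqrt r *\<^sub>R 1 - sqrt r *\<^sub>R s = sqrt r *\<^sub>R (1 - s)" by (simp add: algebra_simps)
    then show "norm (sqrt r *\<^sub>R 1 - sqrt r *\<^sub>R s) \<le> sqrt r"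
      using s(3) True by (simp add: mult_left_le)
  qed (simp add: s)
next
  case False
  then have "r = 0" using le norm_ge_zero[of "r *\<^sub>R 1 - a"] by linarith
  then have "a = 0" using le by simp
  then show thesis using that[of 0] \<open>r = 0\<close> by simp
qed

lemma spos_of_norm_le:
  "a\<^sup>\<star> = a \<Longrightarrow> norm (r *\<^sub>R 1 - a) \<le> r \<Longrightarrow> spos (a::'a::cstar_algebra)"
  by (metis sqrt_exists_of_norm_le spos_def)

text \<open>Converse of \<open>spos_of_norm_le\<close>. Since \<open>norm a \<le> r\<close>, the
  norm criterion applies to \<open>r *\<^sub>R 1 - a\<close> and yields a root \<open>g\<close>
  commuting with the root \<open>h\<close> of \<open>a\<close>; as the two squares add up to
  \<open>r\<close>, each has norm at most \<open>r\<close>.\<close>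

lemma spos_norm_le:
  fixes a :: "'a::cstar_algebra"
  assumes "spos a" "norm a \<le> r"
  shows "norm (r *\<^sub>R 1 - a) \<le> r"
proof -
  obtain h where h: "h\<^sup>\<star> = h" "a = h * h" using assms by (auto simp: spos_def)
  have sa: "(r *\<^sub>R 1 - a)\<^sup>\<star> = r *\<^sub>R 1 - a" using h by (simp add: star_diff star_mult)
  have nle: "norm (r *\<^sub>R 1 - (r *\<^sub>R 1 - a)) \<le> r" using assms by simp
  obtain g where g: "g\<^sup>\<star> = g" "g * g = r *\<^sub>R 1 - a"
      "\<And>y. y * (r *\<^sub>R 1 - a) = (r *\<^sub>R 1 - a) * y \<Longrightarrow> y * g = g * y"
    using sqrt_exists_of_norm_le[OF sa, of r] nle by blast
  have "h * g = g * h" by (rule g(3)) (simp add: h algebra_simps)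
  have r: "r \<ge> 0" using assms(2) norm_ge_zero[of a] by linarith
  have "(norm g)\<^sup>2 \<le> r"
    by (rule norm_le_of_commuting_squares[of g h]) (simp_all add: g(1,2) h(1) h(2)[symmetric] \<open>h * g = g * h\<close> r)
  then show ?thesis using norm_selfadjoint_square[OF g(1)] g(2) by simp
qed

lemma spos_sqrt:
  fixes a :: "'a::cstar_algebra"
  assumes "spos a"
  obtains s where "s\<^sup>\<star> = s" "s * s = a" "spos s" "\<And>y. y * a = a * y \<Longrightarrow> y * s = s * y"
proof -
  obtain s where s: "s\<^sup>\<star> = s" "s * s = a" "norm (sqrt (norm a) *\<^sub>R 1 - s) \<le> sqrt (norm a)"
      "\<And>y. y * a = a * y \<Longrightarrow> y * s = s * y"
    using sqrt_exists_of_norm_le[OF spos_selfadjoint[OF assms] spos_norm_le[OF assms order_refl]] by blast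
  show thesis using that[OF s(1,2) spos_of_norm_le[OF s(1,3)] s(4)] .
qed

text \<open>In the norm form of positivity this is the triangle inequality, with the radii adding
  up.\<close>

lemma spos_add: "spos a \<Longrightarrow> spos b \<Longrightarrow> spos (a + b)"
proof (rule spos_of_norm_le[of _ "norm a + norm b"])
  assume "spos a" "spos b"
  then show "(a + b)\<^sup>\<star> = a + b" by (simp add: star_add spos_selfadjoint)
  have split: "(norm a + norm b) *\<^sub>R 1 - (a + b) = (norm a *\<^sub>R 1 - a) + (norm b *\<^sub>R 1 - b)"
    by (simp add: algebra_simps)
  show "norm ((norm a + norm b) *\<^sub>R 1 - (a + b)) \<le> norm a + norm b"
    unfolding split using spos_norm_le[OF \<open>spos a\<close> order_refl] spos_norm_le[OF \<open>spos b\<close> order_refl]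
      norm_triangle_ineq[of "norm a *\<^sub>R 1 - a" "norm b *\<^sub>R 1 - b"] by linarith
qed

lemma spos_commuting_mult:
  assumes "spos a" "spos b" "a * b = b * a"
  shows "spos (a * b)"
proof -
  obtain s where s: "s\<^sup>\<star> = s" "s * s = a" "\<And>y. y * a = a * y \<Longrightarrow> y * s = s * y"
    using spos_sqrt[OF assms(1)] by blast
  obtain t where t: "t\<^sup>\<star> = t" "t * t = b" "\<And>y. y * b = b * y \<Longrightarrow> y * t = t * y"
    using spos_sqrt[OF assms(2)] by blast
  have "s * t = t * s" using s(3)[of b] t(3)[of s] assms by simp
  then have "(s * t)\<^sup>\<star> = s * t" "a * b = (s * t) * (s * t)"
    unfolding s(2)[symmetric] t(2)[symmetric] star_mult s(1) t(1) by (metis, metis mult.assoc)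
  then show ?thesis unfolding spos_def by blast
qed

lemma spos_norm_minus: "(a::'a::cstar_algebra)\<^sup>\<star> = a \<Longrightarrow> norm a \<le> r \<Longrightarrow> spos (r *\<^sub>R 1 - a)"
  by (rule spos_of_norm_le[of _ r]) (simp_all add: star_diff)

lemma spos_bounded:
  fixes a :: "'a::cstar_algebra"
  assumes "spos a" "spos (r *\<^sub>R 1 - a)" "r \<ge> 0"
  shows "norm a \<le> r"
proof -
  obtain h where h: "h\<^sup>\<star> = h" "a = h * h" using assms by (auto simp: spos_def)
  obtain g where g: "g\<^sup>\<star> = g" "g * g = r *\<^sub>R 1 - a"
      "\<And>y. y * (r *\<^sub>R 1 - a) = (r *\<^sub>R 1 - a) * y \<Longrightarrow> y * g = g * y"
    using spos_sqrt[OF assms(2)] by blast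
  have "h * g = g * h" by (rule g(3)) (simp add: h algebra_simps)
  then have "(norm h)\<^sup>2 \<le> r"
    by (intro norm_le_of_commuting_squares[of h g]) (simp_all add: g(1,2) h(1) h(2)[symmetric] assms(3))
  then show ?thesis using norm_selfadjoint_square[OF h(1)] h(2) by metis
qed

lemma spos_norm_mono:
  fixes a b :: "'a::cstar_algebra"
  assumes "spos a" "spos (b - a)"
  shows "norm a \<le> norm b"
proof (rule spos_bounded[OF assms(1)])
  have "b\<^sup>\<star> = b" using assms spos_selfadjoint
    by (metis diff_add_cancel star_add)
  then have "spos (norm b *\<^sub>R 1 - b + (b - a))"
    using spos_add spos_norm_minus assms by blast
  then show "spos (norm b *\<^sub>R 1 - a)" by simp
qed simp

lemma selfadjoint_square_spos: "(h::'a::cstar_algebra)\<^sup>\<star> = h \<Longrightarrow> spos (h * h)"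
  by (auto simp: spos_def)

text \<open>With \<open>b = - y\<^sup>\<star> y\<close> and \<open>c = y y\<^sup>\<star>\<close> both positive, \<open>z = y (N - b) = (N + c) y\<close> is at the same time
  not longer and considerably longer than \<open>N y\<close>.\<close>

lemma star_mult_self_neg_spos_imp_zero:
  fixes y :: "'a::cstar_algebra"
  assumes "spos (- (y\<^sup>\<star> * y))"
  shows "y = 0"
proof -
  \<comment> \<open>Real and imaginary parts of \<open>y\<close>. Their squares express
    \<open>y\<^sup>\<star> * y + y * y\<^sup>\<star>\<close>, which makes \<open>c\<close> a sum of
    positive elements once \<open>b\<close> is positive.\<close>
  define h k where "h = (1/2) *\<^sub>R (y + y\<^sup>\<star>)" and "k = (-\<i>/2) *\<^sub>C (y - y\<^sup>\<star>)"
  define b c N where "b = - (y\<^sup>\<star> * y)" and "c = y * y\<^sup>\<star>" and "N = (norm y)\<^sup>2"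
  have hs: "h\<^sup>\<star> = h" by (simp add: h_def star_add add.commute)
  have ks: "k\<^sup>\<star> = k"
    by (simp add: k_def star_scaleC star_diff complex_vector.scale_right_diff_distrib)
  have h4: "4 *\<^sub>R (h * h) = (y + y\<^sup>\<star>) * (y + y\<^sup>\<star>)" by (simp add: h_def)
  have k4: "4 *\<^sub>R (k * k) = - ((y - y\<^sup>\<star>) * (y - y\<^sup>\<star>))"
    by (simp add: k_def mult_scaleC_left mult_scaleC_right scaleC_scaleC scaleR_scaleC power2_eq_square)
  have "4 *\<^sub>R (h * h + k * k) = 2 *\<^sub>R (y\<^sup>\<star> * y + y * y\<^sup>\<star>)"
    unfolding scaleR_add_right h4 k4 by (simp add: algebra_simps scaleR_2)
  then have "2 *\<^sub>R (2 *\<^sub>R (h * h + k * k)) = 2 *\<^sub>R (y\<^sup>\<star> * y + y * y\<^sup>\<star>)" by simp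
  then have "2 *\<^sub>R (h * h + k * k) = y\<^sup>\<star> * y + y * y\<^sup>\<star>"
    by (metis scaleR_left_imp_eq zero_neq_numeral)
  then have c_eq: "c = 2 *\<^sub>R (h * h + k * k) + b" by (simp add: b_def c_def)
  have c: "spos c" unfolding c_eq
    by (intro spos_add spos_scaleR selfadjoint_square_spos hs ks) (simp_all add: b_def assms)
  have cN: "norm c = N" by (simp add: c_def N_def cstar_identity')
  have bN: "norm b = N" by (simp add: b_def N_def cstar_identity)
  define z where "z = y * (N *\<^sub>R 1 - b)"
  have z2: "z = (N *\<^sub>R 1 + c) * y" by (simp add: z_def b_def c_def algebra_simps)
  have "norm z \<le> norm y * N" unfolding z_def
    using norm_mult_ineq[of y "N *\<^sub>R 1 - b"] spos_norm_le[OF assms, of N] bN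
    by (metis b_def mult_left_mono norm_ge_zero order_refl order_trans)
  then have "(norm z)\<^sup>2 \<le> (norm y * N)\<^sup>2" by (simp add: power_mono)
  then have up: "norm (z * z\<^sup>\<star>) \<le> N * N * N"
    by (simp add: cstar_identity' power_mult_distrib N_def power2_eq_square algebra_simps)
  have cs: "c\<^sup>\<star> = c" using c by (rule spos_selfadjoint)
  \<comment> \<open>All three terms are positive, and the first alone has norm
    \<open>2 * N * N * N\<close>, twice the upper bound just found.\<close>
  have zz: "z * z\<^sup>\<star> = (2 * N) *\<^sub>R (c * c) + ((N * N) *\<^sub>R c + c * (c * c))"
  proof -
    have "z * z\<^sup>\<star> = (N *\<^sub>R 1 + c) * (y * y\<^sup>\<star>) * (N *\<^sub>R 1 + c)"
      by (simp add: z2 star_mult star_add cs mult.assoc)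
    moreover have "(2 * N) *\<^sub>R (c * c) = N *\<^sub>R (c * c) + N *\<^sub>R (c * c)"
      by (simp add: scaleR_left_distrib[symmetric])
    ultimately show ?thesis unfolding c_def[symmetric] by (simp add: algebra_simps)
  qed
  have N0: "N \<ge> 0" by (simp add: N_def)
  have "spos (c * c)" using cs by (rule selfadjoint_square_spos)
  then have "spos ((N * N) *\<^sub>R c + c * (c * c))" using c N0
    by (intro spos_add spos_scaleR spos_commuting_mult) (auto simp: mult.assoc)
  then have "norm ((2 * N) *\<^sub>R (c * c)) \<le> norm (z * z\<^sup>\<star>)"
    using N0 \<open>spos (c * c)\<close> by (intro spos_norm_mono) (auto simp: zz intro: spos_scaleR)
  then have "2 * N * (N * N) \<le> N * N * N"
    using up N0 norm_selfadjoint_square[OF cs] by (simp add: cN power2_eq_square)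
  then have "N * N * N \<le> 0" by (simp add: mult.assoc)
  then have "\<not> N > 0" by (meson linorder_not_less mult_pos_pos)
  then have "N = 0" using N0 by simp
  then show ?thesis by (simp add: N_def)
qed

text \<open>Kelley--Vaught; \<open>m = \<bar>a\<bar> - a\<close> is twice the negative part of \<open>a = x\<^sup>\<star> x\<close>, and the previous lemma
  shows \<open>x m = 0\<close>.\<close>

lemma star_mult_self_spos: "spos (x\<^sup>\<star> * (x::'a::cstar_algebra))"
proof -
  define a where "a = x\<^sup>\<star> * x"
  have as: "a\<^sup>\<star> = a" by (simp add: a_def star_mult)
  obtain p where p: "p\<^sup>\<star> = p" "p * p = a * a" "spos p" "\<And>y. y * (a * a) = a * a * y \<Longrightarrow> y * p = p * y"
    using spos_sqrt[OF selfadjoint_square_spos[OF as]] by blast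
  have ap: "a * p = p * a" by (rule p(4)) (simp add: mult.assoc)
  define m where "m = p - a"
  have ms: "m\<^sup>\<star> = m" by (simp add: m_def star_diff p as)
  have am: "a * m = - (p * m)" by (simp add: m_def algebra_simps p ap)
  have pm: "p * m = m * p" by (simp add: m_def algebra_simps ap)
  have "(x * m)\<^sup>\<star> * (x * m) = m * (a * m)" by (simp add: star_mult ms a_def mult.assoc)
  also have "\<dots> = - (p * (m * m))" by (metis am mult.assoc mult_minus_right pm)
  finally have y: "(x * m)\<^sup>\<star> * (x * m) = - (p * (m * m))" .
  have "p * (m * m) = m * m * p" by (metis mult.assoc pm)
  then have "spos (p * (m * m))"
    by (rule spos_commuting_mult[OF p(3) selfadjoint_square_spos[OF ms]])
  then have xm: "x * m = 0" using star_mult_self_neg_spos_imp_zero[of "x * m"] y by simp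
  then have am0: "a * m = 0" by (simp add: a_def mult.assoc)
  then have "p * m = 0" using am by simp
  then have "m * m = 0" using am0 unfolding m_def by (simp add: left_diff_distrib)
  then have "m = 0" using norm_selfadjoint_square[OF ms] by simp
  then show ?thesis using p(3) by (simp add: m_def a_def)
qed

lemma cstar_positive_iff_spos: "cstar_positive a \<longleftrightarrow> spos a"
  unfolding cstar_positive_def using star_mult_self_spos by (metis spos_def)

lemma cstar_positive_star_mult [simp]: "cstar_positive (x\<^sup>\<star> * x)"
  by (auto simp: cstar_positive_def)

lemma cstar_positive_mult_star [simp]: "cstar_positive (x * x\<^sup>\<star>)"
  using cstar_positive_star_mult[of "x\<^sup>\<star>"] by simp

lemma cstar_positive_selfadjoint: "cstar_positive a \<Longrightarrow> a\<^sup>\<star> = a"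
  by (simp add: cstar_positive_iff_spos spos_selfadjoint)

lemma cstar_positive_add: "cstar_positive a \<Longrightarrow> cstar_positive b \<Longrightarrow> cstar_positive (a + b)"
  by (simp add: cstar_positive_iff_spos spos_add)

lemma cstar_positive_scaleR: "cstar_positive a \<Longrightarrow> r \<ge> 0 \<Longrightarrow> cstar_positive (r *\<^sub>R a)"
  by (simp add: cstar_positive_iff_spos spos_scaleR)

lemma cstar_positive_zero [simp]: "cstar_positive 0"
  using cstar_positive_star_mult[of 0] by simp

lemma cstar_positive_sum: "(\<And>i. i \<in> A \<Longrightarrow> cstar_positive (f i)) \<Longrightarrow> cstar_positive (sum f A)"
  by (induction A rule: infinite_finite_induct) (auto intro: cstar_positive_add)

lemma cstar_positive_conj: "cstar_positive a \<Longrightarrow> cstar_positive (z\<^sup>\<star> * a * z)"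
  unfolding cstar_positive_def
proof -
  assume "\<exists>y. a = y\<^sup>\<star> * y"
  then obtain y where "a = y\<^sup>\<star> * y" by blast
  then have "z\<^sup>\<star> * a * z = (y * z)\<^sup>\<star> * (y * z)" by (simp add: star_mult mult.assoc)
  then show "\<exists>y. z\<^sup>\<star> * a * z = y\<^sup>\<star> * y" by blast
qed

lemma cstar_positive_norm_minus:
  "a\<^sup>\<star> = a \<Longrightarrow> norm a \<le> r \<Longrightarrow> cstar_positive (r *\<^sub>R 1 - (a::'a::cstar_algebra))"
  by (simp add: cstar_positive_iff_spos spos_norm_minus)

lemma cstar_positive_norm_mono:
  "cstar_positive a \<Longrightarrow> cstar_positive (b - a) \<Longrightarrow> norm a \<le> norm (b::'a::cstar_algebra)"
  unfolding cstar_positive_iff_spos by (rule spos_norm_mono)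

lemma cstar_positive_norm_le:
  "cstar_positive a \<Longrightarrow> cstar_positive (r *\<^sub>R 1 - a) \<Longrightarrow> r \<ge> 0 \<Longrightarrow> norm (a::'a::cstar_algebra) \<le> r"
  unfolding cstar_positive_iff_spos by (rule spos_bounded)

lemma cstar_positive_one [simp]: "cstar_positive (1::'a::cstar_algebra)"
  using cstar_positive_star_mult[of "1::'a"] by simp

lemma cstar_positive_scaleR_one_iff: "cstar_positive (r *\<^sub>R (1::'a::cstar_algebra)) \<longleftrightarrow> r \<ge> 0"
proof
  assume pos: "cstar_positive (r *\<^sub>R (1::'a))"
  show "r \<ge> 0"
  proof (rule ccontr)
    assume "\<not> r \<ge> 0"
    then have "norm (r *\<^sub>R (1::'a)) \<le> 0"
      using cstar_positive_scaleR[of "1::'a" "- r"]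
      by (intro cstar_positive_norm_le[OF pos]) simp_all
    then show False using \<open>\<not> r \<ge> 0\<close> by simp
  qed
qed (simp add: cstar_positive_scaleR)

text \<open>The norm of a positive element belongs to its spectrum, here relative to the corner of \<open>q\<close>.\<close>

lemma positive_no_gap_at_norm:
  fixes q x :: "'a::cstar_algebra"
  assumes q: "q\<^sup>\<star> = q" "q * q = q" and x: "cstar_positive x" "x * q = x" "q * x = x" "x \<noteq> 0"
    and d: "d > 0"
    and gap: "cstar_positive ((norm x *\<^sub>R q - x) * (norm x *\<^sub>R q - x) - d *\<^sub>R q)"
  shows False
proof -
  define N a where "N = norm x" and "a = N *\<^sub>R q - x"
  have N: "N > 0" using x by (simp add: N_def)
  have xs: "x\<^sup>\<star> = x" using x by (simp add: cstar_positive_selfadjoint)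
  have "a = q\<^sup>\<star> * (N *\<^sub>R 1 - x) * q" by (simp add: a_def q x algebra_simps)
  then have a: "cstar_positive a"
    using cstar_positive_conj[OF cstar_positive_norm_minus[OF xs]] by (simp add: N_def)
  have "a * x = x * a" by (simp add: a_def x algebra_simps)
  then have ax: "cstar_positive (a * x)"
    using a x(1) spos_commuting_mult unfolding cstar_positive_iff_spos by blast
  \<comment> \<open>As \<open>a * x\<close> is positive, the gap for \<open>a * a\<close> passes to
    \<open>a\<close> itself with constant \<open>d / N\<close>, so \<open>x\<close> lies below
    \<open>(N - d / N) *\<^sub>R q\<close>.\<close>
  have "N *\<^sub>R a - d *\<^sub>R q = (a * a - d *\<^sub>R q) + a * x"
    by (simp add: a_def x q algebra_simps)
  then have "cstar_positive (N *\<^sub>R a - d *\<^sub>R q)"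
    using gap ax unfolding a_def N_def by (metis cstar_positive_add)
  then have 1: "cstar_positive ((1/N) *\<^sub>R (N *\<^sub>R a - d *\<^sub>R q))"
    using N by (intro cstar_positive_scaleR) simp_all
  \<comment> \<open>The maximum with 0 keeps \<open>c\<close> admissible as a norm bound when
    \<open>N - d / N\<close> is negative.\<close>
  define c where "c = max 0 (N - d / N)"
  have "(1 - q)\<^sup>\<star> * (1 - q) = 1 - q" by (simp add: star_diff q algebra_simps)
  then have q1: "cstar_positive (1 - q)" by (metis cstar_positive_star_mult)
  have q2: "cstar_positive q" using q by (metis cstar_positive_star_mult)
  have "c *\<^sub>R 1 - x = (1/N) *\<^sub>R (N *\<^sub>R a - d *\<^sub>R q) + (c - (N - d / N)) *\<^sub>R q + c *\<^sub>R (1 - q)"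
    using N by (simp add: a_def algebra_simps)
  moreover have "cstar_positive \<dots>"
    by (intro cstar_positive_add 1 cstar_positive_scaleR q1 q2) (simp_all add: c_def)
  ultimately have "norm x \<le> c" using x(1) by (intro cstar_positive_norm_le) (simp_all add: c_def)
  moreover have "c < N" using N d by (simp add: c_def)
  ultimately show False by (simp add: N_def)
qed

section \<open>Subalgebras and centres\<close>

lemma closure_binop:
  fixes f :: "'a::topological_space \<Rightarrow> 'b::topological_space \<Rightarrow> 'c::topological_space"
  assumes "continuous_on UNIV (\<lambda>p. f (fst p) (snd p))"
    and "\<And>x y. x \<in> S \<Longrightarrow> y \<in> T \<Longrightarrow> f x y \<in> closure U"
    and "x \<in> closure S" "y \<in> closure T"
  shows "f x y \<in> closure U"
proof -
  have "(\<lambda>p. f (fst p) (snd p)) ` closure (S \<times> T) \<subseteq> closure U"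
    by (rule image_closure_subset)
      (use assms(2) in \<open>auto intro: continuous_on_subset[OF assms(1)]\<close>)
  then show ?thesis using assms(3,4) by (force simp: closure_Times)
qed

lemma complex_subspace_closure:
  fixes S :: "'a::cstar_algebra set"
  assumes "complex_vector.subspace S"
  shows "complex_vector.subspace (closure S)"
proof (rule complex_vector.subspaceI)
  show "0 \<in> closure S" using assms complex_vector.subspace_0 closure_subset by blast
  show "x + y \<in> closure S" if "x \<in> closure S" "y \<in> closure S" for x y
    by (rule closure_binop[OF _ _ that])
      (auto intro!: continuous_intros complex_vector.subspace_add[OF assms] closure_subset[THEN subsetD])
  show "c *\<^sub>C x \<in> closure S" if "x \<in> closure S" for c x
  proof -
    have "scaleC c ` closure S \<subseteq> closure (scaleC c ` S)"
      by (rule closure_bounded_linear_image_subset[OF bounded_linear_scaleC])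
    also have "\<dots> \<subseteq> closure S"
      by (rule closure_mono) (use assms complex_vector.subspace_scale in auto)
    finally show ?thesis using that by blast
  qed
qed

context
  fixes S :: "'a::cstar_algebra set"
  assumes S: "unital_cstar_subalgebra S"
begin

lemma subalgebra_one: "1 \<in> S"
  and subalgebra_subspace: "complex_vector.subspace S"
  and subalgebra_mult: "x \<in> S \<Longrightarrow> y \<in> S \<Longrightarrow> x * y \<in> S"
  and subalgebra_star: "x \<in> S \<Longrightarrow> x\<^sup>\<star> \<in> S"
  and subalgebra_closed: "closed S"
  using S by (auto simp: unital_cstar_subalgebra_def)

lemma subalgebra_zero: "0 \<in> S"
  and subalgebra_add: "x \<in> S \<Longrightarrow> y \<in> S \<Longrightarrow> x + y \<in> S"
  and subalgebra_diff: "x \<in> S \<Longrightarrow> y \<in> S \<Longrightarrow> x - y \<in> S"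
  and subalgebra_scaleC: "x \<in> S \<Longrightarrow> c *\<^sub>C x \<in> S"
  and subalgebra_scaleR: "x \<in> S \<Longrightarrow> r *\<^sub>R x \<in> S"
  and subalgebra_sum: "(\<And>i. i \<in> I \<Longrightarrow> f i \<in> S) \<Longrightarrow> sum f I \<in> S"
  using subalgebra_subspace
  by (auto simp: scaleR_scaleC intro: complex_vector.subspace_0 complex_vector.subspace_add
      complex_vector.subspace_diff complex_vector.subspace_scale complex_vector.subspace_sum)

lemmas subalgebra_closure_rules = subalgebra_zero subalgebra_one subalgebra_mult subalgebra_star
  subalgebra_add subalgebra_diff subalgebra_scaleC subalgebra_scaleR subalgebra_sum

text \<open>The closed ideal generated by \<open>norm x - x\<close> is proper, hence zero.\<close>

lemma positive_central_eq_norm: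
  assumes simple: "simple_cstar_algebra S" and x: "x \<in> S" "\<And>s. s \<in> S \<Longrightarrow> x * s = s * x"
    and pos: "cstar_positive x"
  shows "x = norm x *\<^sub>R 1"
proof (cases "x = 0")
  case False
  define a where "a = norm x *\<^sub>R 1 - x"
  have aS: "a \<in> S" by (simp add: a_def x subalgebra_closure_rules)
  have ac: "a * s = s * a" if "s \<in> S" for s
    using x(2)[OF that] by (simp add: a_def algebra_simps)
  have as: "a\<^sup>\<star> = a" using cstar_positive_selfadjoint[OF pos] by (simp add: a_def star_diff)
  define I where "I = closure ((*) a ` S)"
  have "closed_ideal S I"
    unfolding closed_ideal_def
  proof (intro conjI ballI)
    show "I \<subseteq> S" unfolding I_def
      by (rule closure_minimal) (use aS in \<open>auto intro: subalgebra_closure_rules subalgebra_closed\<close>)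
    show "complex_vector.subspace I" unfolding I_def
    proof (intro complex_subspace_closure complex_vector.subspaceI)
      show "0 \<in> (*) a ` S" using subalgebra_zero by (metis imageI mult_zero_right)
      show "u + v \<in> (*) a ` S" if "u \<in> (*) a ` S" "v \<in> (*) a ` S" for u v
        using that by (auto simp: distrib_left[symmetric] intro: subalgebra_add)
      show "c *\<^sub>C u \<in> (*) a ` S" if "u \<in> (*) a ` S" for c u
        using that by (auto simp: mult_scaleC_right[symmetric] intro: subalgebra_scaleC)
    qed
    show "closed I" by (simp add: I_def)
    fix s u assume s: "s \<in> S" and u: "u \<in> I"
    have "(*) s ` closure ((*) a ` S) \<subseteq> closure ((*) s ` (*) a ` S)"
      by (rule closure_bounded_linear_image_subset[OF bounded_linear_mult_right])
    also have "\<dots> \<subseteq> I" unfolding I_def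
    proof (rule closure_mono, safe)
      fix t assume "t \<in> S"
      then have "s * (a * t) = a * (s * t)" using ac[OF s] by (metis mult.assoc)
      then show "s * (a * t) \<in> (*) a ` S" using s \<open>t \<in> S\<close> subalgebra_mult by auto
    qed
    finally show "s * u \<in> I" using u by (auto simp: I_def)
    have "(\<lambda>u. u * s) ` closure ((*) a ` S) \<subseteq> closure ((\<lambda>u. u * s) ` (*) a ` S)"
      by (rule closure_bounded_linear_image_subset[OF bounded_linear_mult_left])
    also have "\<dots> \<subseteq> I" unfolding I_def
      by (rule closure_mono) (use s subalgebra_mult in \<open>auto simp: mult.assoc\<close>)
    finally show "u * s \<in> I" using u by (auto simp: I_def)
  qed
  then consider "I = {0}" | "I = S" using simple unfolding simple_cstar_algebra_def by blast
  then show ?thesis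
  proof cases
    case 1
    have "a * 1 \<in> I" unfolding I_def
      by (rule subsetD[OF closure_subset imageI[OF subalgebra_one]])
    then show ?thesis using 1 by (simp add: a_def)
  next
    case 2
    then have "1 \<in> closure ((*) a ` S)" using subalgebra_one I_def by simp
    then obtain b where b: "b \<in> S" "dist (a * b) 1 < 1/2"
      unfolding closure_approachable by (metis half_gt_zero_iff imageE zero_less_one)
    \<comment> \<open>An approximate inverse \<open>b\<close> bounds \<open>a * a\<close> from
      below: \<open>u + e = 1\<close> and the parallelogram law give
      \<open>1 \<le> 2 u\<^sup>\<star>u + 2 e\<^sup>\<star>e\<close>, where
      \<open>e\<^sup>\<star>e \<le> 1/4\<close> and \<open>u\<^sup>\<star>u \<le> K a a\<close>.
      Hence the gap \<open>1 / (4 * K)\<close>; the summand 1 in \<open>K\<close> keeps it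
      positive.\<close>
    define u e K where "u = a * b" and "e = 1 - a * b" and "K = (norm b)\<^sup>2 + 1"
    have K: "K > 0" unfolding K_def by (simp add: add_nonneg_pos)
    have "norm e < 1/2" using b by (simp add: e_def dist_norm norm_minus_commute)
    then have "(norm e)\<^sup>2 \<le> (1/2)\<^sup>2" by (intro power_mono) simp_all
    then have "norm (e\<^sup>\<star> * e) \<le> 1/4" by (simp add: cstar_identity power2_eq_square)
    then have 1: "cstar_positive ((1/4) *\<^sub>R 1 - e\<^sup>\<star> * e)"
      by (intro cstar_positive_norm_minus) (simp_all add: star_mult)
    have "norm (b\<^sup>\<star> * b) \<le> K" by (simp add: cstar_identity K_def)
    then have "cstar_positive (K *\<^sub>R 1 - b\<^sup>\<star> * b)"
      by (intro cstar_positive_norm_minus) (simp_all add: star_mult)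
    then have 2: "cstar_positive (a\<^sup>\<star> * (K *\<^sub>R 1 - b\<^sup>\<star> * b) * a)"
      by (rule cstar_positive_conj)
    have uu: "u\<^sup>\<star> * u = a * (b\<^sup>\<star> * b) * a"
      unfolding u_def star_mult as using ac b subalgebra_star by (metis mult.assoc)
    have ue: "u + e = 1" by (simp add: u_def e_def)
    have "cstar_positive ((u - e)\<^sup>\<star> * (u - e))" by simp
    moreover have "(u - e)\<^sup>\<star> * (u - e) = 2 *\<^sub>R (u\<^sup>\<star> * u) + 2 *\<^sub>R (e\<^sup>\<star> * e) - (u + e)\<^sup>\<star> * (u + e)"
      by (simp add: star_add star_diff algebra_simps scaleR_2)
    ultimately have 3: "cstar_positive (2 *\<^sub>R (u\<^sup>\<star> * u) + 2 *\<^sub>R (e\<^sup>\<star> * e) - 1)" by (simp add: ue)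
    have half: "(1/2) *\<^sub>R 1 + (1/2) *\<^sub>R 1 = (1::'a)" by (simp add: scaleR_left_distrib[symmetric])
    have "(2 * K) *\<^sub>R (a * a) - (1/2) *\<^sub>R 1 = 2 *\<^sub>R (a\<^sup>\<star> * (K *\<^sub>R 1 - b\<^sup>\<star> * b) * a)
        + (2 *\<^sub>R (u\<^sup>\<star> * u) + 2 *\<^sub>R (e\<^sup>\<star> * e) - 1) + 2 *\<^sub>R ((1/4) *\<^sub>R 1 - e\<^sup>\<star> * e)"
      unfolding uu as by (simp add: algebra_simps scaleR_2 half)
    then have "cstar_positive ((2 * K) *\<^sub>R (a * a) - (1/2) *\<^sub>R 1)"
      using 1 2 3 by (simp only:) (intro cstar_positive_add cstar_positive_scaleR; simp)
    then have "cstar_positive ((1 / (2 * K)) *\<^sub>R ((2 * K) *\<^sub>R (a * a) - (1/2) *\<^sub>R 1))"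
      by (rule cstar_positive_scaleR) (use K in simp)
    then have "cstar_positive (a * a - (1 / (4 * K)) *\<^sub>R 1)"
      using K by (simp add: scaleR_diff_right)
    then have False
      using positive_no_gap_at_norm[of 1 x "1 / (4 * K)"] pos False K by (simp add: a_def)
    then show ?thesis ..
  qed
qed simp

text \<open>A selfadjoint central element becomes positive after adding its norm, where
  \<open>positive_central_eq_norm\<close> applies; a general one is assembled from
  \<open>x + x\<^sup>\<star>\<close> and \<open>\<i> *\<^sub>C (x - x\<^sup>\<star>)\<close>.
  Simplicity enters the later arguments in this form.\<close>

lemma central_imp_scalar:
  assumes simple: "simple_cstar_algebra S" and x: "x \<in> S" "\<And>s. s \<in> S \<Longrightarrow> x * s = s * x"
  shows "\<exists>c. x = c *\<^sub>C 1"
proof -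
  have sa: "\<exists>r. h = complex_of_real r *\<^sub>C 1"
    if h: "h \<in> S" "\<And>s. s \<in> S \<Longrightarrow> h * s = s * h" "h\<^sup>\<star> = h" for h
  proof -
    let ?y = "norm h *\<^sub>R 1 - (- h)"
    have "cstar_positive ?y" by (rule cstar_positive_norm_minus) (simp_all add: h)
    moreover have "?y * s = s * ?y" if "s \<in> S" for s using h(2)[OF that] by (simp add: algebra_simps)
    moreover have "?y \<in> S" using h subalgebra_closure_rules by simp
    ultimately have "?y = norm ?y *\<^sub>R 1" using positive_central_eq_norm[OF simple] by blast
    then have "h = (norm ?y - norm h) *\<^sub>R 1" by (simp add: algebra_simps)
    then show ?thesis unfolding scaleR_scaleC by blast
  qed
  have xs: "x\<^sup>\<star> * s = s * x\<^sup>\<star>" if "s \<in> S" for s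
    using x(2)[of "s\<^sup>\<star>"] subalgebra_star[OF that] by (metis star_mult star_star)
  obtain r where r: "x + x\<^sup>\<star> = complex_of_real r *\<^sub>C 1"
  proof -
    have "(x + x\<^sup>\<star>) * s = s * (x + x\<^sup>\<star>)" if "s \<in> S" for s
      using x(2)[OF that] xs[OF that] by (simp add: algebra_simps)
    moreover have "x + x\<^sup>\<star> \<in> S" by (intro subalgebra_closure_rules x)
    moreover have "(x + x\<^sup>\<star>)\<^sup>\<star> = x + x\<^sup>\<star>" by (simp add: star_add add.commute)
    ultimately show thesis using sa[of "x + x\<^sup>\<star>"] that by metis
  qed
  obtain t where t: "\<i> *\<^sub>C (x - x\<^sup>\<star>) = complex_of_real t *\<^sub>C 1"
  proof -
    have "(\<i> *\<^sub>C (x - x\<^sup>\<star>)) * s = s * (\<i> *\<^sub>C (x - x\<^sup>\<star>))" if "s \<in> S" for s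
      using x(2)[OF that] xs[OF that] by (simp add: mult_scaleC_left mult_scaleC_right algebra_simps)
    moreover have "(\<i> *\<^sub>C (x - x\<^sup>\<star>))\<^sup>\<star> = \<i> *\<^sub>C (x - x\<^sup>\<star>)"
      by (simp add: star_scaleC star_diff complex_vector.scale_right_diff_distrib)
    moreover have "\<i> *\<^sub>C (x - x\<^sup>\<star>) \<in> S" by (intro subalgebra_closure_rules x)
    ultimately show thesis using sa[of "\<i> *\<^sub>C (x - x\<^sup>\<star>)"] that by metis
  qed
  have "2 *\<^sub>R x = (x + x\<^sup>\<star>) + (x - x\<^sup>\<star>)" by (simp add: scaleR_2)
  also have "x - x\<^sup>\<star> = (- \<i>) *\<^sub>C (\<i> *\<^sub>C (x - x\<^sup>\<star>))" by (simp add: scaleC_scaleC)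
  also have "(x + x\<^sup>\<star>) + (- \<i>) *\<^sub>C (\<i> *\<^sub>C (x - x\<^sup>\<star>)) = (complex_of_real r - \<i> * complex_of_real t) *\<^sub>C 1"
    unfolding r t by (simp add: scaleC_scaleC complex_vector.scale_left_diff_distrib)
  finally have "(1/2) *\<^sub>R (2 *\<^sub>R x) = ((1/2) * (complex_of_real r - \<i> * complex_of_real t)) *\<^sub>C 1"
    by (simp add: scaleR_scaleC scaleC_scaleC)
  then have "x = ((1/2) * (complex_of_real r - \<i> * complex_of_real t)) *\<^sub>C 1" by simp
  then show ?thesis by (rule exI)
qed

end

section \<open>Conditional expectations of finite index\<close>

locale cond_exp =
  fixes B :: "'a::cstar_algebra set" and E :: "'a \<Rightarrow> 'a"
  assumes B: "unital_cstar_subalgebra B" and E: "conditional_expectation B E"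
begin

lemma E_add: "E (x + y) = E x + E y" and E_scaleC: "E (c *\<^sub>C x) = c *\<^sub>C E x"
  using E Vector_Spaces.linear.axioms(3) unfolding conditional_expectation_def
  by (metis module_hom.add module_hom_iff_linear, metis module_hom.scale module_hom_iff_linear)

lemma E_zero [simp]: "E 0 = 0" using E_scaleC[of 0 0] by simp

lemma E_scaleR: "E (r *\<^sub>R x) = r *\<^sub>R E x" by (simp add: scaleR_scaleC E_scaleC)

lemma E_minus: "E (- x) = - E x" using E_scaleR[of "-1" x] by simp

lemma E_diff: "E (x - y) = E x - E y" using E_add[of x "- y"] by (simp add: E_minus)

lemma E_sum: "E (sum f I) = (\<Sum>i\<in>I. E (f i))"
  by (induction I rule: infinite_finite_induct) (simp_all add: E_add)

lemma E_in: "E x \<in> B" and E_fix: "b \<in> B \<Longrightarrow> E b = b"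
  and E_positive: "cstar_positive x \<Longrightarrow> cstar_positive (E x)"
  using E unfolding conditional_expectation_def by blast+

lemma E_one [simp]: "E 1 = 1"
  by (rule E_fix[OF subalgebra_one[OF B]])

lemma E_bimodule: "b \<in> B \<Longrightarrow> c \<in> B \<Longrightarrow> E (b * x * c) = b * E x * c"
  using E unfolding conditional_expectation_def by blast

lemma E_left: "b \<in> B \<Longrightarrow> E (b * x) = b * E x"
  and E_right: "b \<in> B \<Longrightarrow> E (x * b) = E x * b"
  using E_bimodule[of b 1 x] E_bimodule[of 1 b x] subalgebra_one[OF B] by simp_all

text \<open>Preservation of adjoints comes from positivity: \<open>norm h *\<^sub>R 1 - h\<close> is
  positive, so its image is selfadjoint.\<close>

lemma E_selfadjoint: "h\<^sup>\<star> = h \<Longrightarrow> (E h)\<^sup>\<star> = E h"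
proof -
  assume h: "h\<^sup>\<star> = h"
  have "cstar_positive (E (norm h *\<^sub>R 1 - h))"
    by (intro E_positive cstar_positive_norm_minus h order_refl)
  then have "(norm h *\<^sub>R 1 - E h)\<^sup>\<star> = norm h *\<^sub>R 1 - E h"
    using cstar_positive_selfadjoint by (simp add: E_diff E_scaleR)
  then show ?thesis by (simp add: star_diff)
qed

lemma E_star: "E (x\<^sup>\<star>) = (E x)\<^sup>\<star>"
proof -
  have "(E (x + x\<^sup>\<star>))\<^sup>\<star> = E (x + x\<^sup>\<star>)"
    by (rule E_selfadjoint) (simp add: star_add add.commute)
  then have 1: "(E x)\<^sup>\<star> + (E (x\<^sup>\<star>))\<^sup>\<star> = E x + E (x\<^sup>\<star>)" by (simp add: E_add star_add)
  have "(E (\<i> *\<^sub>C (x - x\<^sup>\<star>)))\<^sup>\<star> = E (\<i> *\<^sub>C (x - x\<^sup>\<star>))"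
    by (rule E_selfadjoint) (simp add: star_scaleC star_diff complex_vector.scale_right_diff_distrib)
  then have "\<i> *\<^sub>C (\<i> *\<^sub>C (E x - E (x\<^sup>\<star>))) = \<i> *\<^sub>C ((- \<i>) *\<^sub>C ((E x)\<^sup>\<star> - (E (x\<^sup>\<star>))\<^sup>\<star>))"
    by (simp add: E_scaleC E_diff star_scaleC star_diff)
  then have 2: "(E x)\<^sup>\<star> - (E (x\<^sup>\<star>))\<^sup>\<star> = - (E x - E (x\<^sup>\<star>))" by (simp add: scaleC_scaleC)
  have "2 *\<^sub>R E (x\<^sup>\<star>) = 2 *\<^sub>R (E x)\<^sup>\<star>"
    using arg_cong2[OF 1 2, of "(+)"] by (simp add: scaleR_2)
  then show ?thesis by (simp add: scaleR_left_imp_eq)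
qed

lemma E_norm_positive:
  assumes "cstar_positive a"
  shows "norm (E a) \<le> norm a"
proof -
  have "cstar_positive (E (norm a *\<^sub>R 1 - a))"
    by (intro E_positive cstar_positive_norm_minus cstar_positive_selfadjoint assms order_refl)
  then show ?thesis
    by (intro cstar_positive_norm_le E_positive assms) (simp_all add: E_diff E_scaleR)
qed

lemma E_norm_selfadjoint:
  assumes h: "h\<^sup>\<star> = h"
  shows "norm (E h) \<le> 3 * norm h"
proof -
  have "cstar_positive (norm h *\<^sub>R 1 - (- h))" by (intro cstar_positive_norm_minus) (simp_all add: h)
  then have "norm (E (norm h *\<^sub>R 1 + h)) \<le> norm (norm h *\<^sub>R 1 + h)"
    using E_norm_positive by simp
  also have "\<dots> \<le> norm (norm h *\<^sub>R (1::'a)) + norm h" by (rule norm_triangle_ineq)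
  finally have "norm (norm h *\<^sub>R 1 + E h) \<le> 2 * norm h" by (simp add: E_add E_scaleR)
  moreover have "norm (E h) \<le> norm (norm h *\<^sub>R 1 + E h) + norm (norm h *\<^sub>R (1::'a))"
    using norm_triangle_ineq4[of "norm h *\<^sub>R 1 + E h" "norm h *\<^sub>R 1"] by simp
  ultimately show ?thesis by simp
qed

text \<open>The constant is crude: the factor 3 for selfadjoint elements is applied to
  \<open>x + x\<^sup>\<star>\<close> and to \<open>x - x\<^sup>\<star>\<close>. Continuity is what
  the later density argument uses.\<close>

lemma bounded_linear_E: "bounded_linear E"
proof (rule bounded_linear_intro[where K = 6])
  show "norm (E x) \<le> norm x * 6" for x
  proof -
    have 1: "norm (E (x + x\<^sup>\<star>)) \<le> 3 * norm (x + x\<^sup>\<star>)"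
      by (rule E_norm_selfadjoint) (simp add: star_add add.commute)
    have "norm (E (\<i> *\<^sub>C (x - x\<^sup>\<star>))) \<le> 3 * norm (\<i> *\<^sub>C (x - x\<^sup>\<star>))"
      by (rule E_norm_selfadjoint) (simp add: star_scaleC star_diff complex_vector.scale_right_diff_distrib)
    then have 2: "norm (E (x - x\<^sup>\<star>)) \<le> 3 * norm (x - x\<^sup>\<star>)" by (simp add: E_scaleC norm_scaleC)
    have "2 *\<^sub>R E x = E (x + x\<^sup>\<star>) + E (x - x\<^sup>\<star>)" by (simp add: E_add E_diff scaleR_2)
    then have "2 * norm (E x) \<le> norm (E (x + x\<^sup>\<star>)) + norm (E (x - x\<^sup>\<star>))"
      by (metis norm_scaleR norm_triangle_ineq abs_numeral)
    then show ?thesis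
      using 1 2 norm_triangle_ineq[of x "x\<^sup>\<star>"] norm_triangle_ineq4[of x "x\<^sup>\<star>"] by simp
  qed
qed (simp_all add: E_add E_scaleR)

text \<open>The scalar argument expands the square of \<open>E (y\<^sup>\<star> * y) x - y b\<close>
  with \<open>b = E (y\<^sup>\<star> * x)\<close>. Here \<open>E (y\<^sup>\<star> * y)\<close> is
  not a scalar, so its upper bound \<open>K\<close> takes its place.\<close>

lemma E_Cauchy_Schwarz:
  assumes K: "K > 0" and y: "cstar_positive (K *\<^sub>R 1 - E (y\<^sup>\<star> * y))"
  shows "(norm (E (y\<^sup>\<star> * x)))\<^sup>2 \<le> K * norm (E (x\<^sup>\<star> * x))"
proof -
  define b where "b = E (y\<^sup>\<star> * x)"
  have bB: "b \<in> B" "b\<^sup>\<star> \<in> B" using E_in subalgebra_star[OF B] by (auto simp: b_def)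
  have b': "E (x\<^sup>\<star> * y) = b\<^sup>\<star>" using E_star[of "y\<^sup>\<star> * x"] by (simp add: b_def star_mult)
  let ?z = "K *\<^sub>R x - y * b"
  have "?z\<^sup>\<star> * ?z = (K * K) *\<^sub>R (x\<^sup>\<star> * x) - K *\<^sub>R (x\<^sup>\<star> * y * b) - K *\<^sub>R (b\<^sup>\<star> * (y\<^sup>\<star> * x)) + b\<^sup>\<star> * (y\<^sup>\<star> * y) * b"
    by (simp add: star_diff star_mult algebra_simps)
  then have "E (?z\<^sup>\<star> * ?z) = (K * K) *\<^sub>R E (x\<^sup>\<star> * x) - K *\<^sub>R (b\<^sup>\<star> * b) - K *\<^sub>R (b\<^sup>\<star> * b) + b\<^sup>\<star> * E (y\<^sup>\<star> * y) * b"
    by (simp only: E_add E_diff E_scaleR E_bimodule[OF bB(2,1)] E_left[OF bB(2)] E_right[OF bB(1)] b' b_def[symmetric])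
  moreover have "cstar_positive (E (?z\<^sup>\<star> * ?z))" by (intro E_positive) simp
  moreover have "cstar_positive (b\<^sup>\<star> * (K *\<^sub>R 1 - E (y\<^sup>\<star> * y)) * b)" by (rule cstar_positive_conj[OF y])
  ultimately have "cstar_positive ((K * K) *\<^sub>R E (x\<^sup>\<star> * x) - K *\<^sub>R (b\<^sup>\<star> * b) - K *\<^sub>R (b\<^sup>\<star> * b) + b\<^sup>\<star> * E (y\<^sup>\<star> * y) * b
      + b\<^sup>\<star> * (K *\<^sub>R 1 - E (y\<^sup>\<star> * y)) * b)"
    using cstar_positive_add by metis
  moreover have "(K * K) *\<^sub>R E (x\<^sup>\<star> * x) - K *\<^sub>R (b\<^sup>\<star> * b) - K *\<^sub>R (b\<^sup>\<star> * b) + b\<^sup>\<star> * E (y\<^sup>\<star> * y) * b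
      + b\<^sup>\<star> * (K *\<^sub>R 1 - E (y\<^sup>\<star> * y)) * b = K *\<^sub>R (K *\<^sub>R E (x\<^sup>\<star> * x) - b\<^sup>\<star> * b)"
    by (simp add: algebra_simps)
  ultimately have "cstar_positive ((1/K) *\<^sub>R (K *\<^sub>R (K *\<^sub>R E (x\<^sup>\<star> * x) - b\<^sup>\<star> * b)))"
    using K by (intro cstar_positive_scaleR[of "K *\<^sub>R (K *\<^sub>R E (x\<^sup>\<star> * x) - b\<^sup>\<star> * b)"]) simp_all
  then have "norm (b\<^sup>\<star> * b) \<le> norm (K *\<^sub>R E (x\<^sup>\<star> * x))"
    using K by (intro cstar_positive_norm_mono) simp_all
  then show ?thesis using K by (simp add: cstar_identity b_def)
qed

lemma right_quasi_basis_adjoint: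
  assumes "right_quasi_basis E L"
  shows "x = (\<Sum>l\<in>L. l * E (l\<^sup>\<star> * x))"
proof -
  have "x\<^sup>\<star> = (\<Sum>l\<in>L. E (x\<^sup>\<star> * l) * l\<^sup>\<star>)"
    using assms unfolding right_quasi_basis_def by blast
  then have "x = (\<Sum>l\<in>L. E (x\<^sup>\<star> * l) * l\<^sup>\<star>)\<^sup>\<star>" by (metis star_star)
  then show ?thesis by (simp add: star_sum star_mult E_star[symmetric])
qed

text \<open>Expand \<open>x\<close> in a quasi-basis and estimate each coefficient
  \<open>E (l\<^sup>\<star> * x)\<close> by Cauchy-Schwarz; the second inequality is the first one
  for \<open>x\<^sup>\<star>\<close>. The added 1 in \<open>k\<close> and in
  \<open>M\<^sup>2 + 1\<close> makes these constants positive.\<close>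

lemma norm_le_E_norm:
  assumes "finite_index E"
  shows "\<exists>K>0. \<forall>x. (norm x)\<^sup>2 \<le> K * norm (E (x\<^sup>\<star> * x)) \<and> (norm x)\<^sup>2 \<le> K * norm (E (x * x\<^sup>\<star>))"
proof -
  obtain L where L: "right_quasi_basis E L" using assms by (auto simp: finite_index_def)
  define k where "k l = (norm l)\<^sup>2 + 1" for l :: 'a
  have k: "k l > 0" for l by (simp add: k_def add_nonneg_pos)
  define M where "M = (\<Sum>l\<in>L. norm l * sqrt (k l))"
  have *: "(norm x)\<^sup>2 \<le> (M\<^sup>2 + 1) * norm (E (x\<^sup>\<star> * x))" for x
  proof -
    have one: "norm (l * E (l\<^sup>\<star> * x)) \<le> norm l * sqrt (k l) * sqrt (norm (E (x\<^sup>\<star> * x)))" for l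
    proof -
      have "norm (E (l\<^sup>\<star> * l)) \<le> k l"
        using E_norm_positive[of "l\<^sup>\<star> * l"] by (simp add: cstar_identity k_def)
      then have "cstar_positive (k l *\<^sub>R 1 - E (l\<^sup>\<star> * l))"
        by (intro cstar_positive_norm_minus E_selfadjoint) (simp add: star_mult)
      then have "(norm (E (l\<^sup>\<star> * x)))\<^sup>2 \<le> k l * norm (E (x\<^sup>\<star> * x))"
        by (rule E_Cauchy_Schwarz[OF k])
      then have "norm (E (l\<^sup>\<star> * x)) \<le> sqrt (k l) * sqrt (norm (E (x\<^sup>\<star> * x)))"
        by (simp add: real_le_rsqrt flip: real_sqrt_mult)
      then have "norm l * norm (E (l\<^sup>\<star> * x)) \<le> norm l * (sqrt (k l) * sqrt (norm (E (x\<^sup>\<star> * x))))"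
        by (rule mult_left_mono) simp
      then show ?thesis using norm_mult_ineq[of l "E (l\<^sup>\<star> * x)"] by (simp add: mult.assoc)
    qed
    have "norm x = norm (\<Sum>l\<in>L. l * E (l\<^sup>\<star> * x))" using right_quasi_basis_adjoint[OF L, of x] by simp
    also have "\<dots> \<le> (\<Sum>l\<in>L. norm l * sqrt (k l) * sqrt (norm (E (x\<^sup>\<star> * x))))"
      by (rule sum_norm_le) (rule one)
    also have "\<dots> = M * sqrt (norm (E (x\<^sup>\<star> * x)))" by (simp add: M_def sum_distrib_right)
    finally have "(norm x)\<^sup>2 \<le> (M * sqrt (norm (E (x\<^sup>\<star> * x))))\<^sup>2" by (simp add: power_mono)
    then show ?thesis
      using norm_ge_zero[of "E (x\<^sup>\<star> * x)"] by (simp add: power_mult_distrib distrib_right add_increasing2)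
  qed
  moreover have "(norm x)\<^sup>2 \<le> (M\<^sup>2 + 1) * norm (E (x * x\<^sup>\<star>))" for x using *[of "x\<^sup>\<star>"] by simp
  moreover have "M\<^sup>2 + 1 > 0" by (simp add: add_nonneg_pos)
  ultimately show ?thesis by blast
qed

lemma index_sum_unique:
  assumes "right_quasi_basis E L" "right_quasi_basis E M"
  shows "(\<Sum>l\<in>L. l * l\<^sup>\<star>) = (\<Sum>m\<in>M. m * m\<^sup>\<star>)"
proof -
  have "(\<Sum>l\<in>L. l * l\<^sup>\<star>) = (\<Sum>l\<in>L. (\<Sum>m\<in>M. m * E (m\<^sup>\<star> * l)) * l\<^sup>\<star>)"
    using right_quasi_basis_adjoint[OF assms(2)] by (intro sum.cong) auto
  also have "\<dots> = (\<Sum>m\<in>M. m * (\<Sum>l\<in>L. E (m\<^sup>\<star> * l) * l\<^sup>\<star>))"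
    unfolding sum_distrib_right sum_distrib_left by (subst sum.swap) (simp add: mult.assoc)
  also have "\<dots> = (\<Sum>m\<in>M. m * m\<^sup>\<star>)"
    using assms(1) unfolding right_quasi_basis_def by (intro sum.cong) auto
  finally show ?thesis .
qed

lemma watatani_index_eq:
  assumes "right_quasi_basis E L"
  shows "watatani_index E = (\<Sum>l\<in>L. l * l\<^sup>\<star>)"
  unfolding watatani_index_def using assms index_sum_unique by (intro the_equality) blast+

text \<open>Expanding \<open>a * l\<close> in the quasi-basis and collecting the coefficients on the
  other side carries \<open>a\<close> through the sum. In a simple ambient algebra the index is
  therefore a scalar.\<close>

lemma watatani_index_central:
  assumes "right_quasi_basis E L"
  shows "a * (\<Sum>l\<in>L. l * l\<^sup>\<star>) = (\<Sum>l\<in>L. l * l\<^sup>\<star>) * a"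
proof -
  have "a * (\<Sum>l\<in>L. l * l\<^sup>\<star>) = (\<Sum>l\<in>L. (a * l) * l\<^sup>\<star>)"
    by (simp add: sum_distrib_left mult.assoc)
  also have "\<dots> = (\<Sum>l\<in>L. (\<Sum>m\<in>L. m * E (m\<^sup>\<star> * (a * l))) * l\<^sup>\<star>)"
    using right_quasi_basis_adjoint[OF assms] by (intro sum.cong refl arg_cong2[where f = "(*)"])
  also have "\<dots> = (\<Sum>m\<in>L. m * (\<Sum>l\<in>L. E ((m\<^sup>\<star> * a) * l) * l\<^sup>\<star>))"
    unfolding sum_distrib_right sum_distrib_left by (subst sum.swap) (simp add: mult.assoc)
  also have "\<dots> = (\<Sum>m\<in>L. m * (m\<^sup>\<star> * a))"
    using assms unfolding right_quasi_basis_def by (intro sum.cong) auto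
  finally show ?thesis by (simp add: sum_distrib_right mult.assoc)
qed

text \<open>Bessel's inequality, applied to the quasi-basis, bounds the size of orthonormal families.\<close>

lemma orthonormal_sum_bounded:
  assumes "finite_index E"
  obtains M where "\<And>V. finite V \<Longrightarrow> (\<And>v w. v \<in> V \<Longrightarrow> w \<in> V \<Longrightarrow> E (v * w\<^sup>\<star>) = (if v = w then 1 else 0)) \<Longrightarrow>
     norm (\<Sum>v\<in>V. v\<^sup>\<star> * v) \<le> M"
proof -
  obtain L where L: "right_quasi_basis E L" using assms by (auto simp: finite_index_def)
  obtain K where K: "K > 0" "\<And>x. (norm x)\<^sup>2 \<le> K * norm (E (x\<^sup>\<star> * x))"
    using norm_le_E_norm[OF assms] by blast
  show thesis
  proof (rule that)
    fix V assume V: "finite V" and on: "\<And>v w. v \<in> V \<Longrightarrow> w \<in> V \<Longrightarrow> E (v * w\<^sup>\<star>) = (if v = w then 1 else 0)"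
    \<comment> \<open>The component of \<open>l\<close> along the adjoints of \<open>V\<close>.
      Orthonormality makes \<open>E\<close> of \<open>(P l)\<^sup>\<star> * P l\<close> equal to
      both mixed terms, so \<open>E\<close> of the square of \<open>l - P l\<close> is
      \<open>E (l\<^sup>\<star> * l) - S\<close>.\<close>
    define P where "P l = (\<Sum>v\<in>V. v\<^sup>\<star> * E (v * l))" for l
    have P: "norm (P l) \<le> sqrt K * norm l" for l
    proof -
      define S where "S = (\<Sum>v\<in>V. (E (v * l))\<^sup>\<star> * E (v * l))"
      have sE: "(E x)\<^sup>\<star> \<in> B" for x using E_in subalgebra_star[OF B] by blast
      have Pl: "E ((P l)\<^sup>\<star> * l) = S"
      proof -
        have "(P l)\<^sup>\<star> * l = (\<Sum>v\<in>V. (E (v * l))\<^sup>\<star> * (v * l))"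
          by (simp add: P_def star_sum star_mult sum_distrib_right mult.assoc)
        then show ?thesis by (simp only: E_sum E_left[OF sE] S_def)
      qed
      have lP: "E (l\<^sup>\<star> * P l) = S"
        using Pl E_star[of "(P l)\<^sup>\<star> * l"]
        by (simp only: star_mult star_star S_def star_sum)
      have "E ((P l)\<^sup>\<star> * P l) = (\<Sum>v\<in>V. \<Sum>w\<in>V. (E (v * l))\<^sup>\<star> * E (v * w\<^sup>\<star>) * E (w * l))"
      proof -
        have "(P l)\<^sup>\<star> * P l = (\<Sum>v\<in>V. \<Sum>w\<in>V. (E (v * l))\<^sup>\<star> * (v * w\<^sup>\<star>) * E (w * l))"
          by (simp add: P_def star_sum star_mult sum_product mult.assoc)
        then show ?thesis by (simp only: E_sum E_bimodule[OF sE E_in])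
      qed
      also have "\<dots> = (\<Sum>v\<in>V. \<Sum>w\<in>V. if v = w then (E (v * l))\<^sup>\<star> * E (w * l) else 0)"
        by (intro sum.cong refl) (simp add: on)
      also have "\<dots> = S" using V by (simp add: S_def)
      finally have PP: "E ((P l)\<^sup>\<star> * P l) = S" .
      have "E ((l - P l)\<^sup>\<star> * (l - P l)) = E (l\<^sup>\<star> * l) - S"
        by (simp add: star_diff left_diff_distrib right_diff_distrib E_diff Pl lP PP)
      then have "cstar_positive (E (l\<^sup>\<star> * l) - S)" by (metis E_positive cstar_positive_star_mult)
      moreover have "cstar_positive S" by (simp add: S_def cstar_positive_sum)
      ultimately have "norm S \<le> norm (E (l\<^sup>\<star> * l))" by (intro cstar_positive_norm_mono)
      also have "\<dots> \<le> (norm l)\<^sup>2" using E_norm_positive[of "l\<^sup>\<star> * l"] by (simp add: cstar_identity)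
      finally have "K * norm S \<le> K * (norm l)\<^sup>2" using K by simp
      then have "(norm (P l))\<^sup>2 \<le> K * (norm l)\<^sup>2" using K(2)[of "P l"] PP by simp
      then have "norm (P l) \<le> sqrt (K * (norm l)\<^sup>2)" by (rule real_le_rsqrt)
      then show ?thesis by (simp add: real_sqrt_mult)
    qed
    \<comment> \<open>Expanding the right factor \<open>v\<close> in the fixed quasi-basis
      \<open>L\<close> replaces a sum over \<open>V\<close> by one over \<open>L\<close>, whose
      length does not depend on \<open>V\<close>.\<close>
    have "(\<Sum>v\<in>V. v\<^sup>\<star> * v) = (\<Sum>v\<in>V. v\<^sup>\<star> * (\<Sum>l\<in>L. E (v * l) * l\<^sup>\<star>))"
      using L unfolding right_quasi_basis_def by (intro sum.cong) auto
    also have "\<dots> = (\<Sum>l\<in>L. P l * l\<^sup>\<star>)"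
      unfolding P_def sum_distrib_right sum_distrib_left by (subst sum.swap) (simp add: mult.assoc)
    finally have "norm (\<Sum>v\<in>V. v\<^sup>\<star> * v) \<le> (\<Sum>l\<in>L. norm (P l * l\<^sup>\<star>))" by (simp add: norm_sum)
    also have "\<dots> \<le> (\<Sum>l\<in>L. sqrt K * norm l * norm l)"
    proof (rule sum_mono)
      fix l
      have "norm (P l * l\<^sup>\<star>) \<le> norm (P l) * norm (l\<^sup>\<star>)" by (rule norm_mult_ineq)
      also have "\<dots> \<le> (sqrt K * norm l) * norm (l\<^sup>\<star>)" by (rule mult_right_mono[OF P]) simp
      finally show "norm (P l * l\<^sup>\<star>) \<le> sqrt K * norm l * norm l" by simp
    qed
    finally show "norm (\<Sum>v\<in>V. v\<^sup>\<star> * v) \<le> (\<Sum>l\<in>L. sqrt K * norm l * norm l)" .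
  qed
qed

end

section \<open>Traces on finite-dimensional algebras\<close>

definition linear_on :: "'a::cstar_algebra set \<Rightarrow> ('a \<Rightarrow> complex) \<Rightarrow> bool" where
  "linear_on C f \<longleftrightarrow> (\<forall>x\<in>C. \<forall>y\<in>C. f (x + y) = f x + f y) \<and> (\<forall>c. \<forall>x\<in>C. f (c *\<^sub>C x) = c * f x)"

lemma linear_onI:
  "(\<And>x y. x \<in> C \<Longrightarrow> y \<in> C \<Longrightarrow> f (x + y) = f x + f y) \<Longrightarrow> (\<And>c x. x \<in> C \<Longrightarrow> f (c *\<^sub>C x) = c * f x)
    \<Longrightarrow> linear_on C f"
  by (simp add: linear_on_def)

lemma linear_on_add: "linear_on C f \<Longrightarrow> x \<in> C \<Longrightarrow> y \<in> C \<Longrightarrow> f (x + y) = f x + f y"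
  and linear_on_scaleC: "linear_on C f \<Longrightarrow> x \<in> C \<Longrightarrow> f (c *\<^sub>C x) = c * f x"
  by (simp_all add: linear_on_def)

section \<open>Traces of operators on a subspace\<close>

context
  fixes C :: "'a::cstar_algebra set"
  assumes C: "complex_vector.subspace C"
begin

lemma linear_on_zero: "linear_on C f \<Longrightarrow> f 0 = 0"
  using linear_on_scaleC[of C f 0 0] complex_vector.subspace_0[OF C] by simp

lemma linear_on_diff: "linear_on C f \<Longrightarrow> x \<in> C \<Longrightarrow> y \<in> C \<Longrightarrow> f (x - y) = f x - f y"
  using linear_on_add[of C f x "(- 1) *\<^sub>C y"] linear_on_scaleC[of C f y "- 1"]
    complex_vector.subspace_scale[OF C, of y "- 1"] by simp

lemma linear_on_sum:
  "linear_on C f \<Longrightarrow> (\<And>i. i \<in> I \<Longrightarrow> g i \<in> C) \<Longrightarrow> f (\<Sum>i\<in>I. g i) = (\<Sum>i\<in>I. f (g i))"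
  by (induction I rule: infinite_finite_induct)
    (simp_all add: linear_on_zero linear_on_add complex_vector.subspace_sum[OF C])

text \<open>A resolution of the identity of \<open>C\<close> into rank-one operators. Linear
  independence is not part of it, so adjoints and conjugates of a basis are frames at once.\<close>

definition frame :: "'i set \<Rightarrow> ('i \<Rightarrow> 'a) \<Rightarrow> ('i \<Rightarrow> 'a \<Rightarrow> complex) \<Rightarrow> bool" where
  "frame I e l \<longleftrightarrow> finite I \<and> (\<forall>i\<in>I. e i \<in> C \<and> linear_on C (l i)) \<and> (\<forall>x\<in>C. x = (\<Sum>i\<in>I. l i x *\<^sub>C e i))"

text \<open>The left-hand side is the trace of the operator \<open>f\<close>, so this contains both the independence of the
  trace from the frame and its commutativity.\<close>

lemma frame_trace:
  assumes fr: "frame I e l" and J: "finite J" "\<And>j. j \<in> J \<Longrightarrow> d j \<in> C" "\<And>j. j \<in> J \<Longrightarrow> linear_on C (m j)"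
    and f: "\<And>x. x \<in> C \<Longrightarrow> f x = (\<Sum>j\<in>J. m j x *\<^sub>C d j)"
  shows "(\<Sum>i\<in>I. l i (f (e i))) = (\<Sum>j\<in>J. m j (d j))"
proof -
  have e: "e i \<in> C" "linear_on C (l i)" if "i \<in> I" for i using fr that by (auto simp: frame_def)
  have x: "x = (\<Sum>i\<in>I. l i x *\<^sub>C e i)" if "x \<in> C" for x using fr that by (auto simp: frame_def)
  have "(\<Sum>i\<in>I. l i (f (e i))) = (\<Sum>i\<in>I. \<Sum>j\<in>J. m j (e i) * l i (d j))"
  proof (intro sum.cong refl)
    fix i assume i: "i \<in> I"
    have "l i (f (e i)) = (\<Sum>j\<in>J. l i (m j (e i) *\<^sub>C d j))"
      unfolding f[OF e(1)[OF i]] using J C e[OF i]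
      by (intro linear_on_sum) (auto intro: complex_vector.subspace_scale)
    then show "l i (f (e i)) = (\<Sum>j\<in>J. m j (e i) * l i (d j))"
      using J e[OF i] by (simp add: linear_on_scaleC)
  qed
  also have "\<dots> = (\<Sum>j\<in>J. \<Sum>i\<in>I. m j (l i (d j) *\<^sub>C e i))"
    by (subst sum.swap, intro sum.cong refl) (simp add: linear_on_scaleC[OF J(3)] e mult.commute)
  also have "\<dots> = (\<Sum>j\<in>J. m j (\<Sum>i\<in>I. l i (d j) *\<^sub>C e i))"
    using J C e by (intro sum.cong refl linear_on_sum[symmetric]) (auto intro: complex_vector.subspace_scale)
  also have "\<dots> = (\<Sum>j\<in>J. m j (d j))"
    by (intro sum.cong refl) (simp add: x[OF J(2), symmetric])
  finally show ?thesis .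
qed

end

section \<open>Orthonormal bases for a faithful state\<close>

locale faithful_state =
  fixes C :: "'a::cstar_algebra set" and \<phi> :: "'a \<Rightarrow> complex"
  assumes C: "unital_cstar_subalgebra C"
    and lin: "linear_on C \<phi>"
    and star: "\<And>x. x \<in> C \<Longrightarrow> \<phi> (x\<^sup>\<star>) = cnj (\<phi> x)"
    and pos: "\<And>x. x \<in> C \<Longrightarrow> \<phi> (x\<^sup>\<star> * x) \<in> \<real>\<^sub>\<ge>\<^sub>0"
    and faithful: "\<And>x. x \<in> C \<Longrightarrow> \<phi> (x\<^sup>\<star> * x) = 0 \<Longrightarrow> x = 0"
    and one: "\<phi> 1 = 1"
begin

lemmas sub = subalgebra_subspace[OF C]
lemmas in_C = subalgebra_closure_rules[OF C]
lemmas phi_add = linear_on_add[OF lin] and phi_scaleC = linear_on_scaleC[OF lin]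
  and phi_sum = linear_on_sum[OF sub lin] and phi_diff = linear_on_diff[OF sub lin]

lemma phi_zero [simp]: "\<phi> 0 = 0" by (rule linear_on_zero[OF sub lin])

text \<open>The order \<open>k * m\<^sup>\<star>\<close> is that of left quasi-bases: with a unitary
  \<open>w\<close> on the right of both factors it cancels in the middle, so \<open>k * w\<close>
  inherits orthonormality.\<close>

definition orthonormal :: "'a set \<Rightarrow> bool" where
  "orthonormal K \<longleftrightarrow> finite K \<and> K \<subseteq> C \<and> (\<forall>k\<in>K. \<forall>m\<in>K. \<phi> (k * m\<^sup>\<star>) = (if k = m then 1 else 0))"

lemma orthonormalD:
  assumes "orthonormal K"
  shows "finite K" "K \<subseteq> C" "\<And>k. k \<in> K \<Longrightarrow> k \<in> C"
    "\<And>k m. k \<in> K \<Longrightarrow> m \<in> K \<Longrightarrow> \<phi> (k * m\<^sup>\<star>) = (if k = m then 1 else 0)"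
  using assms unfolding orthonormal_def by blast+

lemma orthonormal_combination:
  assumes "orthonormal K" "m \<in> K"
  shows "\<phi> ((\<Sum>k\<in>K. c k *\<^sub>C k) * m\<^sup>\<star>) = c m"
proof -
  note K = orthonormalD[OF assms(1)]
  have "\<phi> ((\<Sum>k\<in>K. c k *\<^sub>C k) * m\<^sup>\<star>) = \<phi> (\<Sum>k\<in>K. c k *\<^sub>C (k * m\<^sup>\<star>))"
    by (simp add: sum_distrib_right mult_scaleC_left)
  also have "\<dots> = (\<Sum>k\<in>K. \<phi> (c k *\<^sub>C (k * m\<^sup>\<star>)))"
    by (rule phi_sum) (intro in_C K(3) assms)
  also have "\<dots> = (\<Sum>k\<in>K. if k = m then c k else 0)"
  proof (intro sum.cong refl)
    fix k assume k: "k \<in> K"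
    have "k * m\<^sup>\<star> \<in> C" by (intro in_C K(3) assms k)
    then show "\<phi> (c k *\<^sub>C (k * m\<^sup>\<star>)) = (if k = m then c k else 0)"
      using K(4)[OF k assms(2)] by (simp add: phi_scaleC)
  qed
  also have "\<dots> = c m" using K(1) assms(2) by simp
  finally show ?thesis .
qed

lemma orthonormal_independent: "orthonormal K \<Longrightarrow> complex_vector.independent K"
proof -
  assume K: "orthonormal K"
  have "c m = 0" if "(\<Sum>k\<in>K. c k *\<^sub>C k) = 0" "m \<in> K" for c m
    using orthonormal_combination[OF K that(2), of c] that(1) by simp
  then show ?thesis unfolding complex_vector.dependent_finite[OF orthonormalD(1)[OF K]] by blast
qed

text \<open>Finite dimension is a conclusion here: a bound on the size of orthonormal sets yields a
  largest one, and a nonzero remainder \<open>y\<close> of some expansion, normalized, would enlarge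
  it.\<close>

lemma orthonormal_basis_exists:
  assumes bounded: "\<And>K. orthonormal K \<Longrightarrow> card K \<le> N"
  obtains K where "orthonormal K" "\<And>x. x \<in> C \<Longrightarrow> x = (\<Sum>k\<in>K. \<phi> (x * k\<^sup>\<star>) *\<^sub>C k)"
proof -
  have "orthonormal {}" by (simp add: orthonormal_def)
  then have "\<exists>K. orthonormal K \<and> (\<forall>M. orthonormal M \<longrightarrow> card M \<le> card K)"
    using bounded by (intro ex_has_greatest_nat[of orthonormal "{}" card "Suc N"]) (auto simp: less_Suc_eq_le)
  then obtain K where K: "orthonormal K" and maximal: "\<And>M. orthonormal M \<Longrightarrow> card M \<le> card K"
    by blast
  note KD = orthonormalD[OF K]
  show thesis
  proof (rule that[OF K], rule ccontr)
    fix x assume x: "x \<in> C" and neq: "x \<noteq> (\<Sum>k\<in>K. \<phi> (x * k\<^sup>\<star>) *\<^sub>C k)"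
    define y where "y = x - (\<Sum>k\<in>K. \<phi> (x * k\<^sup>\<star>) *\<^sub>C k)"
    have y: "y \<in> C" unfolding y_def using x KD(3) by (intro in_C) auto
    have y0: "y \<noteq> 0" using neq by (simp add: y_def)
    have yk: "\<phi> (y * k\<^sup>\<star>) = 0" if k: "k \<in> K" for k
    proof -
      have "\<phi> (y * k\<^sup>\<star>) = \<phi> (x * k\<^sup>\<star>) - \<phi> ((\<Sum>k\<in>K. \<phi> (x * k\<^sup>\<star>) *\<^sub>C k) * k\<^sup>\<star>)"
        unfolding y_def left_diff_distrib by (rule phi_diff) (intro in_C x KD(3) k; simp)+
      then show ?thesis using orthonormal_combination[OF K k] by simp
    qed
    obtain r where r: "\<phi> (y * y\<^sup>\<star>) = complex_of_real r" "r \<ge> 0"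
      using pos[of "y\<^sup>\<star>"] y by (auto simp: nonneg_Reals_def in_C)
    have "\<phi> (y * y\<^sup>\<star>) \<noteq> 0" using faithful[of "y\<^sup>\<star>"] y y0 by (auto simp: in_C)
    then have "r > 0" using r by auto
    define z where "z = complex_of_real (1 / sqrt r) *\<^sub>C y"
    have z: "z \<in> C" unfolding z_def by (intro in_C y)
    have "\<phi> (z * z\<^sup>\<star>) = complex_of_real (1 / sqrt r) * (complex_of_real (1 / sqrt r) * \<phi> (y * y\<^sup>\<star>))"
      unfolding z_def star_scaleC mult_scaleC_left mult_scaleC_right complex_cnj_complex_of_real
      by (simp only: phi_scaleC in_C y)
    also have "\<dots> = complex_of_real ((1 / sqrt r) * ((1 / sqrt r) * r))" by (simp only: r of_real_mult)
    also have "(1 / sqrt r) * ((1 / sqrt r) * r) = 1" using \<open>r > 0\<close> by (simp add: field_simps)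
    finally have zz: "\<phi> (z * z\<^sup>\<star>) = 1" by simp
    have zk: "\<phi> (z * k\<^sup>\<star>) = 0" if k: "k \<in> K" for k
      unfolding z_def mult_scaleC_left using yk[OF k] by (simp only: phi_scaleC in_C y KD(3) k) simp
    have kz: "\<phi> (k * z\<^sup>\<star>) = 0" if k: "k \<in> K" for k
      using star[of "z * k\<^sup>\<star>"] zk[OF k] by (simp add: star_mult in_C z KD(3) k)
    have "z \<notin> K" using zk zz by force
    have "orthonormal (insert z K)"
      using KD z zz zk kz \<open>z \<notin> K\<close> unfolding orthonormal_def by auto
    then show False using maximal[of "insert z K"] \<open>z \<notin> K\<close> KD(1) by simp
  qed
qed

end

section \<open>The trace of the left regular representation\<close>

locale orthonormal_basis = faithful_state +
  fixes K
  assumes K: "orthonormal K" and expand: "\<And>x. x \<in> C \<Longrightarrow> x = (\<Sum>k\<in>K. \<phi> (x * k\<^sup>\<star>) *\<^sub>C k)"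
begin

lemmas K_fin = orthonormalD(1)[OF K] and K_C = orthonormalD(3)[OF K] and K_on = orthonormalD(4)[OF K]

lemma C_eq_span: "C = complex_vector.span K"
proof
  show "C \<subseteq> complex_vector.span K"
  proof
    fix x assume "x \<in> C"
    then have "x = (\<Sum>k\<in>K. \<phi> (x * k\<^sup>\<star>) *\<^sub>C k)" by (rule expand)
    then show "x \<in> complex_vector.span K"
      by (metis (no_types, lifting) complex_vector.span_base complex_vector.span_scale complex_vector.span_sum)
  qed
  show "complex_vector.span K \<subseteq> C"
    by (rule complex_vector.span_minimal[OF orthonormalD(2)[OF K] sub])
qed

lemma dim_C: "complex_vector.dim C = card K"
  using complex_vector.dim_span_eq_card_independent[OF orthonormal_independent[OF K]] C_eq_span by simp

lemma orthonormal_frame: "frame C K (\<lambda>k. k) (\<lambda>k x. \<phi> (x * k\<^sup>\<star>))"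
  unfolding frame_def[OF sub]
  using expand K_fin by (auto intro!: linear_onI simp: distrib_right mult_scaleC_left phi_add phi_scaleC in_C K_C)

lemma adjoint_frame: "frame C K star (\<lambda>k x. \<phi> (k * x))"
  unfolding frame_def[OF sub]
proof (intro conjI ballI K_fin)
  fix x assume x: "x \<in> C"
  have "x\<^sup>\<star> = (\<Sum>k\<in>K. \<phi> (x\<^sup>\<star> * k\<^sup>\<star>) *\<^sub>C k)" by (rule expand) (intro in_C x)
  then have "x = (\<Sum>k\<in>K. \<phi> (x\<^sup>\<star> * k\<^sup>\<star>) *\<^sub>C k)\<^sup>\<star>" by (metis star_star)
  also have "\<dots> = (\<Sum>k\<in>K. \<phi> (k * x) *\<^sub>C k\<^sup>\<star>)"
    unfolding star_sum star_scaleC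
  proof (intro sum.cong refl arg_cong2[where f = scaleC])
    fix k assume "k \<in> K"
    then show "cnj (\<phi> (x\<^sup>\<star> * k\<^sup>\<star>)) = \<phi> (k * x)"
      using star[of "k * x"] x by (simp add: star_mult in_C K_C)
  qed
  finally show "x = (\<Sum>k\<in>K. \<phi> (k * x) *\<^sub>C k\<^sup>\<star>)" .
qed (auto intro!: linear_onI simp: distrib_left mult_scaleC_right phi_add phi_scaleC in_C K_C)

text \<open>The coefficient of \<open>k\<close> in \<open>x * k\<close> is
  \<open>\<phi> (x * k * k\<^sup>\<star>)\<close>, so the numerator is the trace of left
  multiplication by \<open>x\<close>.\<close>

definition \<tau> :: "'a \<Rightarrow> complex" where
  "\<tau> x = (\<Sum>k\<in>K. \<phi> (x * k * k\<^sup>\<star>)) / of_nat (card K)"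

lemma card_pos: "card K > 0"
proof (rule ccontr)
  assume "\<not> card K > 0"
  then have "K = {}" using K_fin by simp
  then show False using expand[of 1] in_C by simp
qed

lemma tau_eq: "of_nat (card K) * \<tau> x = (\<Sum>k\<in>K. \<phi> (x * k * k\<^sup>\<star>))"
  using card_pos by (simp add: \<tau>_def)

lemma trace_formula:
  assumes "finite J" "\<And>j. j \<in> J \<Longrightarrow> d j \<in> C" "\<And>j. j \<in> J \<Longrightarrow> linear_on C (m j)"
    and "\<And>y. y \<in> C \<Longrightarrow> x * y = (\<Sum>j\<in>J. m j y *\<^sub>C d j)"
  shows "of_nat (card K) * \<tau> x = (\<Sum>j\<in>J. m j (d j))"
  using frame_trace[OF sub orthonormal_frame assms(1-3), where f = "(*) x"] assms(4)
  by (simp add: tau_eq)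

lemma tau_frame:
  assumes x: "x \<in> C" and fr: "frame C I e l"
  shows "of_nat (card K) * \<tau> x = (\<Sum>i\<in>I. l i (x * e i))"
proof (rule trace_formula[where m = "\<lambda>i y. l i (x * y)" and d = e])
  show "finite I" "i \<in> I \<Longrightarrow> e i \<in> C" for i using fr by (auto simp: frame_def[OF sub])
  show "linear_on C (\<lambda>y. l i (x * y))" if "i \<in> I" for i
    using fr that x by (auto intro!: linear_onI simp: frame_def[OF sub] distrib_left mult_scaleC_right
        linear_on_add linear_on_scaleC in_C)
  show "x * y = (\<Sum>i\<in>I. l i (x * y) *\<^sub>C e i)" if "y \<in> C" for y
  proof -
    have "x * y \<in> C" by (intro in_C x that)
    then show ?thesis using fr unfolding frame_def[OF sub] by blast
  qed
qed

text \<open>The same trace computed in the frame of adjoints. For positive \<open>x\<close> every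
  summand is now visibly nonnegative, and the formula makes sense with \<open>E\<close> on the whole
  algebra, which is the origin of \<open>E\<tau>\<close>.\<close>

lemma tau_conj_sum: "x \<in> C \<Longrightarrow> of_nat (card K) * \<tau> x = (\<Sum>k\<in>K. \<phi> (k * x * k\<^sup>\<star>))"
  using tau_frame[OF _ adjoint_frame] by (simp add: mult.assoc)

text \<open>Left multiplication by \<open>x * y\<close> is written as a sum of rank-one operators
  with vectors \<open>x * k\<close> and functionals taken from \<open>y\<close>; exchanging the two
  roles inside the trace puts \<open>y\<close> first.\<close>

lemma tau_comm:
  assumes x: "x \<in> C" and y: "y \<in> C"
  shows "\<tau> (x * y) = \<tau> (y * x)"
proof -
  have "of_nat (card K) * \<tau> (x * y) = (\<Sum>k\<in>K. \<phi> (y * (x * k) * k\<^sup>\<star>))"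
  proof (rule trace_formula[where m = "\<lambda>k z. \<phi> (y * z * k\<^sup>\<star>)"])
    show "x * k \<in> C" if "k \<in> K" for k by (intro in_C x K_C that)
    show "linear_on C (\<lambda>z. \<phi> (y * z * k\<^sup>\<star>))" if "k \<in> K" for k
      using that y by (auto intro!: linear_onI simp: distrib_left distrib_right mult_scaleC_left
          mult_scaleC_right phi_add phi_scaleC in_C K_C)
    fix z assume z: "z \<in> C"
    have "y * z = (\<Sum>k\<in>K. \<phi> (y * z * k\<^sup>\<star>) *\<^sub>C k)" by (rule expand) (intro in_C y z)
    then show "x * y * z = (\<Sum>k\<in>K. \<phi> (y * z * k\<^sup>\<star>) *\<^sub>C (x * k))"
      by (metis (no_types, lifting) mult.assoc mult_scaleC_right sum.cong sum_distrib_left)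
  qed (rule K_fin)
  also have "\<dots> = of_nat (card K) * \<tau> (y * x)" by (simp add: tau_eq mult.assoc)
  finally show ?thesis using card_pos by simp
qed

text \<open>The unitary \<open>u\<close> need not lie in \<open>C\<close>, so commutativity of the
  trace does not apply. Conjugation by \<open>u\<close> carries one frame to another, and the trace
  does not depend on the frame.\<close>

lemma tau_Ad:
  assumes u: "u\<^sup>\<star> * u = 1" "u * u\<^sup>\<star> = 1" and uC: "\<And>y. y \<in> C \<Longrightarrow> u * y * u\<^sup>\<star> \<in> C" "\<And>y. y \<in> C \<Longrightarrow> u\<^sup>\<star> * y * u \<in> C"
    and x: "x \<in> C"
  shows "\<tau> (u\<^sup>\<star> * x * u) = \<tau> x"
proof -
  have cancel: "u\<^sup>\<star> * (u * z) = z" "u * (u\<^sup>\<star> * z) = z" for z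
    using u by (simp_all add: mult.assoc[symmetric])
  have "of_nat (card K) * \<tau> x = (\<Sum>k\<in>K. \<phi> ((u\<^sup>\<star> * (x * (u * k * u\<^sup>\<star>)) * u) * k\<^sup>\<star>))"
    (is "_ = (\<Sum>k\<in>K. ?m k (?d k))")
  proof (rule tau_frame[OF x, of K "\<lambda>k. u * k * u\<^sup>\<star>" "\<lambda>k z. \<phi> ((u\<^sup>\<star> * z * u) * k\<^sup>\<star>)"])
    show "frame C K (\<lambda>k. u * k * u\<^sup>\<star>) (\<lambda>k z. \<phi> ((u\<^sup>\<star> * z * u) * k\<^sup>\<star>))"
      unfolding frame_def[OF sub]
    proof (intro conjI ballI K_fin)
      fix z assume z: "z \<in> C"
      have "u\<^sup>\<star> * z * u = (\<Sum>k\<in>K. \<phi> ((u\<^sup>\<star> * z * u) * k\<^sup>\<star>) *\<^sub>C k)" by (rule expand) (intro uC z)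
      then have "u * (u\<^sup>\<star> * z * u) * u\<^sup>\<star> = u * (\<Sum>k\<in>K. \<phi> ((u\<^sup>\<star> * z * u) * k\<^sup>\<star>) *\<^sub>C k) * u\<^sup>\<star>" by simp
      moreover have "u * (u\<^sup>\<star> * z * u) * u\<^sup>\<star> = z" by (simp add: mult.assoc cancel u)
      ultimately show "z = (\<Sum>k\<in>K. \<phi> ((u\<^sup>\<star> * z * u) * k\<^sup>\<star>) *\<^sub>C (u * k * u\<^sup>\<star>))"
        by (simp add: sum_distrib_left sum_distrib_right mult_scaleC_left mult_scaleC_right)
    next
      fix k assume "k \<in> K"
      then show "linear_on C (\<lambda>z. \<phi> ((u\<^sup>\<star> * z * u) * k\<^sup>\<star>))"
        by (auto intro!: linear_onI simp: distrib_left distrib_right mult_scaleC_left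
          mult_scaleC_right phi_add phi_scaleC in_C K_C uC)
    qed (auto intro: uC K_C)
  qed
  also have "\<dots> = of_nat (card K) * \<tau> (u\<^sup>\<star> * x * u)" by (simp add: tau_eq mult.assoc cancel u)
  finally show ?thesis using card_pos by simp
qed

lemma tau_linear: "linear_on C \<tau>"
  by (rule linear_onI)
    (simp_all add: \<tau>_def distrib_right mult_scaleC_left phi_add phi_scaleC in_C K_C sum.distrib
      add_divide_distrib sum_distrib_left[symmetric])

lemma tau_one: "\<tau> 1 = 1"
  using card_pos by (simp add: \<tau>_def K_on)

lemma tau_positive_faithful:
  assumes x: "x \<in> C"
  shows "\<tau> (x\<^sup>\<star> * x) \<in> \<real>\<^sub>\<ge>\<^sub>0" and "\<tau> (x\<^sup>\<star> * x) = 0 \<Longrightarrow> x = 0"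
proof -
  have t: "k * (x\<^sup>\<star> * x) * k\<^sup>\<star> = (x * k\<^sup>\<star>)\<^sup>\<star> * (x * k\<^sup>\<star>)" for k by (simp add: star_mult mult.assoc)
  have 1: "of_nat (card K) * \<tau> (x\<^sup>\<star> * x) = (\<Sum>k\<in>K. \<phi> ((x * k\<^sup>\<star>)\<^sup>\<star> * (x * k\<^sup>\<star>)))"
    unfolding t[symmetric] by (rule tau_conj_sum) (intro in_C x)
  have p: "\<phi> ((x * k\<^sup>\<star>)\<^sup>\<star> * (x * k\<^sup>\<star>)) = complex_of_real (Re (\<phi> ((x * k\<^sup>\<star>)\<^sup>\<star> * (x * k\<^sup>\<star>))))"
    "Re (\<phi> ((x * k\<^sup>\<star>)\<^sup>\<star> * (x * k\<^sup>\<star>))) \<ge> 0" if "k \<in> K" for k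
    using pos[of "x * k\<^sup>\<star>"] x that by (auto simp: in_C K_C complex_nonneg_Reals_iff complex_eq_iff)
  define R where "R = (\<Sum>k\<in>K. Re (\<phi> ((x * k\<^sup>\<star>)\<^sup>\<star> * (x * k\<^sup>\<star>))))"
  have R: "of_nat (card K) * \<tau> (x\<^sup>\<star> * x) = complex_of_real R"
    unfolding 1 R_def of_real_sum by (intro sum.cong refl p)
  have R0: "R \<ge> 0" unfolding R_def by (intro sum_nonneg p)
  have "\<tau> (x\<^sup>\<star> * x) = complex_of_real (R / card K)" using R card_pos by (simp add: field_simps)
  then show "\<tau> (x\<^sup>\<star> * x) \<in> \<real>\<^sub>\<ge>\<^sub>0" using R0 by (metis divide_nonneg_nonneg nonneg_Reals_of_real_iff of_nat_0_le_iff)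
  assume "\<tau> (x\<^sup>\<star> * x) = 0"
  then have "R = 0" using R by simp
  then have z: "Re (\<phi> ((x * k\<^sup>\<star>)\<^sup>\<star> * (x * k\<^sup>\<star>))) = 0" if "k \<in> K" for k
    using that p(2) K_fin unfolding R_def by (simp add: sum_nonneg_eq_0_iff)
  have xk: "x * k\<^sup>\<star> = 0" if "k \<in> K" for k
    by (rule faithful) (use x that p(1)[OF that] z[OF that] in \<open>auto simp: in_C K_C\<close>)
  \<comment> \<open>The vanishing of \<open>x * k\<^sup>\<star>\<close> for all \<open>k\<close>
    kills \<open>x\<close>, because 1 is a combination of the adjoints.\<close>
  have "1 = (\<Sum>k\<in>K. \<phi> (k * 1) *\<^sub>C k\<^sup>\<star>)"
    using adjoint_frame in_C unfolding frame_def[OF sub] by blast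
  then have "x = x * (\<Sum>k\<in>K. \<phi> (k * 1) *\<^sub>C k\<^sup>\<star>)" by (metis mult_1_right)
  also have "\<dots> = 0" by (simp add: sum_distrib_left mult_scaleC_right xk)
  finally show "x = 0" .
qed

definition D where "D = (\<Sum>k\<in>K. k * k\<^sup>\<star>)"

lemma D_C: "D \<in> C" unfolding D_def by (intro in_C K_C)

lemma tau_density: "x \<in> C \<Longrightarrow> of_nat (card K) * \<tau> x = \<phi> (x * D)"
  by (simp add: D_def tau_eq sum_distrib_left phi_sum in_C K_C mult.assoc)

text \<open>The density of \<open>\<tau>\<close> with respect to \<open>\<phi>\<close> is \<open>D / n\<close>, so \<open>\<tau> D \<ge> n\<close> is the Cauchy--Schwarz inequality
  for \<open>\<phi>\<close>.\<close>

lemma D_minimal: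
  assumes le: "Re (\<tau> D) \<le> card K" and x: "x \<in> C"
  shows "\<phi> x = \<tau> x"
proof -
  define n where "n = complex_of_real (card K)"
  \<comment> \<open>The deviation of \<open>D\<close> from its \<phi>-mean;
    \<open>\<phi> (y\<^sup>\<star> * y)\<close> is the variance, which the hypothesis makes
    nonpositive.\<close>
  define y where "y = D - n *\<^sub>C 1"
  have Ds: "D\<^sup>\<star> = D" by (simp add: D_def star_sum star_mult)
  have y: "y \<in> C" unfolding y_def by (intro in_C D_C)
  have "y\<^sup>\<star> * y = D * D - (2 * n) *\<^sub>C D + (n * n) *\<^sub>C 1"
    by (simp add: y_def star_diff star_scaleC Ds n_def algebra_simps mult_scaleC_left mult_scaleC_right
        scaleC_scaleC scaleC_add_left[symmetric])
  then have "\<phi> (y\<^sup>\<star> * y) = \<phi> (D * D) - 2 * n * \<phi> D + n * n * \<phi> 1"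
    using D_C by (simp only: phi_add phi_diff phi_scaleC in_C)
  also have "\<phi> (D * D) = n * \<tau> D" using tau_density[OF D_C] by (simp add: n_def)
  also have "\<phi> D = n" using tau_density[of 1] tau_one in_C by (simp add: n_def)
  finally have yy: "\<phi> (y\<^sup>\<star> * y) = n * \<tau> D - n * n" by (simp add: one)
  have "Re (\<phi> (y\<^sup>\<star> * y)) \<le> 0" unfolding yy n_def using le
    by (simp add: mult_left_mono)
  then have "\<phi> (y\<^sup>\<star> * y) = 0" using pos[OF y] by (simp add: complex_nonneg_Reals_iff complex_eq_iff)
  then have "y = 0" by (rule faithful[OF y])
  then have "D = n *\<^sub>C 1" by (simp add: y_def)
  then have "n * \<tau> x = n * \<phi> x"
    using tau_density[OF x] x by (simp add: n_def mult_scaleC_right phi_scaleC)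
  then show ?thesis using card_pos by (simp add: n_def)
qed

end

lemma scaleC_one_eq_iff [simp]: "c *\<^sub>C (1::'a::cstar_algebra) = d *\<^sub>C 1 \<longleftrightarrow> c = d"
proof
  assume "c *\<^sub>C (1::'a) = d *\<^sub>C 1"
  then have "(c - d) *\<^sub>C (1::'a) = 0" by (simp add: complex_vector.scale_left_diff_distrib)
  then show "c = d" by (simp add: complex_vector.scale_eq_0_iff)
qed simp

lemma cstar_positive_scaleC_one_iff:
  "cstar_positive (c *\<^sub>C (1::'a::cstar_algebra)) \<longleftrightarrow> c \<in> \<real>\<^sub>\<ge>\<^sub>0"
proof
  assume p: "cstar_positive (c *\<^sub>C (1::'a))"
  then have "cnj c = c" using cstar_positive_selfadjoint[OF p] by (simp add: star_scaleC)
  then have c: "c = complex_of_real (Re c)" by (simp add: complex_eq_iff)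
  then have "cstar_positive (Re c *\<^sub>R (1::'a))" using p by (metis scaleR_scaleC)
  then have "Re c \<ge> 0" by (simp add: cstar_positive_scaleR_one_iff)
  then show "c \<in> \<real>\<^sub>\<ge>\<^sub>0" using c by (metis nonneg_Reals_of_real_iff)
next
  assume "c \<in> \<real>\<^sub>\<ge>\<^sub>0"
  then show "cstar_positive (c *\<^sub>C (1::'a))"
    by (auto simp: nonneg_Reals_def scaleR_scaleC[symmetric] cstar_positive_scaleR_one_iff)
qed

lemma unital_cstar_subalgebra_UNIV: "unital_cstar_subalgebra (UNIV :: 'a::cstar_algebra set)"
  by (simp add: unital_cstar_subalgebra_def complex_vector.subspace_UNIV)

lemma mem_unitary_group:
  "u \<in> unitary_group S \<longleftrightarrow> u \<in> S \<and> u\<^sup>\<star> * u = 1 \<and> u * u\<^sup>\<star> = 1"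
  by (auto simp: unitary_group_def)

lemma centralizer_subalgebra:
  assumes "\<And>b. b \<in> S \<Longrightarrow> b\<^sup>\<star> \<in> S"
  shows "unital_cstar_subalgebra (centralizer S)"
  unfolding unital_cstar_subalgebra_def
proof (intro conjI ballI complex_vector.subspaceI)
  show "closed (centralizer S)"
  proof -
    have "centralizer S = (\<Inter>b\<in>S. {x. x * b = b * x})" by (auto simp: centralizer_def)
    moreover have "closed {x. x * b = b * x}" for b :: 'a
      by (intro closed_Collect_eq continuous_intros)
    ultimately show ?thesis by auto
  qed
  show "x\<^sup>\<star> \<in> centralizer S" if "x \<in> centralizer S" for x
    unfolding centralizer_def
  proof safe
    fix b assume "b \<in> S"
    then have "x * b\<^sup>\<star> = b\<^sup>\<star> * x" using that assms by (auto simp: centralizer_def)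
    then show "x\<^sup>\<star> * b = b * x\<^sup>\<star>" by (metis star_mult star_star)
  qed
  show "x * y \<in> centralizer S" if "x \<in> centralizer S" "y \<in> centralizer S" for x y
    unfolding centralizer_def
  proof safe
    fix b assume "b \<in> S"
    then have "x * b = b * x" "y * b = b * y" using that by (auto simp: centralizer_def)
    then show "x * y * b = b * (x * y)" by (metis mult.assoc)
  qed
qed (auto simp: centralizer_def distrib_left distrib_right mult_scaleC_left mult_scaleC_right)

section \<open>Regular inclusions of simple algebras\<close>

locale regular_simple =
  fixes B :: "'a::cstar_algebra set"
  assumes B: "unital_cstar_subalgebra B"
    and simple_A: "simple_cstar_algebra (UNIV :: 'a set)"
    and simple_B: "simple_cstar_algebra B"
    and regular: "regular_inclusion B"
begin

abbreviation C :: "'a set" where "C \<equiv> centralizer B"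
abbreviation N :: "'a set" where "N \<equiv> normalizer B"

lemmas in_B = subalgebra_closure_rules[OF B]

lemma C_subalgebra: "unital_cstar_subalgebra C"
  by (rule centralizer_subalgebra) (rule subalgebra_star[OF B])

lemmas in_C = subalgebra_closure_rules[OF C_subalgebra]

lemma C_comm: "x \<in> C \<Longrightarrow> b \<in> B \<Longrightarrow> x * b = b * x"
  by (simp add: centralizer_def)

lemma C_I: "(\<And>b. b \<in> B \<Longrightarrow> x * b = b * x) \<Longrightarrow> x \<in> C"
  by (simp add: centralizer_def)

text \<open>Invariance of \<open>B\<close> under \<open>u\<close> and under
  \<open>u\<^sup>\<star>\<close> is symmetric, so closure under adjoints becomes immediate.\<close>

lemma normalizer_iff:
  "u \<in> N \<longleftrightarrow> u\<^sup>\<star> * u = 1 \<and> u * u\<^sup>\<star> = 1 \<and> (\<forall>b\<in>B. u * b * u\<^sup>\<star> \<in> B) \<and> (\<forall>b\<in>B. u\<^sup>\<star> * b * u \<in> B)"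
proof
  assume u: "u \<in> N"
  then have uu: "u\<^sup>\<star> * u = 1" "u * u\<^sup>\<star> = 1" and im: "(\<lambda>b. u * b * u\<^sup>\<star>) ` B = B"
    by (auto simp: normalizer_def mem_unitary_group)
  have "u\<^sup>\<star> * b * u \<in> B" if "b \<in> B" for b
  proof -
    have "b \<in> (\<lambda>b. u * b * u\<^sup>\<star>) ` B" using im that by simp
    then obtain b' where b': "b' \<in> B" "b = u * b' * u\<^sup>\<star>" by (rule imageE)
    have "u\<^sup>\<star> * b * u = (u\<^sup>\<star> * u) * b' * (u\<^sup>\<star> * u)" unfolding b'(2) by (simp only: mult.assoc)
    then show ?thesis using uu b' by simp
  qed
  then show "u\<^sup>\<star> * u = 1 \<and> u * u\<^sup>\<star> = 1 \<and> (\<forall>b\<in>B. u * b * u\<^sup>\<star> \<in> B) \<and> (\<forall>b\<in>B. u\<^sup>\<star> * b * u \<in> B)"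
    using uu im by auto
next
  assume u: "u\<^sup>\<star> * u = 1 \<and> u * u\<^sup>\<star> = 1 \<and> (\<forall>b\<in>B. u * b * u\<^sup>\<star> \<in> B) \<and> (\<forall>b\<in>B. u\<^sup>\<star> * b * u \<in> B)"
  have "B \<subseteq> (\<lambda>b. u * b * u\<^sup>\<star>) ` B"
  proof
    fix b assume "b \<in> B"
    then have "u\<^sup>\<star> * b * u \<in> B" using u by blast
    moreover have "u * (u\<^sup>\<star> * b * u) * u\<^sup>\<star> = (u * u\<^sup>\<star>) * b * (u * u\<^sup>\<star>)" by (simp only: mult.assoc)
    then have "b = u * (u\<^sup>\<star> * b * u) * u\<^sup>\<star>" using u by simp
    ultimately show "b \<in> (\<lambda>b. u * b * u\<^sup>\<star>) ` B" by (rule image_eqI[rotated])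
  qed
  then show "u \<in> N" using u by (auto simp: normalizer_def mem_unitary_group)
qed

lemma N_unitary: "u \<in> N \<Longrightarrow> u\<^sup>\<star> * u = 1" "u \<in> N \<Longrightarrow> u * u\<^sup>\<star> = 1"
  by (simp_all add: normalizer_iff)

lemma N_cancel: "u \<in> N \<Longrightarrow> u\<^sup>\<star> * (u * z) = z" "u \<in> N \<Longrightarrow> u * (u\<^sup>\<star> * z) = z"
  by (simp_all add: N_unitary flip: mult.assoc)

lemma N_conj: "u \<in> N \<Longrightarrow> b \<in> B \<Longrightarrow> u * b * u\<^sup>\<star> \<in> B" "u \<in> N \<Longrightarrow> b \<in> B \<Longrightarrow> u\<^sup>\<star> * b * u \<in> B"
  by (simp_all add: normalizer_iff)

lemma N_star: "u \<in> N \<Longrightarrow> u\<^sup>\<star> \<in> N"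
  by (simp add: normalizer_iff)

lemma N_one: "1 \<in> N"
  by (simp add: normalizer_iff)

lemma N_mult: "u \<in> N \<Longrightarrow> v \<in> N \<Longrightarrow> u * v \<in> N"
  unfolding normalizer_iff[of "u * v"]
proof (intro conjI ballI)
  assume u: "u \<in> N" and v: "v \<in> N"
  show "(u * v)\<^sup>\<star> * (u * v) = 1" "u * v * (u * v)\<^sup>\<star> = 1"
    by (simp_all add: star_mult mult.assoc N_cancel u v N_unitary)
  fix b assume b: "b \<in> B"
  show "u * v * b * (u * v)\<^sup>\<star> \<in> B"
    using N_conj(1)[OF u N_conj(1)[OF v b]] by (simp add: star_mult mult.assoc)
  show "(u * v)\<^sup>\<star> * b * (u * v) \<in> B"
    using N_conj(2)[OF v N_conj(2)[OF u b]] by (simp add: star_mult mult.assoc)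
qed

lemma N_conj_C: "u \<in> N \<Longrightarrow> c \<in> C \<Longrightarrow> u * c * u\<^sup>\<star> \<in> C" "u \<in> N \<Longrightarrow> c \<in> C \<Longrightarrow> u\<^sup>\<star> * c * u \<in> C"
proof -
  have *: "u * c * u\<^sup>\<star> \<in> C" if u: "u \<in> N" and c: "c \<in> C" for u c
  proof (rule C_I)
    fix b assume b: "b \<in> B"
    have "u * c * u\<^sup>\<star> * b = u * (c * (u\<^sup>\<star> * b * u)) * u\<^sup>\<star>"
      using N_unitary(2)[OF u] by (simp add: mult.assoc)
    also have "\<dots> = u * ((u\<^sup>\<star> * b * u) * c) * u\<^sup>\<star>" using C_comm[OF c N_conj(2)[OF u b]] by simp
    also have "\<dots> = b * (u * c * u\<^sup>\<star>)" by (simp add: mult.assoc N_cancel[OF u])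
    finally show "u * c * u\<^sup>\<star> * b = b * (u * c * u\<^sup>\<star>)" .
  qed
  show "u \<in> N \<Longrightarrow> c \<in> C \<Longrightarrow> u * c * u\<^sup>\<star> \<in> C" by (rule *)
  show "u \<in> N \<Longrightarrow> c \<in> C \<Longrightarrow> u\<^sup>\<star> * c * u \<in> C" using *[OF N_star, of u c] by simp
qed

section \<open>Classes of normalizers\<close>

text \<open>Congruence modulo the product of the two unitary groups, written on elements; it can be
  used before any quotient group is formed.\<close>

definition same_class :: "'a \<Rightarrow> 'a \<Rightarrow> bool" where
  "same_class u v \<longleftrightarrow> (\<exists>b\<in>unitary_group B. \<exists>k\<in>unitary_group C. u = b * k * v)"

lemma same_class_refl: "same_class u u"
  unfolding same_class_def
  by (intro bexI[of _ 1]) (auto simp: mem_unitary_group in_B in_C)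

lemma UB_UC_comm: "b \<in> unitary_group B \<Longrightarrow> k \<in> unitary_group C \<Longrightarrow> k * b = b * k"
  by (auto simp: mem_unitary_group intro: C_comm)

lemma unitary_group_star: "u \<in> unitary_group S \<Longrightarrow> unital_cstar_subalgebra S \<Longrightarrow> u\<^sup>\<star> \<in> unitary_group S"
  by (auto simp: mem_unitary_group intro: subalgebra_star)

lemma unitary_group_mult:
  "u \<in> unitary_group S \<Longrightarrow> v \<in> unitary_group S \<Longrightarrow> unital_cstar_subalgebra S \<Longrightarrow> u * v \<in> unitary_group S"
proof -
  assume u: "u \<in> unitary_group S" and v: "v \<in> unitary_group S" and S: "unital_cstar_subalgebra S"
  have "(u * v)\<^sup>\<star> * (u * v) = v\<^sup>\<star> * (u\<^sup>\<star> * u) * v" "u * v * (u * v)\<^sup>\<star> = u * (v * v\<^sup>\<star>) * u\<^sup>\<star>"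
    by (simp_all only: star_mult mult.assoc)
  then show ?thesis using u v subalgebra_mult[OF S] by (simp add: mem_unitary_group)
qed

lemma same_class_sym: "same_class u v \<Longrightarrow> same_class v u"
proof -
  assume "same_class u v"
  then obtain b k where b: "b \<in> unitary_group B" and k: "k \<in> unitary_group C" and u: "u = b * k * v"
    by (auto simp: same_class_def)
  have "b\<^sup>\<star> * k\<^sup>\<star> * u = b\<^sup>\<star> * k\<^sup>\<star> * (k * b) * v"
    unfolding u UB_UC_comm[OF b k] by (simp add: mult.assoc)
  also have "\<dots> = b\<^sup>\<star> * (k\<^sup>\<star> * k) * b * v" by (simp only: mult.assoc)
  also have "\<dots> = v" using b k by (simp add: mem_unitary_group)
  finally have "v = b\<^sup>\<star> * k\<^sup>\<star> * u" by simp
  then show ?thesis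
    using unitary_group_star b k B C_subalgebra unfolding same_class_def by blast
qed

lemma same_class_trans: "same_class u v \<Longrightarrow> same_class v w \<Longrightarrow> same_class u w"
proof -
  assume "same_class u v" "same_class v w"
  then obtain b k b' k' where b: "b \<in> unitary_group B" "b' \<in> unitary_group B"
    and k: "k \<in> unitary_group C" "k' \<in> unitary_group C" and u: "u = b * k * (b' * k' * w)"
    by (auto simp: same_class_def)
  have "b * k * (b' * k' * w) = b * (k * b') * k' * w" by (simp only: mult.assoc)
  also have "\<dots> = (b * b') * (k * k') * w" using UB_UC_comm[OF b(2) k(1)] by (simp add: mult.assoc)
  finally have "u = (b * b') * (k * k') * w" using u by simp
  then show ?thesis
    using unitary_group_mult b k B C_subalgebra unfolding same_class_def by blast
qed

text \<open>Taking adjoints puts the unitaries of \<open>B\<close> and \<open>C\<close> to the right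
  of \<open>v\<close>; conjugation by \<open>v\<close> preserves both groups and brings them back.
  Thus adjoints of inequivalent representatives stay inequivalent, as right orthonormality
  requires.\<close>

lemma same_class_of_star:
  assumes u: "u \<in> N" and v: "v \<in> N"
  shows "same_class (u\<^sup>\<star>) (v\<^sup>\<star>) \<Longrightarrow> same_class u v"
proof -
  assume "same_class (u\<^sup>\<star>) (v\<^sup>\<star>)"
  then obtain b k where b: "b \<in> unitary_group B" and k: "k \<in> unitary_group C" and e: "u\<^sup>\<star> = b * k * v\<^sup>\<star>"
    by (auto simp: same_class_def)
  have "u = (b * k * v\<^sup>\<star>)\<^sup>\<star>" unfolding e[symmetric] by simp
  also have "\<dots> = v * k\<^sup>\<star> * b\<^sup>\<star>" by (simp add: star_mult mult.assoc)
  also have "\<dots> = (v * k\<^sup>\<star> * v\<^sup>\<star>) * (v * b\<^sup>\<star> * v\<^sup>\<star>) * v"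
    by (simp add: mult.assoc N_cancel N_unitary v)
  finally have e2: "u = (v * k\<^sup>\<star> * v\<^sup>\<star>) * (v * b\<^sup>\<star> * v\<^sup>\<star>) * v" .
  have conj: "(v * x * v\<^sup>\<star>)\<^sup>\<star> * (v * x * v\<^sup>\<star>) = 1 \<and> (v * x * v\<^sup>\<star>) * (v * x * v\<^sup>\<star>)\<^sup>\<star> = 1"
    if "x\<^sup>\<star> * x = 1" "x * x\<^sup>\<star> = 1" for x
  proof -
    have "x\<^sup>\<star> * (x * z) = z" "x * (x\<^sup>\<star> * z) = z" for z using that by (simp_all flip: mult.assoc)
    then show ?thesis by (simp add: star_mult mult.assoc N_cancel N_unitary v)
  qed
  have k': "v * k\<^sup>\<star> * v\<^sup>\<star> \<in> unitary_group C" and b': "v * b\<^sup>\<star> * v\<^sup>\<star> \<in> unitary_group B"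
    using b k unfolding mem_unitary_group
    by (intro conjI N_conj_C N_conj v in_B in_C conj[THEN conjunct1] conj[THEN conjunct2]; simp)+
  show ?thesis unfolding same_class_def
    using k' b' e2 UB_UC_comm[OF b' k'] by auto
qed

lemma unitary_scaling:
  assumes z: "z \<noteq> 0" and 1: "z\<^sup>\<star> * z = c *\<^sub>C 1" and 2: "z * z\<^sup>\<star> = d *\<^sub>C 1"
  shows "\<exists>r>0. (r *\<^sub>R z)\<^sup>\<star> * (r *\<^sub>R z) = 1 \<and> (r *\<^sub>R z) * (r *\<^sub>R z)\<^sup>\<star> = 1"
proof -
  have "c \<in> \<real>\<^sub>\<ge>\<^sub>0" "d \<in> \<real>\<^sub>\<ge>\<^sub>0"
    using cstar_positive_star_mult[of z] cstar_positive_mult_star[of z]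
    unfolding 1 2 cstar_positive_scaleC_one_iff by auto
  moreover have "cmod c = (norm z)\<^sup>2" "cmod d = (norm z)\<^sup>2"
    using cstar_identity[of z] cstar_identity'[of z] by (simp_all add: 1 2 norm_scaleC)
  ultimately have cd: "c = complex_of_real ((norm z)\<^sup>2)" "d = complex_of_real ((norm z)\<^sup>2)"
    by (auto simp: nonneg_Reals_def)
  then have 3: "z\<^sup>\<star> * z = (norm z)\<^sup>2 *\<^sub>R 1" "z * z\<^sup>\<star> = (norm z)\<^sup>2 *\<^sub>R 1"
    by (simp_all only: 1 2 scaleR_scaleC)
  show ?thesis
  proof (intro exI conjI)
    show "1 / norm z > 0" using z by simp
    show "((1 / norm z) *\<^sub>R z)\<^sup>\<star> * ((1 / norm z) *\<^sub>R z) = 1" "((1 / norm z) *\<^sub>R z) * ((1 / norm z) *\<^sub>R z)\<^sup>\<star> = 1"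
      using z by (simp_all add: 3 power2_eq_square)
  qed
qed

text \<open>A nonzero element of \<open>B\<close> intertwining two automorphisms is, up to scaling, a unitary, because
  \<open>B\<close> has trivial centre.\<close>

lemma same_class_of_intertwiner:
  assumes u: "u \<in> N" and v: "v \<in> N" and z: "z \<in> B" "z \<noteq> 0"
    and inter: "\<And>b. b \<in> B \<Longrightarrow> z * b = (u * v\<^sup>\<star> * b * (v * u\<^sup>\<star>)) * z"
  shows "same_class u v"
proof -
  define w where "w = u * v\<^sup>\<star>"
  have w: "w \<in> N" unfolding w_def by (intro N_mult N_star u v)
  have ws: "w\<^sup>\<star> = v * u\<^sup>\<star>" by (simp add: w_def star_mult)
  have int: "z * b = w * b * w\<^sup>\<star> * z" if "b \<in> B" for b
    using inter[OF that] unfolding ws unfolding w_def by (simp add: mult.assoc)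
  have int': "b * z\<^sup>\<star> = z\<^sup>\<star> * (w * b * w\<^sup>\<star>)" if b: "b \<in> B" for b
  proof -
    have "(z * b\<^sup>\<star>)\<^sup>\<star> = (w * b\<^sup>\<star> * w\<^sup>\<star> * z)\<^sup>\<star>" using int[OF in_B(4)[OF b]] by simp
    then show ?thesis by (simp add: star_mult mult.assoc)
  qed
  have zs: "z\<^sup>\<star> \<in> B" by (intro in_B z)
  \<comment> \<open>The intertwining relation and its adjoint make
    \<open>z\<^sup>\<star> * z\<close>, and likewise \<open>z * z\<^sup>\<star>\<close>, central in
    \<open>B\<close> and hence scalar.\<close>
  have "z\<^sup>\<star> * z * b = b * (z\<^sup>\<star> * z)" if b: "b \<in> B" for b
    using int[OF b] int'[OF b] by (metis mult.assoc)
  then obtain c where c: "z\<^sup>\<star> * z = c *\<^sub>C 1"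
    using central_imp_scalar[OF B simple_B, of "z\<^sup>\<star> * z"] in_B(3)[OF zs z(1)] by blast
  have "z * z\<^sup>\<star> * b = b * (z * z\<^sup>\<star>)" if b: "b \<in> B" for b
  proof -
    have b': "w\<^sup>\<star> * b * w \<in> B" by (rule N_conj[OF w b])
    have bb: "w * (w\<^sup>\<star> * b * w) * w\<^sup>\<star> = b" by (simp add: mult.assoc N_cancel[OF w] N_unitary[OF w])
    show ?thesis using int[OF b'] int'[OF b'] unfolding bb by (metis mult.assoc)
  qed
  then obtain d where d: "z * z\<^sup>\<star> = d *\<^sub>C 1"
    using central_imp_scalar[OF B simple_B, of "z * z\<^sup>\<star>"] in_B(3)[OF z(1) zs] by blast
  obtain r where r: "r > 0" "(r *\<^sub>R z)\<^sup>\<star> * (r *\<^sub>R z) = 1" "(r *\<^sub>R z) * (r *\<^sub>R z)\<^sup>\<star> = 1"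
    using unitary_scaling[OF z(2) c d] by blast
  define y where "y = r *\<^sub>R z"
  have yB: "y \<in> B" unfolding y_def by (intro in_B z)
  have y: "y \<in> unitary_group B" using r yB by (simp add: mem_unitary_group y_def)
  have yu: "y\<^sup>\<star> * y = 1" "y * y\<^sup>\<star> = 1" using r by (simp_all add: y_def)
  \<comment> \<open>The unitary \<open>y\<close> of \<open>B\<close> and the normalizer
    \<open>w\<close> induce the same automorphism of \<open>B\<close>, so their quotient lies in the
    centralizer.\<close>
  define k where "k = y\<^sup>\<star> * w"
  have kC: "k \<in> C"
  proof (rule C_I)
    fix b assume b: "b \<in> B"
    have "b * y\<^sup>\<star> = y\<^sup>\<star> * (w * b * w\<^sup>\<star>)" using int'[OF b] by (simp add: y_def)
    then have "b * y\<^sup>\<star> * w = y\<^sup>\<star> * w * b" by (simp add: mult.assoc N_unitary[OF w])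
    then show "k * b = b * k" by (simp add: k_def mult.assoc)
  qed
  have "k\<^sup>\<star> * k = w\<^sup>\<star> * (y * y\<^sup>\<star>) * w" "k * k\<^sup>\<star> = y\<^sup>\<star> * (w * w\<^sup>\<star>) * y"
    by (simp_all only: k_def star_mult star_star mult.assoc)
  then have k: "k \<in> unitary_group C"
    using kC yu N_unitary[OF w] by (simp add: mem_unitary_group)
  have "y * k * v = (y * y\<^sup>\<star>) * u * (v\<^sup>\<star> * v)" by (simp only: k_def w_def mult.assoc)
  then have "u = y * k * v" using yu N_unitary[OF v] by simp
  then show ?thesis using y k unfolding same_class_def by blast
qed

lemma weyl_set_mult: "unitary_group B <#>\<^bsub>normalizer_group B\<^esub> unitary_group C =
    {b * k | b k. b \<in> unitary_group B \<and> k \<in> unitary_group C}"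
  by (auto simp: set_mult_def normalizer_group_def)

definition weyl_class :: "'a \<Rightarrow> 'a set" where "weyl_class u = {w. same_class w u}"

lemma carrier_generalized_Weyl_group: "carrier (generalized_Weyl_group B) = weyl_class ` N"
proof -
  have "(unitary_group B <#>\<^bsub>normalizer_group B\<^esub> unitary_group C) #>\<^bsub>normalizer_group B\<^esub> u = weyl_class u" for u
    unfolding weyl_set_mult by (auto simp: r_coset_def normalizer_group_def weyl_class_def same_class_def)
  then show ?thesis
    by (auto simp: generalized_Weyl_group_def FactGroup_def RCOSETS_def normalizer_group_def)
qed

lemma weyl_class_eq_iff: "weyl_class u = weyl_class v \<longleftrightarrow> same_class u v"
  unfolding weyl_class_def using same_class_refl same_class_sym same_class_trans by blast

definition reps :: "'a set" where
  "reps = (\<lambda>X. SOME u. u \<in> N \<and> weyl_class u = X) ` carrier (generalized_Weyl_group B)"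

lemma rep_props:
  assumes "X \<in> carrier (generalized_Weyl_group B)"
  shows "(SOME u. u \<in> N \<and> weyl_class u = X) \<in> N \<and> weyl_class (SOME u. u \<in> N \<and> weyl_class u = X) = X"
proof -
  have "\<exists>u. u \<in> N \<and> weyl_class u = X" using assms carrier_generalized_Weyl_group by auto
  then show ?thesis by (rule someI_ex)
qed

lemma reps_N: "w \<in> reps \<Longrightarrow> w \<in> N"
  using rep_props by (auto simp: reps_def)

lemma reps_distinct: "v \<in> reps \<Longrightarrow> w \<in> reps \<Longrightarrow> same_class v w \<Longrightarrow> v = w"
proof -
  assume "v \<in> reps" "w \<in> reps" and s: "same_class v w"
  then obtain X Y where X: "X \<in> carrier (generalized_Weyl_group B)" "v = (SOME u. u \<in> N \<and> weyl_class u = X)"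
    and Y: "Y \<in> carrier (generalized_Weyl_group B)" "w = (SOME u. u \<in> N \<and> weyl_class u = Y)"
    by (auto simp: reps_def)
  have "weyl_class v = X" "weyl_class w = Y" using rep_props[OF X(1)] rep_props[OF Y(1)] X(2) Y(2) by auto
  then show "v = w" using s weyl_class_eq_iff X(2) Y(2) by metis
qed

lemma reps_cover:
  assumes "u \<in> N"
  obtains w where "w \<in> reps" "same_class u w"
proof -
  have X: "weyl_class u \<in> carrier (generalized_Weyl_group B)"
    using assms carrier_generalized_Weyl_group by auto
  then have "weyl_class (SOME w. w \<in> N \<and> weyl_class w = weyl_class u) = weyl_class u" using rep_props by blast
  then have "same_class u (SOME w. w \<in> N \<and> weyl_class w = weyl_class u)" using weyl_class_eq_iff by metis
  then show thesis using that X unfolding reps_def by blast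
qed

lemma reps_bij: "bij_betw weyl_class reps (carrier (generalized_Weyl_group B))"
proof (rule bij_betwI')
  show "(weyl_class x = weyl_class y) = (x = y)" if "x \<in> reps" "y \<in> reps" for x y
    using that reps_distinct weyl_class_eq_iff by blast
  show "weyl_class x \<in> carrier (generalized_Weyl_group B)" if "x \<in> reps" for x
    using reps_N[OF that] carrier_generalized_Weyl_group by auto
  show "\<exists>x\<in>reps. y = weyl_class x" if y: "y \<in> carrier (generalized_Weyl_group B)" for y
    using rep_props[OF y] y unfolding reps_def by blast
qed

section \<open>Density of the span of the normalizers\<close>

lemma span_N_mult:
  assumes x: "x \<in> complex_vector.span N" and y: "y \<in> complex_vector.span N"
  shows "x * y \<in> complex_vector.span N"
proof -
  have 1: "x * v \<in> complex_vector.span N" if "v \<in> N" for v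
  proof -
    have "complex_vector.span N \<subseteq> {x. x * v \<in> complex_vector.span N}"
      by (rule complex_vector.span_minimal)
        (auto intro!: complex_vector.subspaceI intro: complex_vector.span_base[OF N_mult] that
          complex_vector.span_zero complex_vector.span_add complex_vector.span_scale
          simp: distrib_right mult_scaleC_left)
    then show ?thesis using x by blast
  qed
  have "complex_vector.span N \<subseteq> {y. x * y \<in> complex_vector.span N}"
    by (rule complex_vector.span_minimal)
      (auto intro!: complex_vector.subspaceI intro: 1
          complex_vector.span_zero complex_vector.span_add complex_vector.span_scale
          simp: distrib_left mult_scaleC_right)
  then show ?thesis using y by blast
qed

lemma span_N_star:
  assumes x: "x \<in> complex_vector.span N"
  shows "x\<^sup>\<star> \<in> complex_vector.span N"
proof -
  have "complex_vector.span N \<subseteq> {x. x\<^sup>\<star> \<in> complex_vector.span N}"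
    by (rule complex_vector.span_minimal)
      (auto intro!: complex_vector.subspaceI intro: complex_vector.span_base[OF N_star]
          complex_vector.span_zero complex_vector.span_add complex_vector.span_scale
          simp: star_add star_scaleC)
  then show ?thesis using x by blast
qed

text \<open>The usable form of regularity. Normalizers are closed under products and adjoints, so
  the closure of their linear span is already a $C^*$-algebra and identities that are linear and
  continuous need checking only on them.\<close>

lemma closed_subspace_eq_UNIV:
  assumes "complex_vector.subspace T" "closed T" "N \<subseteq> T"
  shows "T = UNIV"
proof -
  let ?S = "closure (complex_vector.span N)"
  have "unital_cstar_subalgebra ?S"
    unfolding unital_cstar_subalgebra_def
  proof (intro conjI ballI)
    show "1 \<in> ?S" by (intro subsetD[OF closure_subset] complex_vector.span_base N_one)
    show "complex_vector.subspace ?S"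
      by (intro complex_subspace_closure complex_vector.subspace_span)
    show "x * y \<in> ?S" if "x \<in> ?S" "y \<in> ?S" for x y
      by (rule closure_binop[OF _ _ that])
        (auto intro!: continuous_intros span_N_mult closure_subset[THEN subsetD])
    show "x\<^sup>\<star> \<in> ?S" if "x \<in> ?S" for x
    proof -
      have "star ` ?S \<subseteq> closure (star ` complex_vector.span N)"
        by (rule closure_bounded_linear_image_subset[OF bounded_linear_star])
      also have "\<dots> \<subseteq> ?S" by (rule closure_mono) (auto intro: span_N_star)
      finally show ?thesis using that by blast
    qed
  qed simp
  moreover have "N \<subseteq> ?S" by (meson closure_subset complex_vector.span_superset order_trans)
  ultimately have "UNIV \<subseteq> ?S"
    using regular unfolding regular_inclusion_def by (metis hull_minimal)
  also have "?S \<subseteq> T"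
    by (intro closure_minimal complex_vector.span_minimal assms)
  finally show ?thesis by blast
qed

end

section \<open>Quasi-bases from normalizers\<close>

locale regular_expectation = regular_simple B + cond_exp B E
  for B :: "'a::cstar_algebra set" and E
begin

definition \<phi> :: "'a \<Rightarrow> complex" where "\<phi> x = (THE c. E x = c *\<^sub>C 1)"

lemma E_C:
  assumes x: "x \<in> C"
  shows "E x = \<phi> x *\<^sub>C 1"
proof -
  have "E x * b = b * E x" if "b \<in> B" for b
    using E_left[OF that, of x] E_right[OF that, of x] C_comm[OF x that] by simp
  then obtain c where c: "E x = c *\<^sub>C 1"
    using central_imp_scalar[OF B simple_B E_in] by blast
  then have "\<phi> x = c" unfolding \<phi>_def by (intro the_equality) auto
  then show ?thesis using c by simp
qed

lemma phi_unique: "x \<in> C \<Longrightarrow> E x = c *\<^sub>C 1 \<Longrightarrow> \<phi> x = c"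
  using E_C[of x] by simp

text \<open>Faithfulness is kept as a hypothesis because the lemma is also applied to
  \<open>E\<tau>\<close> at a point where its finite index is still to be derived.\<close>

lemma faithful_state_phi:
  assumes "\<And>x. x \<in> C \<Longrightarrow> E (x\<^sup>\<star> * x) = 0 \<Longrightarrow> x = 0"
  shows "faithful_state C \<phi>"
proof
  show "linear_on C \<phi>"
    by (rule linear_onI; rule phi_unique)
      (simp_all add: in_C E_add E_scaleC E_C complex_vector.scale_left_distrib scaleC_scaleC)
  show "\<phi> (x\<^sup>\<star>) = cnj (\<phi> x)" if "x \<in> C" for x
    using that by (intro phi_unique) (simp_all add: in_C E_star E_C star_scaleC)
  show "\<phi> (x\<^sup>\<star> * x) \<in> \<real>\<^sub>\<ge>\<^sub>0" if "x \<in> C" for x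
    using E_positive[OF cstar_positive_star_mult[of x]] that
    by (simp add: E_C in_C cstar_positive_scaleC_one_iff)
  show "x = 0" if "x \<in> C" "\<phi> (x\<^sup>\<star> * x) = 0" for x
    using assms[of x] that by (simp add: E_C in_C)
  show "\<phi> 1 = 1" by (intro phi_unique) (simp_all add: in_C)
qed (rule C_subalgebra)

lemma finite_index_faithful:
  assumes "finite_index E"
  shows "faithful_state C \<phi>"
proof (rule faithful_state_phi)
  fix x assume "E (x\<^sup>\<star> * x) = 0"
  moreover obtain K where "\<forall>x. (norm x)\<^sup>2 \<le> K * norm (E (x\<^sup>\<star> * x))"
    using norm_le_E_norm[OF assms] by blast
  ultimately have "(norm x)\<^sup>2 \<le> 0" by (metis mult_zero_right norm_zero)
  then show "x = 0" by simp
qed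

text \<open>\<open>E (k * k\<^sup>\<star>) = 1\<close> gives \<open>norm k \<ge> 1\<close>, so norm
  equivalence keeps \<open>\<phi> (k\<^sup>\<star> * k)\<close> above the fixed value
  \<open>1 / c\<close>, while Bessel bounds the sum of all
  \<open>k\<^sup>\<star> * k\<close>.\<close>

lemma orthonormal_card_bounded:
  assumes fin: "finite_index E"
  obtains n where "\<And>K. faithful_state.orthonormal C \<phi> K \<Longrightarrow> card K \<le> n"
proof -
  interpret faithful_state C \<phi> using finite_index_faithful[OF fin] .
  obtain c where c: "c > 0" "\<And>x. (norm x)\<^sup>2 \<le> c * norm (E (x\<^sup>\<star> * x))"
    using norm_le_E_norm[OF fin] by blast
  obtain M where M: "\<And>V. finite V \<Longrightarrow>
      (\<And>v w. v \<in> V \<Longrightarrow> w \<in> V \<Longrightarrow> E (v * w\<^sup>\<star>) = (if v = w then 1 else 0)) \<Longrightarrow>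
      norm (\<Sum>v\<in>V. v\<^sup>\<star> * v) \<le> M"
    using orthonormal_sum_bounded[OF fin] by metis
  show thesis
  proof (rule that)
    fix K assume K: "orthonormal K"
    note KD = orthonormalD[OF K]
    have "E (v * w\<^sup>\<star>) = (if v = w then 1 else 0)" if "v \<in> K" "w \<in> K" for v w
      using KD(4)[OF that] E_C[of "v * w\<^sup>\<star>"] KD(3) that by (simp add: in_C)
    then have M1: "norm (\<Sum>v\<in>K. v\<^sup>\<star> * v) \<le> M" by (rule M[OF KD(1)])
    have pos1: "cstar_positive (\<Sum>v\<in>K. v\<^sup>\<star> * v)" by (rule cstar_positive_sum) simp
    have one: "1 \<le> c * Re (\<phi> (k\<^sup>\<star> * k))" if k: "k \<in> K" for k
    proof -
      have kk: "k * k\<^sup>\<star> \<in> C" "k\<^sup>\<star> * k \<in> C" using KD(3)[OF k] by (simp_all add: in_C)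
      have "1 = norm (E (k * k\<^sup>\<star>))" using KD(4)[OF k k] E_C[OF kk(1)] by simp
      also have "\<dots> \<le> (norm k)\<^sup>2"
        using E_norm_positive[of "k * k\<^sup>\<star>"] by (simp add: cstar_identity')
      also have "\<dots> \<le> c * norm (E (k\<^sup>\<star> * k))" by (rule c)
      also have "norm (E (k\<^sup>\<star> * k)) = Re (\<phi> (k\<^sup>\<star> * k))"
        using pos[OF KD(3)[OF k]] by (auto simp: E_C[OF kk(2)] norm_scaleC nonneg_Reals_def)
      finally show ?thesis .
    qed
    have SC: "(\<Sum>k\<in>K. k\<^sup>\<star> * k) \<in> C" by (intro in_C KD(3))
    have "real (card K) \<le> (\<Sum>k\<in>K. c * Re (\<phi> (k\<^sup>\<star> * k)))"
      using sum_mono[of K "\<lambda>_. 1", OF one] by simp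
    also have "\<dots> = c * Re (\<phi> (\<Sum>k\<in>K. k\<^sup>\<star> * k))"
      by (subst phi_sum) (simp_all add: sum_distrib_left in_C KD(3))
    also have "\<dots> \<le> c * norm (E (\<Sum>k\<in>K. k\<^sup>\<star> * k))"
      using c(1) by (simp add: E_C[OF SC] norm_scaleC complex_Re_le_cmod)
    also have "\<dots> \<le> c * M"
      using E_norm_positive[OF pos1] M1 c(1) by simp
    finally show "card K \<le> nat \<lceil>c * M\<rceil>" by linarith
  qed
qed

lemma orthonormal_basis_exists:
  assumes fin: "finite_index E"
  obtains K where "orthonormal_basis C \<phi> K"
proof -
  interpret faithful_state C \<phi> using finite_index_faithful[OF fin] .
  obtain n where "\<And>K. orthonormal K \<Longrightarrow> card K \<le> n" using orthonormal_card_bounded[OF fin] by blast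
  then obtain K where "orthonormal K" "\<And>x. x \<in> C \<Longrightarrow> x = (\<Sum>k\<in>K. \<phi> (x * k\<^sup>\<star>) *\<^sub>C k)"
    using orthonormal_basis_exists by blast
  then have "orthonormal_basis C \<phi> K" by unfold_locales
  then show thesis by (rule that)
qed

text \<open>The element \<open>u * c * v\<^sup>\<star>\<close> intertwines \<open>b\<close> with its
  image under conjugation by \<open>u * v\<^sup>\<star>\<close>. The bimodule property passes this
  to its expectation, which lies in \<open>B\<close>, and a nonzero intertwiner in \<open>B\<close>
  would put \<open>u\<close> and \<open>v\<close> in one class.\<close>

lemma E_different_classes:
  assumes u: "u \<in> N" and v: "v \<in> N" and c: "c \<in> C" and ne: "\<not> same_class u v"
  shows "E (u * c * v\<^sup>\<star>) = 0"
proof (rule ccontr)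
  assume nz: "E (u * c * v\<^sup>\<star>) \<noteq> 0"
  have "same_class u v"
  proof (rule same_class_of_intertwiner[OF u v E_in nz])
    fix b assume b: "b \<in> B"
    have b1: "v\<^sup>\<star> * b * v \<in> B" by (rule N_conj[OF v b])
    have b2: "u * (v\<^sup>\<star> * b * v) * u\<^sup>\<star> \<in> B" by (rule N_conj[OF u b1])
    have "u * c * v\<^sup>\<star> * b = u * (c * (v\<^sup>\<star> * b * v)) * v\<^sup>\<star>"
      by (simp add: mult.assoc N_unitary[OF v])
    also have "\<dots> = u * ((v\<^sup>\<star> * b * v) * c) * v\<^sup>\<star>" using C_comm[OF c b1] by simp
    also have "\<dots> = (u * (v\<^sup>\<star> * b * v) * u\<^sup>\<star>) * (u * c * v\<^sup>\<star>)"
      by (simp add: mult.assoc N_cancel[OF u])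
    finally have "E (u * c * v\<^sup>\<star> * b) = E ((u * (v\<^sup>\<star> * b * v) * u\<^sup>\<star>) * (u * c * v\<^sup>\<star>))" by simp
    then have "E (u * c * v\<^sup>\<star>) * b = (u * (v\<^sup>\<star> * b * v) * u\<^sup>\<star>) * E (u * c * v\<^sup>\<star>)"
      unfolding E_right[OF b] E_left[OF b2] .
    then show "E (u * c * v\<^sup>\<star>) * b = u * v\<^sup>\<star> * b * (v * u\<^sup>\<star>) * E (u * c * v\<^sup>\<star>)"
      by (simp add: mult.assoc)
  qed
  then show False using ne by blast
qed

text \<open>Representatives are orthonormal themselves, and being unitary they turn the sum in
  Bessel's bound into their number.\<close>

lemma finite_reps:
  assumes fin: "finite_index E"
  shows "finite reps"
proof (rule ccontr)
  assume inf: "infinite reps"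
  obtain M where M: "\<And>V. finite V \<Longrightarrow>
      (\<And>v w. v \<in> V \<Longrightarrow> w \<in> V \<Longrightarrow> E (v * w\<^sup>\<star>) = (if v = w then 1 else 0)) \<Longrightarrow>
      norm (\<Sum>v\<in>V. v\<^sup>\<star> * v) \<le> M"
    using orthonormal_sum_bounded[OF fin] by metis
  obtain F where F: "F \<subseteq> reps" "finite F" "card F = Suc (nat \<lceil>M\<rceil>)"
    using infinite_arbitrarily_large[OF inf] by metis
  have "E (v * w\<^sup>\<star>) = (if v = w then 1 else 0)" if "v \<in> F" "w \<in> F" for v w
  proof (cases "v = w")
    case True
    then show ?thesis using N_unitary reps_N F that by (metis E_one subset_iff)
  next
    case False
    then have "\<not> same_class v w" using reps_distinct F that by blast
    then have "E (v * 1 * w\<^sup>\<star>) = 0" using F that by (intro E_different_classes reps_N in_C) auto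
    then show ?thesis using False by simp
  qed
  then have "norm (\<Sum>v\<in>F. v\<^sup>\<star> * v) \<le> M" by (rule M[OF F(2)])
  moreover have "(\<Sum>v\<in>F. v\<^sup>\<star> * v) = (\<Sum>v\<in>F. 1)"
    using F reps_N N_unitary by (intro sum.cong) auto
  ultimately have "real (card F) \<le> M" by simp
  then show False using F by linarith
qed

end

text \<open>Finiteness of \<open>reps\<close>, which depends on \<open>B\<close> alone, is assumed
  in place of finite index. The locale thereby applies to \<open>E\<tau>\<close> as well, and
  \<open>finite_index_E\<close> returns finite index as a result.\<close>

locale regular_basis = regular_expectation B E + orthonormal_basis "centralizer B" \<phi> K
  for B :: "'a::cstar_algebra set" and E and K +
  assumes finite_reps: "finite reps"
begin

definition V :: "'a set" where "V = (\<lambda>(k, w). k * w) ` (K \<times> reps)"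

lemma E_left_products:
  assumes k: "k \<in> C" "m \<in> C" and v: "v \<in> reps" "w \<in> reps"
  shows "E (k * v * (m * w)\<^sup>\<star>) = (if v = w then \<phi> (k * m\<^sup>\<star>) else 0) *\<^sub>C 1"
proof (cases "v = w")
  case True
  have "k * v * (m * w)\<^sup>\<star> = k * m\<^sup>\<star>"
    using N_cancel(2)[OF reps_N[OF v(2)]] by (simp add: True star_mult mult.assoc)
  then show ?thesis using True k by (simp add: E_C in_C)
next
  case False
  have vN: "v \<in> N" "w \<in> N" using v reps_N by auto
  \<comment> \<open>Conjugating \<open>k\<close> and \<open>m\<^sup>\<star>\<close> past the
    normalizers collects an element of \<open>C\<close> between \<open>v\<close> and
    \<open>w\<^sup>\<star>\<close>.\<close>
  have "k * v * (m * w)\<^sup>\<star> = v * ((v\<^sup>\<star> * k * v) * (w\<^sup>\<star> * m\<^sup>\<star> * w)) * w\<^sup>\<star>"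
    by (simp add: star_mult mult.assoc N_cancel[OF vN(1)] N_unitary[OF vN(2)])
  moreover have "(v\<^sup>\<star> * k * v) * (w\<^sup>\<star> * m\<^sup>\<star> * w) \<in> C" by (intro in_C(3,4) N_conj_C vN k)
  ultimately show ?thesis
    using E_different_classes[OF vN] reps_distinct[OF v] False by auto
qed

lemma V_eq_iff:
  assumes "k \<in> K" "m \<in> K" "v \<in> reps" "w \<in> reps"
  shows "k * v = m * w \<longleftrightarrow> k = m \<and> v = w"
proof
  assume eq: "k * v = m * w"
  have "E (k * v * (m * w)\<^sup>\<star>) = E (m * w * (m * w)\<^sup>\<star>)" using eq by simp
  then show "k = m \<and> v = w"
    using E_left_products[OF K_C K_C, OF assms] E_left_products[OF K_C K_C, OF assms(2,2,4,4)] assms K_on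
    by (auto split: if_splits)
qed simp

lemma V_inj: "inj_on (\<lambda>(k, w). k * w) (K \<times> reps)"
  using V_eq_iff by (auto simp: inj_on_def)

lemma finite_V: "finite V" unfolding V_def using K_fin finite_reps by simp

lemma sum_V: "(\<Sum>v\<in>V. f v) = (\<Sum>k\<in>K. \<Sum>w\<in>reps. f (k * w))"
  unfolding V_def by (subst sum.reindex[OF V_inj]) (simp add: sum.cartesian_product case_prod_unfold o_def)

lemma left_orthonormal: "v \<in> V \<Longrightarrow> w \<in> V \<Longrightarrow> E (v * w\<^sup>\<star>) = (if v = w then 1 else 0)"
proof -
  assume "v \<in> V" "w \<in> V"
  then obtain k m v' w' where *: "k \<in> K" "m \<in> K" "v' \<in> reps" "w' \<in> reps" "v = k * v'" "w = m * w'"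
    by (auto simp: V_def)
  then show ?thesis
    using E_left_products[OF K_C K_C, of k m v' w'] V_eq_iff[of k m v' w'] K_on[of k m] by auto
qed

text \<open>Both sides are linear and continuous in \<open>x\<close>. The parameters
  \<open>g\<close> and \<open>h\<close> let the lemma serve the left and the right
  expansion.\<close>

lemma expansion_closed:
  assumes "\<And>u. u \<in> N \<Longrightarrow> (\<Sum>v\<in>V. E (u * g v) * h v) = u"
  shows "(\<Sum>v\<in>V. E (x * g v) * h v) = x"
proof -
  let ?T = "{x. (\<Sum>v\<in>V. E (x * g v) * h v) = x}"
  have cont: "continuous_on UNIV (\<lambda>x. E (x * y))" for y
    by (rule linear_continuous_on[OF bounded_linear_compose[OF bounded_linear_E bounded_linear_mult_left]])
  have "?T = UNIV"
  proof (rule closed_subspace_eq_UNIV)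
    show "complex_vector.subspace ?T"
      by (rule complex_vector.subspaceI)
        (simp_all add: distrib_right E_add sum.distrib mult_scaleC_left E_scaleC
          complex_vector.scale_sum_right[symmetric])
    show "closed ?T"
      by (intro closed_Collect_eq continuous_intros cont)
    show "N \<subseteq> ?T" using assms by blast
  qed
  then show ?thesis by blast
qed

text \<open>For a normalizer \<open>b * c * w\<close> only the terms with representative
  \<open>w\<close> survive; \<open>b\<close> leaves the expectation on the left and the expansion of
  \<open>c\<close> in \<open>K\<close> remains.\<close>

lemma left_expansion: "x = (\<Sum>v\<in>V. E (x * v\<^sup>\<star>) * v)"
proof (rule expansion_closed[symmetric, of star "\<lambda>v. v"])
  fix u assume "u \<in> N"
  then obtain w where w: "w \<in> reps" "same_class u w" by (rule reps_cover)
  then obtain b c where b: "b \<in> unitary_group B" and c: "c \<in> unitary_group C" and u: "u = b * c * w"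
    by (auto simp: same_class_def)
  have bB: "b \<in> B" and cC: "c \<in> C" using b c by (auto simp: mem_unitary_group)
  have e: "E (u * (k * v)\<^sup>\<star>) * (k * v) = (if v = w then \<phi> (c * k\<^sup>\<star>) *\<^sub>C (b * k * w) else 0)"
    if "k \<in> K" "v \<in> reps" for k v
  proof -
    have "E (u * (k * v)\<^sup>\<star>) = b * E (c * w * (k * v)\<^sup>\<star>)"
      unfolding u E_left[OF bB, symmetric] by (simp add: mult.assoc)
    then show ?thesis
      using E_left_products[OF cC K_C[OF that(1)] w(1) that(2)]
      by (auto simp: mult_scaleC_left mult_scaleC_right mult.assoc)
  qed
  have "(\<Sum>v\<in>V. E (u * v\<^sup>\<star>) * v) = (\<Sum>k\<in>K. \<Sum>v\<in>reps. if v = w then \<phi> (c * k\<^sup>\<star>) *\<^sub>C (b * k * w) else 0)"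
    unfolding sum_V by (intro sum.cong refl e)
  also have "\<dots> = (\<Sum>k\<in>K. \<phi> (c * k\<^sup>\<star>) *\<^sub>C (b * k * w))"
    using finite_reps w(1) by simp
  also have "\<dots> = b * (\<Sum>k\<in>K. \<phi> (c * k\<^sup>\<star>) *\<^sub>C k) * w"
    by (simp add: sum_distrib_left sum_distrib_right mult_scaleC_left mult_scaleC_right)
  also have "\<dots> = u" using expand[OF cC] u by simp
  finally show "(\<Sum>v\<in>V. E (u * v\<^sup>\<star>) * v) = u" .
qed

lemma inj_star: "inj_on star (A :: 'a set)"
  by (metis inj_onI star_star)

text \<open>The index is defined by right quasi-bases, whereas \<open>V\<close> is so far a left
  one; passing to adjoints switches sides for every \<phi>.\<close>

lemma right_quasi_basis_star_V: "right_quasi_basis E (star ` V)"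
  unfolding right_quasi_basis_def
  using left_expansion finite_V by (simp add: sum.reindex[OF inj_star])

lemma finite_index_E: "finite_index E"
  using right_quasi_basis_star_V by (auto simp: finite_index_def)

lemma left_orthonormal_quasi_basis_V: "left_orthonormal_quasi_basis E V"
  unfolding left_orthonormal_quasi_basis_def left_quasi_basis_def
  using left_expansion finite_V left_orthonormal by blast

lemma watatani_index_sum:
  "watatani_index E = (\<Sum>w\<in>reps. w\<^sup>\<star> * (\<Sum>k\<in>K. k\<^sup>\<star> * k) * w)"
proof -
  have "watatani_index E = (\<Sum>v\<in>V. v\<^sup>\<star> * v)"
    using watatani_index_eq[OF right_quasi_basis_star_V] by (simp add: sum.reindex[OF inj_star])
  also have "\<dots> = (\<Sum>w\<in>reps. \<Sum>k\<in>K. (k * w)\<^sup>\<star> * (k * w))"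
    unfolding sum_V by (rule sum.swap)
  also have "\<dots> = (\<Sum>w\<in>reps. w\<^sup>\<star> * (\<Sum>k\<in>K. k\<^sup>\<star> * k) * w)"
    by (simp add: sum_distrib_left sum_distrib_right star_mult mult.assoc)
  finally show ?thesis .
qed

lemma watatani_index_scalar: "\<exists>r\<ge>0. watatani_index E = complex_of_real r *\<^sub>C 1"
proof -
  have eq: "watatani_index E = (\<Sum>l\<in>star ` V. l * l\<^sup>\<star>)"
    by (rule watatani_index_eq[OF right_quasi_basis_star_V])
  have "\<exists>c. watatani_index E = c *\<^sub>C 1"
    unfolding eq using watatani_index_central[OF right_quasi_basis_star_V]
    by (intro central_imp_scalar[OF unital_cstar_subalgebra_UNIV simple_A]) auto
  then obtain c where c: "watatani_index E = c *\<^sub>C 1" ..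
  have "cstar_positive (watatani_index E)" unfolding eq by (rule cstar_positive_sum) simp
  then have "c \<in> \<real>\<^sub>\<ge>\<^sub>0" unfolding c cstar_positive_scaleC_one_iff .
  then show ?thesis using c by (auto simp: nonneg_Reals_def)
qed

text \<open>Since the index is a scalar, it can be evaluated by a trace on \<open>C\<close>, which absorbs the conjugations
  by normalizers.\<close>

lemma watatani_index_trace:
  assumes lin: "linear_on C t" and t1: "t 1 = 1"
    and inv: "\<And>w x. w \<in> N \<Longrightarrow> x \<in> C \<Longrightarrow> t (w\<^sup>\<star> * x * w) = t x"
    and comm: "\<And>x y. x \<in> C \<Longrightarrow> y \<in> C \<Longrightarrow> t (x * y) = t (y * x)"
    and r: "watatani_index E = c *\<^sub>C 1"
  shows "c = of_nat (card reps) * (\<Sum>k\<in>K. t (k * k\<^sup>\<star>))"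
proof -
  have Z: "(\<Sum>k\<in>K. k\<^sup>\<star> * k) \<in> C" by (intro in_C K_C)
  have "c = t (c *\<^sub>C 1)" using linear_on_scaleC[OF lin in_C(2), of c] t1 by simp
  also have "\<dots> = t (\<Sum>w\<in>reps. w\<^sup>\<star> * (\<Sum>k\<in>K. k\<^sup>\<star> * k) * w)"
    using watatani_index_sum r by simp
  also have "\<dots> = (\<Sum>w\<in>reps. t (w\<^sup>\<star> * (\<Sum>k\<in>K. k\<^sup>\<star> * k) * w))"
    by (intro linear_on_sum[OF sub lin] N_conj_C reps_N Z)
  also have "\<dots> = (\<Sum>w\<in>reps. t (\<Sum>k\<in>K. k\<^sup>\<star> * k))"
    by (intro sum.cong refl inv reps_N Z)
  also have "t (\<Sum>k\<in>K. k\<^sup>\<star> * k) = (\<Sum>k\<in>K. t (k\<^sup>\<star> * k))"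
    by (intro linear_on_sum[OF sub lin] in_C K_C)
  also have "\<dots> = (\<Sum>k\<in>K. t (k * k\<^sup>\<star>))"
    by (intro sum.cong refl comm in_C K_C)
  finally show ?thesis by simp
qed

text \<open>A product \<open>v\<^sup>\<star> * (k\<^sup>\<star> * m) * v\<close> has the normalizer
  outside instead of in the middle: invariance removes it, and the trace property turns
  \<open>k\<^sup>\<star> * m\<close> into \<open>m * k\<^sup>\<star>\<close>, for which
  \<open>K\<close> is orthonormal.\<close>

lemma two_sided:
  assumes inv: "\<And>w x. w \<in> N \<Longrightarrow> x \<in> C \<Longrightarrow> \<phi> (w\<^sup>\<star> * x * w) = \<phi> x"
    and comm: "\<And>x y. x \<in> C \<Longrightarrow> y \<in> C \<Longrightarrow> \<phi> (x * y) = \<phi> (y * x)"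
  shows "two_sided_orthonormal_quasi_basis E V"
proof -
  have products: "E ((k * v)\<^sup>\<star> * (m * w)) = (if v = w then \<phi> (m * k\<^sup>\<star>) else 0) *\<^sub>C 1"
    if k: "k \<in> C" "m \<in> C" and v: "v \<in> reps" "w \<in> reps" for k m v w
  proof (cases "v = w")
    case True
    have km: "k\<^sup>\<star> * m \<in> C" by (intro in_C k)
    have "E ((k * v)\<^sup>\<star> * (m * w)) = E (v\<^sup>\<star> * (k\<^sup>\<star> * m) * v)"
      by (simp add: True star_mult mult.assoc)
    also have "\<dots> = \<phi> (m * k\<^sup>\<star>) *\<^sub>C 1"
      using inv[OF reps_N[OF v(1)] km] comm[of m "k\<^sup>\<star>"] k by (simp add: E_C N_conj_C reps_N v km in_C)
    finally show ?thesis using True by simp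
  next
    case False
    have vN: "v \<in> N" "w \<in> N" using v reps_N by auto
    have "(k * v)\<^sup>\<star> * (m * w) = v\<^sup>\<star> * (k\<^sup>\<star> * m) * (w\<^sup>\<star>)\<^sup>\<star>" by (simp add: star_mult mult.assoc)
    moreover have "\<not> same_class (v\<^sup>\<star>) (w\<^sup>\<star>)"
      using same_class_of_star[OF vN] reps_distinct[OF v] False by blast
    ultimately show ?thesis
      using E_different_classes[OF N_star[OF vN(1)] N_star[OF vN(2)], of "k\<^sup>\<star> * m"] k False by (simp add: in_C)
  qed
  have on: "E (v\<^sup>\<star> * w) = (if v = w then 1 else 0)" if vw: "v \<in> V" "w \<in> V" for v w
  proof -
    obtain k m v' w' where *: "k \<in> K" "m \<in> K" "v' \<in> reps" "w' \<in> reps" "v = k * v'" "w = m * w'"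
      using vw by (auto simp: V_def)
    then show ?thesis
      using products[OF K_C K_C, of k m v' w'] V_eq_iff[of k m v' w'] K_on[of m k] by auto
  qed
  have "(\<Sum>v\<in>V. E (x * v) * v\<^sup>\<star>) = x" for x
  proof (rule expansion_closed[of "\<lambda>v. v" star])
    fix u assume uN: "u \<in> N"
    \<comment> \<open>The class of \<open>u\<^sup>\<star>\<close> is used so that the unitary of
      \<open>B\<close> ends up on the right of \<open>u\<close>. It commutes with \<open>k\<close>,
      is conjugated past \<open>v\<close>, and then leaves \<open>E\<close> on the right.\<close>
    then obtain w where w: "w \<in> reps" "same_class (u\<^sup>\<star>) w" using reps_cover[OF N_star] by blast
    then obtain b c where b: "b \<in> unitary_group B" and c: "c \<in> unitary_group C" and us: "u\<^sup>\<star> = b * c * w"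
      by (auto simp: same_class_def)
    have bB: "b \<in> B" "b\<^sup>\<star> \<in> B" and cC: "c \<in> C" using b c in_B by (auto simp: mem_unitary_group)
    have u: "u = (c * w)\<^sup>\<star> * b\<^sup>\<star>" using arg_cong[OF us, of star] by (simp add: star_mult mult.assoc)
    have e: "E (u * (k * v)) * (k * v)\<^sup>\<star> = (if v = w then \<phi> (k * c\<^sup>\<star>) *\<^sub>C (w\<^sup>\<star> * b\<^sup>\<star> * k\<^sup>\<star>) else 0)"
      if k: "k \<in> K" and v: "v \<in> reps" for k v
    proof -
      have vN: "v \<in> N" by (rule reps_N[OF v])
      have "u * (k * v) = (c * w)\<^sup>\<star> * (b\<^sup>\<star> * k) * v" by (simp add: u mult.assoc)
      also have "b\<^sup>\<star> * k = k * b\<^sup>\<star>" using C_comm[OF K_C[OF k] bB(2)] by simp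
      also have "(c * w)\<^sup>\<star> * (k * b\<^sup>\<star>) * v = ((c * w)\<^sup>\<star> * (k * v)) * (v\<^sup>\<star> * b\<^sup>\<star> * v)"
        by (simp add: mult.assoc N_cancel[OF vN])
      finally have "E (u * (k * v)) = E ((c * w)\<^sup>\<star> * (k * v)) * (v\<^sup>\<star> * b\<^sup>\<star> * v)"
        by (simp only: E_right[OF N_conj(2)[OF vN bB(2)]])
      then have "E (u * (k * v)) * (k * v)\<^sup>\<star> = E ((c * w)\<^sup>\<star> * (k * v)) * (v\<^sup>\<star> * b\<^sup>\<star> * k\<^sup>\<star>)"
        by (simp add: star_mult mult.assoc N_cancel[OF vN])
      then show ?thesis
        using products[OF cC K_C[OF k] w(1) v] by (auto simp: mult_scaleC_left)
    qed
    have "(\<Sum>v\<in>V. E (u * v) * v\<^sup>\<star>) = (\<Sum>k\<in>K. \<Sum>v\<in>reps. if v = w then \<phi> (k * c\<^sup>\<star>) *\<^sub>C (w\<^sup>\<star> * b\<^sup>\<star> * k\<^sup>\<star>) else 0)"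
      unfolding sum_V by (intro sum.cong refl e)
    also have "\<dots> = (\<Sum>k\<in>K. \<phi> (k * c\<^sup>\<star>) *\<^sub>C (w\<^sup>\<star> * b\<^sup>\<star> * k\<^sup>\<star>))"
      using finite_reps w(1) by simp
    also have "\<dots> = w\<^sup>\<star> * b\<^sup>\<star> * (\<Sum>k\<in>K. \<phi> (k * c\<^sup>\<star>) *\<^sub>C k\<^sup>\<star>)"
      by (simp add: sum_distrib_left mult_scaleC_right)
    also have "(\<Sum>k\<in>K. \<phi> (k * c\<^sup>\<star>) *\<^sub>C k\<^sup>\<star>) = c\<^sup>\<star>"
      using adjoint_frame in_C(4)[OF cC] unfolding frame_def[OF sub] by metis
    also have "w\<^sup>\<star> * b\<^sup>\<star> * c\<^sup>\<star> = u"
    proof -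
      have "c\<^sup>\<star> * b\<^sup>\<star> = b\<^sup>\<star> * c\<^sup>\<star>" using C_comm[OF in_C(4)[OF cC] bB(2)] .
      then show ?thesis by (simp add: u star_mult mult.assoc)
    qed
    finally show "(\<Sum>v\<in>V. E (u * v) * v\<^sup>\<star>) = u" .
  qed
  then have "right_orthonormal_quasi_basis E V"
    unfolding right_orthonormal_quasi_basis_def right_quasi_basis_def
    using finite_V on by simp
  then show ?thesis
    using left_orthonormal_quasi_basis_V by (simp add: two_sided_orthonormal_quasi_basis_def)
qed

section \<open>The expectation extending the trace\<close>

text \<open>Elements of \<open>K\<close> commute with \<open>B\<close>, so this average keeps the
  bimodule property; on \<open>C\<close> it is the formula \<open>tau_conj_sum\<close>.\<close>

definition E\<tau> :: "'a \<Rightarrow> 'a" where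
  "E\<tau> x = (1 / card K) *\<^sub>R (\<Sum>k\<in>K. E (k * x * k\<^sup>\<star>))"

lemma E_tau_C: "x \<in> C \<Longrightarrow> E\<tau> x = \<tau> x *\<^sub>C 1"
proof -
  assume x: "x \<in> C"
  have "(\<Sum>k\<in>K. E (k * x * k\<^sup>\<star>)) = (\<Sum>k\<in>K. \<phi> (k * x * k\<^sup>\<star>)) *\<^sub>C 1"
    unfolding complex_vector.scale_sum_left by (intro sum.cong refl E_C in_C x K_C)
  also have "\<dots> = (of_nat (card K) * \<tau> x) *\<^sub>C 1" using tau_conj_sum[OF x] by simp
  finally show ?thesis using card_pos by (simp add: E\<tau>_def scaleR_scaleC scaleC_scaleC)
qed

lemma E_tau_bimodule:
  assumes b: "b \<in> B" "c \<in> B"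
  shows "E\<tau> (b * x * c) = b * E\<tau> x * c"
proof -
  have "E (k * (b * x * c) * k\<^sup>\<star>) = b * E (k * x * k\<^sup>\<star>) * c" if k: "k \<in> K" for k
  proof -
    have "k * (b * x * c) * k\<^sup>\<star> = (k * b) * x * (c * k\<^sup>\<star>)" by (simp add: mult.assoc)
    also have "k * b = b * k" by (rule C_comm[OF K_C[OF k] b(1)])
    also have "c * k\<^sup>\<star> = k\<^sup>\<star> * c" using C_comm[OF in_C(4)[OF K_C[OF k]] b(2)] by simp
    finally have "k * (b * x * c) * k\<^sup>\<star> = b * (k * x * k\<^sup>\<star>) * c" by (simp add: mult.assoc)
    then show ?thesis by (simp only: E_bimodule[OF b])
  qed
  then show ?thesis by (simp add: E\<tau>_def sum_distrib_left sum_distrib_right)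
qed

lemma E_tau_conditional_expectation: "conditional_expectation B E\<tau>"
proof -
  have fix1: "E\<tau> b = b" if b: "b \<in> B" for b
    using E_tau_bimodule[OF b in_B(2), of 1] E_tau_C[of 1] tau_one by (simp add: in_C)
  have inB: "E\<tau> x \<in> B" for x
    unfolding E\<tau>_def by (intro in_B E_in)
  have "Vector_Spaces.linear (*\<^sub>C) (*\<^sub>C) E\<tau>"
    unfolding Vector_Spaces.linear_iff
    using complex_vector.vector_space_axioms
    by (auto simp: E\<tau>_def distrib_left distrib_right E_add sum.distrib scaleR_add_right
      mult_scaleC_left mult_scaleC_right E_scaleC complex_vector.scale_sum_right
      scaleR_scaleC scaleC_scaleC mult.commute scaleC_add_right)
  moreover have "range E\<tau> = B" using fix1 inB by (auto intro: rev_image_eqI[symmetric] simp: image_iff) metis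
  moreover have "cstar_positive (E\<tau> x)" if x: "cstar_positive x" for x
    unfolding E\<tau>_def
  proof (intro cstar_positive_scaleR cstar_positive_sum E_positive)
    show "cstar_positive (k * x * k\<^sup>\<star>)" for k using cstar_positive_conj[OF x, of "k\<^sup>\<star>"] by simp
  qed simp
  ultimately show ?thesis
    unfolding conditional_expectation_def using fix1 E_tau_bimodule by auto
qed

end

section \<open>Minimal projections and Markov traces\<close>

lemma projection_adjoint_mult:
  "q\<^sup>\<star> = q \<Longrightarrow> p\<^sup>\<star> = p \<Longrightarrow> q * p = r \<Longrightarrow> r\<^sup>\<star> = r \<Longrightarrow> p * q = (r::'a::cstar_algebra)"
  by (metis star_mult)

lemma projection_in_mult:
  assumes "unital_cstar_subalgebra P" "projection_in P p" "projection_in P q" "p * q = q * p"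
  shows "projection_in P (p * q)"
proof -
  have "p * q * (p * q) = (p * p) * (q * q)" using assms(4) by (metis mult.assoc)
  then show ?thesis
    using assms(2-4) subalgebra_mult[OF assms(1)] by (auto simp: projection_in_def star_mult)
qed

text \<open>For positive \<open>m\<close> the $C^*$-identity applied to \<open>a ^ m * y\<close>
  produces the power \<open>2 * m\<close>, which is at least \<open>Suc m\<close> and so contains
  the vanishing factor.\<close>

lemma selfadjoint_power_cancel:
  fixes a y :: "'a::cstar_algebra"
  assumes a: "a\<^sup>\<star> = a"
  shows "a ^ m * y = 0 \<Longrightarrow> a * y = 0"
proof (induction m)
  case (Suc m)
  show ?case
  proof (cases "m = 0")
    case False
    then obtain l where l: "m = Suc l" by (cases m) auto
    have "(a ^ m * y)\<^sup>\<star> * (a ^ m * y) = y\<^sup>\<star> * (a ^ m * a ^ m) * y"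
      by (simp add: star_mult star_power a mult.assoc)
    also have "a ^ m * a ^ m = a ^ l * a ^ Suc m"
      by (simp only: l add_Suc add_Suc_right flip: power_add)
    also have "y\<^sup>\<star> * (a ^ l * a ^ Suc m) * y = y\<^sup>\<star> * a ^ l * (a ^ Suc m * y)" by (simp add: mult.assoc)
    also have "\<dots> = 0" using Suc.prems by simp
    finally have "a ^ m * y = 0" by (simp add: star_mult_self_eq_0_iff)
    then show ?thesis by (rule Suc.IH)
  qed (use Suc.prems in simp)
qed simp

lemma orthogonal_projections_independent:
  fixes S :: "'a::cstar_algebra set"
  assumes S: "finite S" "\<And>p. p \<in> S \<Longrightarrow> p * p = p \<and> p \<noteq> 0" "\<And>p q. p \<in> S \<Longrightarrow> q \<in> S \<Longrightarrow> p \<noteq> q \<Longrightarrow> p * q = 0"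
  shows "complex_vector.independent S"
proof -
  have "u r = 0" if z: "(\<Sum>p\<in>S. u p *\<^sub>C p) = 0" and r: "r \<in> S" for u r
  proof -
    have "0 = (\<Sum>p\<in>S. u p *\<^sub>C p) * r" using z by simp
    also have "\<dots> = (\<Sum>p\<in>S. if p = r then u r *\<^sub>C r else 0)"
      unfolding sum_distrib_right
      by (intro sum.cong refl) (use S r in \<open>auto simp: mult_scaleC_left\<close>)
    also have "\<dots> = u r *\<^sub>C r" using S r by simp
    finally show ?thesis using S(2)[OF r] by (simp add: complex_vector.scale_eq_0_iff)
  qed
  then show ?thesis unfolding complex_vector.dependent_finite[OF S(1)] by blast
qed

lemma minimal_projectionD:
  assumes "minimal_projection P p"
  shows "p \<in> P" "p\<^sup>\<star> = p" "p * p = p" "p \<noteq> 0" "projection_in P p"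
    "\<And>q. projection_in P q \<Longrightarrow> q * p = q \<Longrightarrow> q = 0 \<or> q = p"
  using assms by (auto simp: minimal_projection_def projection_in_def)

definition orthogonal_family :: "'a::cstar_algebra set \<Rightarrow> 'a \<Rightarrow> 'a set \<Rightarrow> bool" where
  "orthogonal_family P e S \<longleftrightarrow> finite S \<and> (\<forall>p\<in>S. projection_in P p \<and> p \<noteq> 0) \<and>
     (\<forall>p\<in>S. \<forall>q\<in>S. p \<noteq> q \<longrightarrow> p * q = 0) \<and> \<Sum>S = e"

text \<open>The condition in \<open>projection_rank\<close> with the cardinality split off.\<close>

definition minimal_partition :: "'a::cstar_algebra set \<Rightarrow> 'a \<Rightarrow> 'a set \<Rightarrow> bool" where
  "minimal_partition P e S \<longleftrightarrow> finite S \<and> (\<forall>p\<in>S. minimal_projection P p) \<and>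
     (\<forall>p\<in>S. \<forall>q\<in>S. p \<noteq> q \<longrightarrow> p * q = 0) \<and> \<Sum>S = e"

lemma minimal_partition_mult:
  assumes "minimal_partition P e S" "p \<in> S"
  shows "p * e = p" "e * p = p"
proof -
  have S: "finite S" "\<And>p q. p \<in> S \<Longrightarrow> q \<in> S \<Longrightarrow> p * q = (if p = q then p else 0)" "\<Sum>S = e"
    using assms unfolding minimal_partition_def by (auto dest: minimal_projectionD)
  have "p * e = (\<Sum>q\<in>S. if p = q then p else 0)"
    unfolding S(3)[symmetric] sum_distrib_left by (intro sum.cong refl S assms)
  then show "p * e = p" using S assms by simp
  have "e * p = (\<Sum>q\<in>S. if q = p then q else 0)"
    unfolding S(3)[symmetric] sum_distrib_right by (intro sum.cong refl S assms)
  then show "e * p = p" using S assms by simp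
qed

lemma scalars_subalgebra: "unital_cstar_subalgebra (scalars :: 'a::cstar_algebra set)"
  unfolding unital_cstar_subalgebra_def
proof (intro conjI ballI complex_vector.subspaceI)
  show "1 \<in> (scalars :: 'a set)" by (auto simp: scalars_def intro: image_eqI[of _ _ 1])
  show "0 \<in> (scalars :: 'a set)" by (auto simp: scalars_def intro: image_eqI[of _ _ 0])
  show "closed (scalars :: 'a set)"
    unfolding closed_sequential_limits
  proof (intro allI impI, elim conjE)
    fix x :: "nat \<Rightarrow> 'a" and l assume x: "\<forall>n. x n \<in> scalars" and l: "x \<longlonglongrightarrow> l"
    then have "\<forall>n. \<exists>c. x n = c *\<^sub>C 1" by (auto simp: scalars_def)
    then obtain c where c: "\<And>n. x n = c n *\<^sub>C 1" by metis
    have "norm (c m - c n) = norm (x m - x n)" for m n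
      unfolding c by (simp add: norm_scaleC flip: complex_vector.scale_left_diff_distrib)
    then have "Cauchy c"
      using LIMSEQ_imp_Cauchy[OF l] unfolding Cauchy_def dist_norm by simp
    then obtain d where d: "c \<longlonglongrightarrow> d" using Cauchy_convergent_iff convergent_def by blast
    have "(\<lambda>n. norm (x n - d *\<^sub>C 1)) \<longlonglongrightarrow> 0"
      unfolding c using tendsto_norm[OF LIM_zero[OF d]]
      by (simp add: norm_scaleC flip: complex_vector.scale_left_diff_distrib)
    then have "x \<longlonglongrightarrow> d *\<^sub>C 1" using LIM_zero_cancel tendsto_norm_zero_iff by blast
    then show "l \<in> scalars" using LIMSEQ_unique[OF l] by (auto simp: scalars_def)
  qed
qed (auto simp: scalars_def star_scaleC mult_scaleC_left mult_scaleC_right scaleC_scaleC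
      simp flip: complex_vector.scale_left_distrib)

section \<open>Minimal projections of a finite-dimensional algebra\<close>

context orthonormal_basis
begin

text \<open>Indices up to \<open>card K\<close> inclusive give one vector more than the dimension. A
  repeated value is treated separately, with coefficients 1 and -1, since dependence of a set does
  not see repetitions.\<close>

lemma linear_relation:
  assumes f: "\<And>k. f k \<in> C"
  obtains c :: "nat \<Rightarrow> complex" and m where "m \<le> card K" "c m \<noteq> 0" "(\<Sum>k\<le>card K. c k *\<^sub>C f k) = 0"
proof (cases "inj_on f {..card K}")
  case True
  have "complex_vector.dependent (f ` {..card K})"
  proof (rule ccontr)
    assume "\<not> ?thesis"
    then have "card (f ` {..card K}) \<le> card K"
      using complex_vector.independent_span_bound[OF K_fin] f C_eq_span by blast
    then show False by (simp add: card_image True)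
  qed
  then obtain u where u: "\<exists>v\<in>f ` {..card K}. u v \<noteq> 0" "(\<Sum>v\<in>f ` {..card K}. u v *\<^sub>C v) = 0"
    by (subst (asm) complex_vector.dependent_finite) auto
  then obtain m where "m \<le> card K" "u (f m) \<noteq> 0" by auto
  moreover have "(\<Sum>k\<le>card K. u (f k) *\<^sub>C f k) = 0"
    using u(2) by (simp add: sum.reindex[OF True])
  ultimately show thesis using that[of m "u \<circ> f"] by simp
next
  case False
  then obtain i j where ij: "i \<le> card K" "j \<le> card K" "i \<noteq> j" "f i = f j" by (auto simp: inj_on_def)
  have "(\<Sum>k\<le>card K. (if k = i then 1 else if k = j then -1 else 0) *\<^sub>C f k)
      = (\<Sum>k\<le>card K. (if k = i then f i else 0) - (if k = j then f j else 0))"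
    using ij by (intro sum.cong) auto
  also have "\<dots> = 0" using ij by (simp add: sum_subtractf)
  finally show thesis using that[of i "\<lambda>k. if k = i then 1 else if k = j then -1 else 0"] ij by simp
qed

lemma power_in_C: "a \<in> C \<Longrightarrow> a ^ k \<in> C"
  by (induction k) (auto intro: in_C)

text \<open>A polynomial relation for \<open>a\<close> with lowest nonzero coefficient
  \<open>c m\<close> reads \<open>a ^ m * (c m *\<^sub>C 1 + a * g) = 0\<close>. Cancelling down to
  one factor \<open>a\<close> shows that \<open>h = - g / c m\<close> satisfies
  \<open>a * (a * h) = a\<close>, and \<open>a * h\<close> is the support of
  \<open>a\<close>.\<close>

lemma support_projection:
  assumes a: "a \<in> C" "a\<^sup>\<star> = a"
  obtains s h where "projection_in C s" "s * a = a" "h \<in> C" "s = a * h" "s = h * a"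
proof -
  obtain c m0 where c0: "m0 \<le> card K" "c m0 \<noteq> 0" "(\<Sum>k\<le>card K. c k *\<^sub>C a ^ k) = 0"
    using linear_relation[of "\<lambda>k. a ^ k"] power_in_C[OF a(1)] by metis
  define m where "m = (LEAST k. c k \<noteq> 0)"
  have m: "c m \<noteq> 0" "\<And>k. k < m \<Longrightarrow> c k = 0" "m \<le> card K"
  proof -
    show "c m \<noteq> 0" unfolding m_def by (rule LeastI[of _ m0]) (rule c0(2))
    show "c k = 0" if "k < m" for k using not_less_Least[of k "\<lambda>k. c k \<noteq> 0"] that unfolding m_def by blast
    have "m \<le> m0" unfolding m_def by (rule Least_le) (rule c0(2))
    then show "m \<le> card K" using c0(1) by simp
  qed
  define g where "g = (\<Sum>k\<in>{Suc m..card K}. c k *\<^sub>C a ^ (k - Suc m))"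
  have gC: "g \<in> C" unfolding g_def by (intro in_C power_in_C a)
  have ga: "g * a = a * g"
    by (simp add: g_def sum_distrib_left sum_distrib_right mult_scaleC_left mult_scaleC_right power_commutes)
  have "0 = (\<Sum>k\<in>{m..card K}. c k *\<^sub>C a ^ k)"
    unfolding c0(3)[symmetric] using m by (intro sum.mono_neutral_right) (auto simp: not_le)
  also have "\<dots> = c m *\<^sub>C a ^ m + (\<Sum>k\<in>{Suc m..card K}. c k *\<^sub>C a ^ k)"
    using m(3) by (simp add: sum.atLeast_Suc_atMost)
  also have "(\<Sum>k\<in>{Suc m..card K}. c k *\<^sub>C a ^ k) = a ^ m * (a * g)"
    unfolding g_def sum_distrib_left mult_scaleC_right
    by (intro sum.cong refl arg_cong2[where f = scaleC]) (auto simp flip: power_Suc power_add)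
  finally have "a ^ m * (c m *\<^sub>C 1 + a * g) = 0" by (simp add: distrib_left mult_scaleC_right)
  then have "a * (c m *\<^sub>C 1 + a * g) = 0" by (rule selfadjoint_power_cancel[OF a(2)])
  then have rel: "c m *\<^sub>C a + a * (a * g) = 0" by (simp add: distrib_left mult_scaleC_right)
  define h where "h = (- 1 / c m) *\<^sub>C g"
  have hC: "h \<in> C" unfolding h_def by (intro in_C gC)
  have ha: "h * a = a * h" by (simp add: h_def mult_scaleC_left mult_scaleC_right ga)
  have "a * (a * h) = (- 1 / c m) *\<^sub>C (a * (a * g))" by (simp add: h_def mult_scaleC_right)
  also have "a * (a * g) = (- c m) *\<^sub>C a" using rel by (simp add: eq_neg_iff_add_eq_0 add.commute)
  finally have aah: "a * (a * h) = a" using m(1) by (simp add: scaleC_scaleC)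
  define s where "s = a * h"
  have as: "a * s = a" by (simp add: s_def aah)
  have sa: "s * a = a" by (simp add: s_def mult.assoc ha aah)
  have ss: "s * s = s" unfolding s_def using aah ha by (metis mult.assoc)
  have "s\<^sup>\<star> * a = a" using arg_cong[OF as, of star] by (simp add: star_mult a)
  then have "s\<^sup>\<star> * s = s" by (simp add: s_def mult.assoc[symmetric])
  then have "s\<^sup>\<star> = s" by (metis star_mult star_star)
  moreover have "s \<in> C" unfolding s_def by (intro in_C a hC)
  ultimately have "projection_in C s" using ss by (simp add: projection_in_def)
  then show thesis using that sa hC s_def ha by metis
qed

text \<open>Compressing a shifted selfadjoint element gives a positive \<open>y\<close> in the
  corner. Its defect \<open>a\<close> from \<open>norm y *\<^sub>R q\<close> is not invertible
  there, as the norm is a spectral value, so the support of \<open>a\<close> is not \<open>q\<close>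
  and must vanish by minimality.\<close>

lemma minimal_corner:
  assumes q: "minimal_projection C q" and x: "x \<in> C"
  shows "\<exists>c. q * x * q = c *\<^sub>C q"
proof -
  note qD = minimal_projectionD[OF q]
  have sa: "\<exists>c. q * x * q = c *\<^sub>C q" if x: "x \<in> C" "x\<^sup>\<star> = x" for x
  proof -
    define y where "y = q\<^sup>\<star> * (norm x *\<^sub>R 1 - (- x)) * q"
    have y_eq: "y = norm x *\<^sub>R q + q * x * q" by (simp add: y_def qD algebra_simps)
    have yC: "y \<in> C" unfolding y_eq by (intro in_C x qD)
    have yp: "cstar_positive y" unfolding y_def
      by (intro cstar_positive_conj cstar_positive_norm_minus) (simp_all add: x)
    have ys: "y\<^sup>\<star> = y" by (rule cstar_positive_selfadjoint[OF yp])
    have qq: "q * (q * z) = q * z" for z by (simp add: qD flip: mult.assoc)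
    have yq: "y * q = y" "q * y = y" by (simp_all add: y_eq distrib_left distrib_right mult.assoc qq qD)
    define a where "a = norm y *\<^sub>R q - y"
    have aC: "a \<in> C" unfolding a_def by (intro in_C qD yC)
    have as: "a\<^sup>\<star> = a" by (simp add: a_def star_diff qD ys)
    have aq: "a * q = a" "q * a = a" by (simp_all add: a_def yq qD algebra_simps)
    obtain s h where s: "projection_in C s" "s * a = a" "h \<in> C" "s = a * h" "s = h * a"
      using support_projection[OF aC as] .
    have "s * q = s" by (simp add: s(5) mult.assoc aq)
    then consider "s = 0" | "s = q" using qD(6)[OF s(1)] by blast
    then have "a = 0"
    proof cases
      case 1
      then show ?thesis using s(2) by simp
    next
      case 2
      show ?thesis
      proof (rule ccontr)
        assume "a \<noteq> 0"
        have y0: "y \<noteq> 0" using \<open>a \<noteq> 0\<close> by (auto simp: a_def)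
        \<comment> \<open>Now \<open>h * a = q\<close>, so \<open>h\<close> inverts \<open>a\<close>
          in the corner and \<open>q \<le> k a a\<close>: the gap \<open>1 / k\<close> excluded at
          the norm.\<close>
        define k where "k = (norm h)\<^sup>2 + 1"
        have k: "k > 0" by (simp add: k_def add_nonneg_pos)
        have "cstar_positive (k *\<^sub>R 1 - h\<^sup>\<star> * h)"
          by (intro cstar_positive_norm_minus) (simp_all add: star_mult cstar_identity k_def)
        then have "cstar_positive (a\<^sup>\<star> * (k *\<^sub>R 1 - h\<^sup>\<star> * h) * a)" by (rule cstar_positive_conj)
        moreover have "a\<^sup>\<star> * (k *\<^sub>R 1 - h\<^sup>\<star> * h) * a = k *\<^sub>R (a * a) - (h * a)\<^sup>\<star> * (h * a)"
          by (simp add: as star_mult algebra_simps)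
        moreover have "(h * a)\<^sup>\<star> * (h * a) = q" using s(5) 2 qD by metis
        ultimately have "cstar_positive ((1/k) *\<^sub>R (k *\<^sub>R (a * a) - q))"
          using k by (intro cstar_positive_scaleR) simp_all
        then have "cstar_positive (a * a - (1/k) *\<^sub>R q)" using k by (simp add: scaleR_diff_right)
        then show False
          using positive_no_gap_at_norm[OF qD(2,3) yp yq y0, of "1/k"] k by (simp add: a_def)
      qed
    qed
    then have "q * x * q = (norm y - norm x) *\<^sub>R q" using y_eq by (simp add: a_def algebra_simps)
    then show ?thesis unfolding scaleR_scaleC by blast
  qed
  obtain c where c: "q * (x + x\<^sup>\<star>) * q = c *\<^sub>C q"
    using sa[of "x + x\<^sup>\<star>"] x in_C by (auto simp: star_add add.commute)
  obtain d where d: "q * (\<i> *\<^sub>C (x - x\<^sup>\<star>)) * q = d *\<^sub>C q"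
    using sa[of "\<i> *\<^sub>C (x - x\<^sup>\<star>)"] x in_C
    by (auto simp: star_scaleC star_diff complex_vector.scale_right_diff_distrib)
  have "2 *\<^sub>R x = (x + x\<^sup>\<star>) + (- \<i>) *\<^sub>C (\<i> *\<^sub>C (x - x\<^sup>\<star>))" by (simp add: scaleC_scaleC scaleR_2)
  then have "q * (2 *\<^sub>R x) * q = q * (x + x\<^sup>\<star>) * q + (- \<i>) *\<^sub>C (q * (\<i> *\<^sub>C (x - x\<^sup>\<star>)) * q)"
    by (simp only: distrib_left distrib_right mult_scaleC_left mult_scaleC_right)
  then have "(1/2) *\<^sub>R (q * (2 *\<^sub>R x) * q) = (1/2) *\<^sub>R ((c + - \<i> * d) *\<^sub>C q)"
    unfolding c d by (simp add: scaleC_scaleC complex_vector.scale_left_diff_distrib)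
  then have "q * x * q = (complex_of_real (1/2) * (c + - \<i> * d)) *\<^sub>C q"
    by (simp add: scaleR_scaleC scaleC_scaleC mult_scaleC_left mult_scaleC_right)
  then show ?thesis by (rule exI)
qed

text \<open>In a family of greatest size every member is minimal, since otherwise it could be split
  into \<open>q\<close> and \<open>p - q\<close>. A general \<open>P\<close> is allowed because both
  \<open>C\<close> and its centre are partitioned this way.\<close>

lemma minimal_partition_exists:
  assumes P: "unital_cstar_subalgebra P" "P \<subseteq> C" and e: "projection_in P e"
  obtains S where "minimal_partition P e S"
proof -
  have bound: "card S \<le> card K" if "orthogonal_family P e S" for S
  proof -
    have "complex_vector.independent S"
      using that unfolding orthogonal_family_def projection_in_def
      by (intro orthogonal_projections_independent) auto
    moreover have "S \<subseteq> complex_vector.span K"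
      using that P(2) C_eq_span unfolding orthogonal_family_def projection_in_def by auto
    ultimately show ?thesis using complex_vector.independent_span_bound[OF K_fin] by blast
  qed
  \<comment> \<open>Members must be nonzero, so the starting family for \<open>e = 0\<close> is
    empty.\<close>
  have "orthogonal_family P e (if e = 0 then {} else {e})"
    using e by (simp add: orthogonal_family_def)
  then have "\<exists>S. orthogonal_family P e S \<and> (\<forall>T. orthogonal_family P e T \<longrightarrow> card T \<le> card S)"
    using bound by (intro ex_has_greatest_nat[where b = "Suc (card K)"]) (auto simp: less_Suc_eq_le)
  then obtain S where S: "orthogonal_family P e S" and max: "\<And>T. orthogonal_family P e T \<Longrightarrow> card T \<le> card S"
    by blast
  have SD: "finite S" "\<And>p. p \<in> S \<Longrightarrow> p \<in> P \<and> p\<^sup>\<star> = p \<and> p * p = p \<and> p \<noteq> 0"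
      "\<And>p q. p \<in> S \<Longrightarrow> q \<in> S \<Longrightarrow> p \<noteq> q \<Longrightarrow> p * q = 0" "\<Sum>S = e"
    using S unfolding orthogonal_family_def projection_in_def by auto
  have "minimal_projection P p" if p: "p \<in> S" for p
  proof (rule ccontr)
    assume "\<not> minimal_projection P p"
    then obtain q where q: "projection_in P q" "q * p = q" "q \<noteq> 0" "q \<noteq> p"
      using SD(2)[OF p] unfolding minimal_projection_def projection_in_def by blast
    have qD: "q \<in> P" "q\<^sup>\<star> = q" "q * q = q" using q by (auto simp: projection_in_def)
    have pD: "p \<in> P" "p\<^sup>\<star> = p" "p * p = p" "p \<noteq> 0" using SD(2)[OF p] by auto
    have pq: "p * q = q" using projection_adjoint_mult[OF qD(2) pD(2) q(2) qD(2)] .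
    define T where "T = insert q (insert (p - q) (S - {p}))"
    have orth: "r * q = 0" "q * r = 0" "r * (p - q) = 0" "(p - q) * r = 0" if r: "r \<in> S - {p}" for r
    proof -
      have rp: "r * p = 0" "p * r = 0" using SD(3) r p by auto
      have "r * q = r * p * q" using pq by (simp add: mult.assoc)
      then show rq: "r * q = 0" using rp by simp
      have "q * r = q * (p * r)" using q(2) by (metis mult.assoc)
      then show qr: "q * r = 0" using rp by simp
      show "r * (p - q) = 0" "(p - q) * r = 0" using rp rq qr by (simp_all add: algebra_simps)
    qed
    have pq0: "q * (p - q) = 0" "(p - q) * q = 0" using q(2) qD pq by (simp_all add: algebra_simps)
    have pmq: "projection_in P (p - q)" "p - q \<noteq> 0"
      using subalgebra_diff[OF P(1) pD(1) qD(1)] pD qD q pq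
      by (auto simp: projection_in_def star_diff algebra_simps)
    have nq: "q \<notin> S - {p}" using orth(1)[of q] qD(3) q(3) by auto
    have npq: "p - q \<notin> S - {p}" using orth(3)[of "p - q"] pmq by (auto simp: projection_in_def)
    have ne: "q \<noteq> p - q" using pq0(1) qD(3) q(3) by metis
    have "\<Sum>T = q + (p - q + \<Sum>(S - {p}))"
      unfolding T_def using SD(1) nq npq ne by simp
    also have "\<dots> = \<Sum>S" using SD(1) p by (simp add: sum.remove)
    finally have "\<Sum>T = e" using SD(4) by simp
    moreover have "finite T" using SD(1) by (simp add: T_def)
    moreover have "\<forall>r\<in>T. projection_in P r \<and> r \<noteq> 0"
      unfolding T_def using q pmq SD(2) by (auto simp: projection_in_def)
    moreover have "\<forall>r\<in>T. \<forall>t\<in>T. r \<noteq> t \<longrightarrow> r * t = 0"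
      unfolding T_def using orth pq0 SD(3) by blast
    ultimately have "orthogonal_family P e T" by (simp add: orthogonal_family_def)
    then have "card T \<le> card S" by (rule max)
    moreover have "card T = Suc (card S)"
      unfolding T_def using SD(1) nq npq ne card_Suc_Diff1[OF SD(1) p] by simp
    ultimately show False by simp
  qed
  then have "minimal_partition P e S" using SD unfolding minimal_partition_def by blast
  then show thesis by (rule that)
qed

text \<open>For minimal projections this is Murray-von Neumann equivalence: a nonzero element of
  \<open>p C q\<close> is a multiple of a partial isometry between them.\<close>

definition linked :: "'a \<Rightarrow> 'a \<Rightarrow> bool" where
  "linked p q \<longleftrightarrow> (\<exists>y\<in>C. p * y * q \<noteq> 0)"

lemma partial_isometry:
  assumes p: "minimal_projection C p" and q: "minimal_projection C q" and y: "y \<in> C" "x = p * y * q" "x \<noteq> 0"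
  shows "\<exists>c. c \<noteq> 0 \<and> x * x\<^sup>\<star> = c *\<^sub>C p \<and> x\<^sup>\<star> * x = c *\<^sub>C q"
proof -
  note pD = minimal_projectionD[OF p] and qD = minimal_projectionD[OF q]
  have "x * x\<^sup>\<star> = p * (y * q * y\<^sup>\<star>) * p" "x\<^sup>\<star> * x = q * (y\<^sup>\<star> * p * y) * q"
    using pD(2,3) qD(2,3) unfolding y(2) by (simp_all add: star_mult) (metis mult.assoc)+
  moreover have "y * q * y\<^sup>\<star> \<in> C" "y\<^sup>\<star> * p * y \<in> C" by (intro in_C y pD qD)+
  ultimately obtain c d where c: "x * x\<^sup>\<star> = c *\<^sub>C p" and d: "x\<^sup>\<star> * x = d *\<^sub>C q"
    using minimal_corner[OF p] minimal_corner[OF q] by metis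
  have px: "p * x = x" unfolding y(2) by (simp add: pD flip: mult.assoc)
  have xq: "x * q = x" unfolding y(2) by (simp add: qD mult.assoc)
  have "c *\<^sub>C x = x * x\<^sup>\<star> * x" unfolding c by (simp add: mult_scaleC_left px)
  also have "\<dots> = x * (x\<^sup>\<star> * x)" by (simp add: mult.assoc)
  also have "\<dots> = d *\<^sub>C x" unfolding d by (simp add: mult_scaleC_right xq)
  finally have "c = d" using y(3) by simp
  moreover have "c \<noteq> 0" using c y(3) cstar_identity'[of x] by auto
  ultimately show ?thesis using c d by blast
qed

lemma linked_sym: "minimal_projection C p \<Longrightarrow> minimal_projection C q \<Longrightarrow> linked p q \<Longrightarrow> linked q p"
  unfolding linked_def
proof (elim bexE)
  fix y assume p: "minimal_projection C p" and q: "minimal_projection C q" and y: "y \<in> C" "p * y * q \<noteq> 0"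
  have "(p * y * q)\<^sup>\<star> = q * y\<^sup>\<star> * p"
    by (simp add: star_mult minimal_projectionD[OF p] minimal_projectionD[OF q] mult.assoc)
  then show "\<exists>y\<in>C. q * y * p \<noteq> 0" using y in_C by (metis star_eq_0_iff)
qed

lemma linked_trans:
  assumes p: "minimal_projection C p" and q: "minimal_projection C q"
    and "linked p q" "linked q r"
    and r: "r \<in> C"
  shows "linked p r"
proof -
  obtain y z where y: "y \<in> C" "p * y * q \<noteq> 0" and z: "z \<in> C" "q * z * r \<noteq> 0"
    using assms unfolding linked_def by blast
  obtain c where c: "c \<noteq> 0" "(p * y * q)\<^sup>\<star> * (p * y * q) = c *\<^sub>C q"
    using partial_isometry[OF p q y(1) refl y(2)] by blast
  have qq: "q * (q * w) = q * w" for w by (simp add: minimal_projectionD(3)[OF q] flip: mult.assoc)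
  have "(p * y * q)\<^sup>\<star> * (p * (y * q * z) * r) = ((p * y * q)\<^sup>\<star> * (p * y * q)) * (q * z * r)"
    by (simp only: mult.assoc qq)
  also have "\<dots> = c *\<^sub>C (q * z * r)" unfolding c by (simp only: mult.assoc mult_scaleC_left qq)
  finally have "(p * y * q)\<^sup>\<star> * (p * (y * q * z) * r) \<noteq> 0"
    using c(1) z(2) by (simp add: complex_vector.scale_eq_0_iff)
  then have "p * (y * q * z) * r \<noteq> 0" by auto
  moreover have "y * q * z \<in> C" by (intro in_C y z minimal_projectionD[OF q])
  ultimately show ?thesis unfolding linked_def by blast
qed

lemma linked_trace_eq:
  assumes p: "minimal_projection C p" and q: "minimal_projection C q" and l: "linked p q"
    and t: "tracial_state C t"
  shows "t p = t q"
proof -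
  obtain y where y: "y \<in> C" "p * y * q \<noteq> 0" using l unfolding linked_def by blast
  obtain c where c: "c \<noteq> 0" "(p * y * q) * (p * y * q)\<^sup>\<star> = c *\<^sub>C p" "(p * y * q)\<^sup>\<star> * (p * y * q) = c *\<^sub>C q"
    using partial_isometry[OF p q y(1) refl y(2)] by blast
  have "p * y * q \<in> C" by (intro in_C y minimal_projectionD[OF p] minimal_projectionD[OF q])
  then have "t (c *\<^sub>C p) = t (c *\<^sub>C q)"
    using t in_C(4) unfolding c(2,3)[symmetric] tracial_state_def by blast
  then show ?thesis
    using t c(1) minimal_projectionD(1)[OF p] minimal_projectionD(1)[OF q] unfolding tracial_state_def by simp
qed

section \<open>The centre of \<open>C\<close> and its simple summands\<close>

abbreviation Z where "Z \<equiv> C \<inter> centralizer C"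

lemma Z_subalgebra: "unital_cstar_subalgebra Z"
proof -
  have "unital_cstar_subalgebra (centralizer C)"
    by (rule centralizer_subalgebra) (rule in_C)
  then show ?thesis using C unfolding unital_cstar_subalgebra_def
    by (auto intro: complex_vector.subspace_inter)
qed

lemma partition_of_one:
  obtains S where "minimal_partition C 1 S"
  using minimal_partition_exists[OF C order_refl, of 1] in_C by (auto simp: projection_in_def)

lemma summandD:
  assumes "z \<in> simple_summands C"
  shows "z \<in> C" "z\<^sup>\<star> = z" "z * z = z" "z \<noteq> 0" "\<And>x. x \<in> C \<Longrightarrow> z * x = x * z"
    "\<And>q. projection_in Z q \<Longrightarrow> q * z = q \<Longrightarrow> q = 0 \<or> q = z"
proof -
  have z: "minimal_projection Z z" using assms by (simp add: simple_summands_def)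
  note zD = minimal_projectionD[OF z]
  show "z \<in> C" "z\<^sup>\<star> = z" "z * z = z" "z \<noteq> 0" using zD by simp_all
  show "z * x = x * z" if "x \<in> C" for x using zD(1) that by (simp add: centralizer_def)
  show "q = 0 \<or> q = z" if "projection_in Z q" "q * z = q" for q using zD(6)[OF that] .
qed

text \<open>The sum of those members of a partition that are linked to \<open>p\<close> is central, hence dominates the
  summand of \<open>p\<close>.\<close>

lemma summand_linked:
  assumes z: "z \<in> simple_summands C" and p: "minimal_projection C p" "p * z = p"
    and q: "minimal_projection C q" "q * z = q"
  shows "linked p q"
proof -
  obtain S where S: "minimal_partition C 1 S" using partition_of_one .
  have SD: "finite S" "\<And>r. r \<in> S \<Longrightarrow> minimal_projection C r"
    "\<And>r s. r \<in> S \<Longrightarrow> s \<in> S \<Longrightarrow> r \<noteq> s \<Longrightarrow> r * s = 0" "\<Sum>S = 1"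
    using S by (auto simp: minimal_partition_def)
  note zD = summandD[OF z] and pD = minimal_projectionD[OF p(1)] and qD = minimal_projectionD[OF q(1)]
  \<comment> \<open>All blocks \<open>r x s\<close> and \<open>s x r\<close> with \<open>r\<close>
    in this set and \<open>s\<close> outside it vanish, so cutting \<open>x\<close> by the partition
    shows that the sum \<open>f\<close> commutes with \<open>C\<close>.\<close>
  define L where "L = {r \<in> S. linked p r}"
  define f where "f = \<Sum>L"
  have L: "finite L" "\<And>r. r \<in> L \<Longrightarrow> r \<in> S" using SD(1) by (auto simp: L_def)
  have rC: "r \<in> C" if "r \<in> S" for r using minimal_projectionD(1)[OF SD(2)[OF that]] .
  have fC: "f \<in> C" unfolding f_def by (intro in_C rC L)
  have fs: "f\<^sup>\<star> = f"
    unfolding f_def star_sum by (intro sum.cong refl minimal_projectionD(2)[OF SD(2)] L)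
  have off: "r * x * s = 0" if "linked p r" "\<not> linked p s" "r \<in> S" "s \<in> S" "x \<in> C" for r s x
    using linked_trans[OF p(1) SD(2)[OF that(3)] that(1) _ rC[OF that(4)]] that unfolding linked_def[of r s] by blast
  have off': "s * x * r = 0" if "linked p r" "\<not> linked p s" "r \<in> S" "s \<in> S" "x \<in> C" for r s x
    using off[OF that(1-4) in_C(4)[OF that(5)]] minimal_projectionD(2)[OF SD(2)] that(3,4)
    by (metis star_eq_0_iff star_mult star_star mult.assoc)
  have fx: "f * x = f * x * f" "x * f = f * x * f" if x: "x \<in> C" for x
  proof -
    have "f * x = f * x * \<Sum>S" using SD(4) by simp
    also have "\<dots> = (\<Sum>s\<in>S. f * x * s)" by (simp add: sum_distrib_left)
    also have "\<dots> = (\<Sum>s\<in>L. f * x * s)"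
    proof (rule sum.mono_neutral_right[OF SD(1)])
      show "L \<subseteq> S" by (auto simp: L_def)
      show "\<forall>s\<in>S - L. f * x * s = 0"
        unfolding f_def sum_distrib_right using off x by (auto simp: L_def intro!: sum.neutral)
    qed
    also have "\<dots> = f * x * f" by (simp add: f_def sum_distrib_left)
    finally show "f * x = f * x * f" .
    have "x * f = \<Sum>S * (x * f)" using SD(4) by simp
    also have "\<dots> = (\<Sum>s\<in>S. s * x * f)" by (simp add: sum_distrib_right mult.assoc)
    also have "\<dots> = (\<Sum>s\<in>L. s * x * f)"
    proof (rule sum.mono_neutral_right[OF SD(1)])
      show "L \<subseteq> S" by (auto simp: L_def)
      show "\<forall>s\<in>S - L. s * x * f = 0"
        unfolding f_def sum_distrib_left using off' x by (auto simp: L_def intro!: sum.neutral)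
    qed
    also have "\<dots> = f * x * f" by (simp add: f_def sum_distrib_right)
    finally show "x * f = f * x * f" .
  qed
  have fcomm: "f * x = x * f" if "x \<in> C" for x using fx[OF that] by simp
  have ff: "f * f = f" using fx(1)[of 1] in_C by simp
  have p_link: "linked r s" if "r * s \<noteq> 0" for r s
    unfolding linked_def using that in_C(2) by (intro bexI[of _ 1]) auto
  have pf: "p * f = p"
  proof -
    have "p = (\<Sum>s\<in>S. p * s)" using SD(4) by (simp flip: sum_distrib_left)
    also have "\<dots> = (\<Sum>s\<in>L. p * s)"
      using SD(1) p_link by (intro sum.mono_neutral_right) (auto simp: L_def)
    finally show ?thesis by (simp add: f_def sum_distrib_left)
  qed
  have "f \<in> Z" using fC fcomm unfolding centralizer_def by blast
  then have "projection_in Z f" using fs ff by (simp only: projection_in_def)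
  moreover have "projection_in Z z" using z by (simp only: simple_summands_def minimal_projection_def mem_Collect_eq)
  ultimately have "projection_in Z (f * z)"
    by (rule projection_in_mult[OF Z_subalgebra]) (rule fcomm[OF zD(1)])
  moreover have "f * z * z = f * z" by (simp add: mult.assoc zD)
  moreover have "f * z \<noteq> 0"
  proof
    assume "f * z = 0"
    then have "p * f * z = 0" by (simp add: mult.assoc)
    then show False using pf p(2) pD(4) by simp
  qed
  ultimately have "f * z = z" using zD(6) by blast
  then have "q * f * z = q" using q(2) by (simp add: mult.assoc)
  also have "q * f * z = q * z * f" using zD(5)[OF fC] by (simp add: mult.assoc)
  finally have "q * f = q" using q(2) by simp
  then have "(\<Sum>r\<in>L. q * r) \<noteq> 0" using qD(4) by (simp add: f_def sum_distrib_left)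
  then obtain r where r: "r \<in> L" "q * r \<noteq> 0" by (meson sum.neutral)
  then have "linked r q" using linked_sym[OF q(1) SD(2)] p_link L by blast
  then show ?thesis using r linked_trans[OF p(1) SD(2)[OF L(2)[OF r(1)]] _ _ qD(1)] by (auto simp: L_def)
qed

text \<open>Left multiplication by \<open>p\<close> has trace \<open>dim (p C)\<close>, and \<open>p C\<close> is the sum of the lines \<open>p C q\<close>.\<close>

lemma tau_minimal_projection:
  assumes z: "z \<in> simple_summands C" and p: "minimal_projection C p" "p * z = p"
    and S: "minimal_partition C z S"
  shows "of_nat (card K) * \<tau> p = of_nat (card S)"
proof -
  have SD: "finite S" "\<And>r. r \<in> S \<Longrightarrow> minimal_projection C r" "\<Sum>S = z"
    using S by (auto simp: minimal_partition_def)
  note zD = summandD[OF z] and pD = minimal_projectionD[OF p(1)]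
  have "\<exists>y\<in>C. p * y * q \<noteq> 0" if "q \<in> S" for q
    using summand_linked[OF z p SD(2)[OF that] minimal_partition_mult(1)[OF S that]] unfolding linked_def .
  then obtain y where y: "\<And>q. q \<in> S \<Longrightarrow> y q \<in> C" "\<And>q. q \<in> S \<Longrightarrow> p * y q * q \<noteq> 0" by metis
  define d where "d q = p * y q * q" for q
  have dC: "d q \<in> C" if "q \<in> S" for q
    unfolding d_def by (intro in_C y pD that minimal_projectionD(1)[OF SD(2)])
  \<comment> \<open>Up to a nonzero factor \<open>q\<close> is
    \<open>(d q)\<^sup>\<star> * d q\<close>. Inserting this after \<open>p * x * q\<close> leaves
    an element of the one-dimensional corner of \<open>p\<close> times \<open>d q\<close>.\<close>
  have line: "\<exists>c. p * x * q = c *\<^sub>C d q" if q: "q \<in> S" and x: "x \<in> C" for q x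
  proof -
    obtain c where c: "c \<noteq> 0" "d q * (d q)\<^sup>\<star> = c *\<^sub>C p" "(d q)\<^sup>\<star> * d q = c *\<^sub>C q"
      using partial_isometry[OF p(1) SD(2)[OF q] y(1)[OF q] d_def] y(2)[OF q] d_def by metis
    have pd: "p * d q = d q" by (simp add: d_def pD flip: mult.assoc)
    have ds: "(d q)\<^sup>\<star> * p = (d q)\<^sup>\<star>" using arg_cong[OF pd, of star] by (simp add: star_mult pD)
    obtain e where e: "p * (x * q * (d q)\<^sup>\<star>) * p = e *\<^sub>C p"
      using minimal_corner[OF p(1), of "x * q * (d q)\<^sup>\<star>"] x dC[OF q] minimal_projectionD(1)[OF SD(2)[OF q]] in_C
      by metis
    have "c *\<^sub>C (p * x * q) = p * x * q * (c *\<^sub>C q)"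
      using minimal_projectionD(3)[OF SD(2)[OF q]] by (simp add: mult_scaleC_right mult.assoc)
    also have "\<dots> = (p * (x * q * (d q)\<^sup>\<star>) * p) * d q"
      unfolding c(3)[symmetric] by (simp add: mult.assoc pd)
    also have "\<dots> = e *\<^sub>C d q" unfolding e by (simp add: mult_scaleC_left pd)
    finally have "(1 / c) *\<^sub>C (c *\<^sub>C (p * x * q)) = (e / c) *\<^sub>C d q" by (simp add: scaleC_scaleC)
    then show ?thesis using c(1) by (auto simp: scaleC_scaleC)
  qed
  then obtain m where m: "\<And>q x. q \<in> S \<Longrightarrow> x \<in> C \<Longrightarrow> p * x * q = m q x *\<^sub>C d q" by metis
  have m_unique: "m q x = c" if "q \<in> S" "x \<in> C" "p * x * q = c *\<^sub>C d q" for q x c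
    using m[OF that(1,2)] that(3) y(2)[OF that(1)] by (simp add: d_def complex_vector.scale_cancel_right)
  have "of_nat (card K) * \<tau> p = (\<Sum>q\<in>S. m q (d q))"
  proof (rule trace_formula[OF SD(1) dC])
    show "linear_on C (m q)" if q: "q \<in> S" for q
      by (rule linear_onI; rule m_unique)
        (simp_all add: q in_C distrib_left distrib_right mult_scaleC_left mult_scaleC_right m
          scaleC_add_left scaleC_scaleC)
    fix x assume x: "x \<in> C"
    have "p * x = p * z * x" using p(2) by simp
    also have "\<dots> = p * x * \<Sum>S" using zD(5)[OF x] SD(3) by (simp add: mult.assoc)
    also have "\<dots> = (\<Sum>q\<in>S. p * x * q)" by (rule sum_distrib_left)
    also have "\<dots> = (\<Sum>q\<in>S. m q x *\<^sub>C d q)" by (intro sum.cong refl m x)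
    finally show "p * x = (\<Sum>q\<in>S. m q x *\<^sub>C d q)" .
  qed
  also have "\<dots> = (\<Sum>q\<in>S. 1)"
  proof (intro sum.cong refl m_unique dC)
    fix q assume q: "q \<in> S"
    have "p * d q * q = (p * p) * y q * (q * q)" by (simp add: d_def mult.assoc)
    then show "p * d q * q = 1 *\<^sub>C d q" using pD(3) minimal_projectionD(3)[OF SD(2)[OF q]] by (simp add: d_def)
  qed auto
  finally show ?thesis by simp
qed

end

lemma minimal_projection_scalars_iff: "minimal_projection scalars e \<longleftrightarrow> e = (1::'a::cstar_algebra)"
proof -
  have proj: "q = 0 \<or> q = 1" if q: "projection_in scalars q" for q :: 'a
  proof -
    obtain c where c: "q = c *\<^sub>C 1" using q by (auto simp: projection_in_def scalars_def)
    then have "c * c = c" using q by (simp add: projection_in_def mult_scaleC_left scaleC_scaleC)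
    then show ?thesis using c by auto
  qed
  have "projection_in scalars (1::'a)"
    using scalars_subalgebra by (auto simp: projection_in_def unital_cstar_subalgebra_def)
  then have "minimal_projection scalars (1::'a)"
    using proj by (auto simp: minimal_projection_def)
  moreover have "e = 1" if "minimal_projection scalars e"
    using that proj[of e] by (auto simp: minimal_projection_def)
  ultimately show ?thesis by blast
qed

lemma simple_summands_scalars: "simple_summands (scalars :: 'a::cstar_algebra set) = {1}"
proof -
  have "scalars \<inter> centralizer scalars = (scalars :: 'a set)"
    by (auto simp: scalars_def centralizer_def mult_scaleC_left mult_scaleC_right)
  then show ?thesis by (simp add: simple_summands_def minimal_projection_scalars_iff)
qed

lemma scalars_eq_span: "scalars = complex_vector.span {1::'a::cstar_algebra}"
  by (auto simp: scalars_def complex_vector.span_singleton)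

lemma finite_dimensional_scalars: "finite_dimensional_cstar_subalgebra (scalars :: 'a::cstar_algebra set)"
  unfolding finite_dimensional_cstar_subalgebra_def using scalars_subalgebra scalars_eq_span by blast

section \<open>The inclusion of the scalars in \<open>C\<close> and its Markov trace\<close>

context orthonormal_basis
begin

lemma minimal_partition_C_exists:
  assumes "projection_in C e" "e \<noteq> 0"
  obtains S p where "minimal_partition C e S" "p \<in> S" "minimal_projection C p" "p * e = p"
proof -
  obtain S where S: "minimal_partition C e S"
    using minimal_partition_exists[OF C order_refl assms(1)] .
  then have "S \<noteq> {}" using assms(2) by (auto simp: minimal_partition_def)
  then obtain p where "p \<in> S" by blast
  then show thesis
    using that[OF S] S minimal_partition_mult(1)[OF S] by (auto simp: minimal_partition_def)
qed

lemma summand_projection: "z \<in> simple_summands C \<Longrightarrow> projection_in C z"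
  using summandD(1-3) by (simp add: projection_in_def)

text \<open>The description is proper because \<open>tau_minimal_projection\<close> computes the
  size of any partition of \<open>z\<close> from the trace of one fixed minimal projection.\<close>

lemma projection_rank_eq:
  assumes z: "z \<in> simple_summands C" and S: "minimal_partition C z S"
  shows "projection_rank C z = card S"
proof -
  have eq: "(\<exists>S. finite S \<and> (\<forall>p\<in>S. minimal_projection C p) \<and>
        (\<forall>p\<in>S. \<forall>q\<in>S. p \<noteq> q \<longrightarrow> p * q = 0) \<and> \<Sum>S = z \<and> card S = n) \<longleftrightarrow>
      (\<exists>S. minimal_partition C z S \<and> card S = n)" for n
    unfolding minimal_partition_def by blast
  obtain T p where p: "minimal_projection C p" "p * z = p"
    using minimal_partition_C_exists[OF summand_projection[OF z] summandD(4)[OF z]] by blast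
  have "card T = card S" if "minimal_partition C z T" for T
    using tau_minimal_projection[OF z p that] tau_minimal_projection[OF z p S] by simp
  then show ?thesis unfolding projection_rank_def eq using S by (intro the_equality) blast+
qed

lemma inclusion_matrix_scalars: "inclusion_matrix scalars C 1 z = projection_rank C z"
  unfolding inclusion_matrix_def minimal_projection_scalars_iff by simp

lemma summand_card:
  assumes "z \<in> simple_summands C"
  obtains S p where "minimal_partition C z S" "p \<in> S" "minimal_projection C p" "p * z = p"
    "inclusion_matrix scalars C 1 z = card S"
  using minimal_partition_C_exists[OF summand_projection[OF assms] summandD(4)[OF assms]]
    projection_rank_eq[OF assms] inclusion_matrix_scalars by metis

lemma trace_vector_eq:
  assumes z: "z \<in> simple_summands C" and t: "tracial_state C t" and p: "minimal_projection C p" "p * z = p"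
  shows "trace_vector C t z = t p"
  unfolding trace_vector_def
  using p linked_trace_eq[OF _ p(1) _ t] summand_linked[OF z _ _ p]
  by (intro the_equality) blast+

lemma tracial_sum:
  assumes t: "tracial_state C t" and f: "\<And>i. i \<in> I \<Longrightarrow> f i \<in> C"
  shows "t (sum f I) = (\<Sum>i\<in>I. t (f i))"
  using t f by (intro linear_on_sum[OF sub]) (auto simp: tracial_state_def linear_on_def)

lemma summand_trace:
  assumes z: "z \<in> simple_summands C" and t: "tracial_state C t"
  shows "t z = of_nat (inclusion_matrix scalars C 1 z) * trace_vector C t z"
proof -
  obtain S p where S: "minimal_partition C z S" "p \<in> S" "minimal_projection C p" "p * z = p"
    "inclusion_matrix scalars C 1 z = card S" using summand_card[OF z] .
  have SD: "finite S" "\<And>r. r \<in> S \<Longrightarrow> minimal_projection C r" "\<Sum>S = z"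
    using S by (auto simp: minimal_partition_def)
  have "t z = (\<Sum>r\<in>S. t r)"
    unfolding SD(3)[symmetric] by (rule tracial_sum[OF t]) (rule minimal_projectionD(1)[OF SD(2)])
  also have "\<dots> = (\<Sum>r\<in>S. trace_vector C t z)"
    using trace_vector_eq[OF z t SD(2) minimal_partition_mult(1)[OF S(1)]] by (intro sum.cong) auto
  finally show ?thesis using S(5) by simp
qed

text \<open>Two minimal projections of the commutative algebra \<open>Z\<close> are equal or
  orthogonal. Each summand therefore meets, and equals, a member of any minimal partition of
  1.\<close>

lemma summands_partition: "minimal_partition Z 1 (simple_summands C)"
proof -
  have "projection_in Z 1" using subalgebra_one[OF Z_subalgebra] by (simp add: projection_in_def)
  then obtain T where T: "minimal_partition Z 1 T"
    using minimal_partition_exists[OF Z_subalgebra Int_lower1] by blast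
  have TD: "finite T" "\<And>r. r \<in> T \<Longrightarrow> minimal_projection Z r" "\<Sum>T = 1"
    using T by (auto simp: minimal_partition_def)
  have "z \<in> T" if z: "z \<in> simple_summands C" for z
  proof -
    note zD = summandD[OF z]
    have "(\<Sum>w\<in>T. z * w) \<noteq> 0" using zD(4) TD(3) by (simp flip: sum_distrib_left)
    then obtain w where w: "w \<in> T" "z * w \<noteq> 0" by (meson sum.neutral)
    have wz: "w \<in> simple_summands C" using TD(2)[OF w(1)] by (simp add: simple_summands_def)
    note wD = summandD[OF wz]
    have comm: "z * w = w * z" by (rule zD(5)[OF wD(1)])
    have "projection_in Z (z * w)"
      using z wz by (intro projection_in_mult[OF Z_subalgebra _ _ comm])
        (simp_all only: simple_summands_def minimal_projection_def mem_Collect_eq)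
    moreover have "z * w * z = z * w" using comm zD(3) by (metis mult.assoc)
    moreover have "z * w * w = z * w" using wD(3) by (simp add: mult.assoc)
    ultimately have "z * w = z" "z * w = w" using zD(6) wD(6) w(2) by blast+
    then show ?thesis using w(1) by simp
  qed
  moreover have "z \<in> simple_summands C" if "z \<in> T" for z
    using TD(2)[OF that] by (simp add: simple_summands_def)
  ultimately have "simple_summands C = T" by blast
  then show ?thesis using T by simp
qed

lemma sum_summands: "\<Sum>(simple_summands C) = 1" and finite_summands: "finite (simple_summands C)"
  using summands_partition by (auto simp: minimal_partition_def)

lemma finite_dimensional_C: "finite_dimensional_cstar_subalgebra C"
  unfolding finite_dimensional_cstar_subalgebra_def using C C_eq_span K_fin by blast

text \<open>The inclusion matrix is a single row, so the Markov equation at \<open>z\<close> has the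
  entry at \<open>z\<close> times a sum over all summands, and that sum is
  \<open>t 1 = 1\<close>.\<close>

lemma Markov_trace_iff:
  "Markov_trace scalars C t \<beta> \<longleftrightarrow> tracial_state C t \<and> \<beta> > 0 \<and>
     (\<forall>z\<in>simple_summands C. of_nat (inclusion_matrix scalars C 1 z) = of_real \<beta> * trace_vector C t z)"
proof -
  have "(\<Sum>w\<in>simple_summands C.
           (\<Sum>y\<in>simple_summands scalars.
              of_nat (inclusion_matrix scalars C y z) * of_nat (inclusion_matrix scalars C y w))
           * trace_vector C t w) = (of_nat (inclusion_matrix scalars C 1 z) :: complex)"
    if t: "tracial_state C t" for z
  proof -
    have "(\<Sum>w\<in>simple_summands C. of_nat (inclusion_matrix scalars C 1 w) * trace_vector C t w)
        = (\<Sum>w\<in>simple_summands C. t w)"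
      using summand_trace[OF _ t] by (intro sum.cong) auto
    also have "\<dots> = t (\<Sum>w\<in>simple_summands C. w)"
      by (rule tracial_sum[OF t, symmetric]) (rule summandD(1))
    also have "\<dots> = 1" using sum_summands t by (simp add: tracial_state_def)
    finally show ?thesis
      unfolding simple_summands_scalars by (simp add: mult.assoc flip: sum_distrib_left)
  qed
  moreover have "scalars \<subseteq> C" using in_C by (auto simp: scalars_def)
  ultimately show ?thesis
    unfolding Markov_trace_def using finite_dimensional_scalars finite_dimensional_C by auto
qed

lemma tracial_tau: "tracial_state C \<tau>"
  unfolding tracial_state_def
  using linear_on_add[OF tau_linear] linear_on_scaleC[OF tau_linear] tau_positive_faithful tau_one tau_comm by blast

lemma tau_trace_vector:
  assumes z: "z \<in> simple_summands C"
  shows "of_nat (inclusion_matrix scalars C 1 z) = of_nat (card K) * trace_vector C \<tau> z"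
proof -
  obtain S p where S: "minimal_partition C z S" "p \<in> S" "minimal_projection C p" "p * z = p"
    "inclusion_matrix scalars C 1 z = card S" using summand_card[OF z] .
  show ?thesis
    using tau_minimal_projection[OF z S(3,4,1)] trace_vector_eq[OF z tracial_tau S(3,4)] S(5) by simp
qed

lemma Markov_tau: "Markov_trace scalars C \<tau> (real (complex_vector.dim C))"
  unfolding Markov_trace_iff dim_C using tracial_tau card_pos tau_trace_vector by simp

lemma Markov_unique:
  assumes M: "Markov_trace scalars C t \<beta>" and x: "x \<in> C"
  shows "t x = \<tau> x"
proof -
  have t: "tracial_state C t" and beta: "\<beta> > 0"
    and eq: "\<And>z. z \<in> simple_summands C \<Longrightarrow>
      of_nat (inclusion_matrix scalars C 1 z) = complex_of_real \<beta> * trace_vector C t z"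
    using M unfolding Markov_trace_iff by auto
  have total: "(\<Sum>z\<in>simple_summands C. s z) = 1" if "tracial_state C s" for s
  proof -
    have "(\<Sum>z\<in>simple_summands C. s z) = s (\<Sum>z\<in>simple_summands C. z)"
      by (rule tracial_sum[OF that, symmetric]) (rule summandD(1))
    then show ?thesis using sum_summands that by (simp add: tracial_state_def)
  qed
  let ?n = "\<lambda>z. complex_of_nat (inclusion_matrix scalars C 1 z)"
  \<comment> \<open>Multiplying the equation at \<open>z\<close> by the matrix entry and summing
    expresses \<beta> as the sum of squared entries. The same computation for \<tau> gives
    \<open>card K\<close>, which fixes the modulus.\<close>
  have "complex_of_real \<beta> = (\<Sum>z\<in>simple_summands C. complex_of_real \<beta> * t z)"
    by (simp add: total[OF t] flip: sum_distrib_left)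
  also have "\<dots> = (\<Sum>z\<in>simple_summands C. ?n z * ?n z)"
    using summand_trace[OF _ t] eq by (intro sum.cong refl) (simp add: mult.left_commute)
  also have "\<dots> = (\<Sum>z\<in>simple_summands C. of_nat (card K) * \<tau> z)"
    using summand_trace[OF _ tracial_tau] tau_trace_vector by (intro sum.cong refl) (simp add: mult.left_commute)
  also have "\<dots> = of_nat (card K)" by (simp add: total[OF tracial_tau] flip: sum_distrib_left)
  finally have beta_eq: "complex_of_real \<beta> = of_nat (card K)" .
  have minimal: "t q = \<tau> q" if q: "minimal_projection C q" for q
  proof -
    note qD = minimal_projectionD[OF q]
    have "(\<Sum>z\<in>simple_summands C. z * q) \<noteq> 0"
      using qD(4) sum_summands by (simp flip: sum_distrib_right)
    then obtain z where z: "z \<in> simple_summands C" "z * q \<noteq> 0" by (meson sum.neutral)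
    note zD = summandD[OF z(1)]
    have comm: "z * q = q * z" by (rule zD(5)[OF qD(1)])
    have "projection_in C (z * q)"
      by (rule projection_in_mult[OF C summand_projection[OF z(1)] qD(5) comm])
    moreover have "z * q * q = z * q" using qD(3) by (simp add: mult.assoc)
    ultimately have "z * q = q" using qD(6) z(2) by blast
    then have qz: "q * z = q" using comm by simp
    have "complex_of_nat (card K) * t q = complex_of_nat (card K) * \<tau> q"
      using eq[OF z(1)] tau_trace_vector[OF z(1)] beta_eq
        trace_vector_eq[OF z(1) t q qz] trace_vector_eq[OF z(1) tracial_tau q qz] by auto
    then show ?thesis using card_pos by simp
  qed
  obtain S where S: "minimal_partition C 1 S" using partition_of_one .
  have SD: "finite S" "\<And>r. r \<in> S \<Longrightarrow> minimal_projection C r" "\<Sum>S = 1"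
    using S by (auto simp: minimal_partition_def)
  have "\<forall>q\<in>S. \<exists>c. q * x * q = c *\<^sub>C q" using minimal_corner[OF SD(2) x] by blast
  then obtain c where c: "\<And>q. q \<in> S \<Longrightarrow> q * x * q = c q *\<^sub>C q" by metis
  \<comment> \<open>A trace sees only the diagonal blocks \<open>q * x * q\<close>, and these are
    scalar multiples of \<open>q\<close>; its values on minimal projections thus determine
    it.\<close>
  have diag: "s x = (\<Sum>q\<in>S. c q * s q)" if s: "tracial_state C s" for s
  proof -
    have "s x = s (\<Sum>q\<in>S. q * x)" using SD(3) by (simp flip: sum_distrib_right)
    also have "\<dots> = (\<Sum>q\<in>S. s (q * x))"
      by (rule tracial_sum[OF s]) (intro in_C x minimal_projectionD(1)[OF SD(2)])
    also have "\<dots> = (\<Sum>q\<in>S. c q * s q)"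
    proof (intro sum.cong refl)
      fix q assume q: "q \<in> S"
      note qD = minimal_projectionD[OF SD(2)[OF q]]
      have "s (q * x) = s (q * (q * x))" using qD(3) by (simp flip: mult.assoc)
      also have "\<dots> = s (q * x * q)"
        using s qD(1) in_C(3)[OF qD(1) x] unfolding tracial_state_def by blast
      also have "\<dots> = c q * s q" unfolding c[OF q] using s qD(1) by (simp add: tracial_state_def)
      finally show "s (q * x) = c q * s q" .
    qed
    finally show ?thesis .
  qed
  show ?thesis
    unfolding diag[OF t] diag[OF tracial_tau] by (intro sum.cong refl) (simp add: minimal SD)
qed

text \<open>The diagram is a star: the only vertex of the scalars is joined to every summand, since
  no summand has an empty partition.\<close>

lemma connected: "connected_inclusion scalars C"
proof -
  define R where "R = {(Inl y :: 'a + 'a, Inr z :: 'a + 'a) | y z. y \<in> simple_summands scalars \<and> z \<in> simple_summands C \<and>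
                 inclusion_matrix scalars C y z \<noteq> 0}"
  have edge: "(Inl 1, Inr z) \<in> R" if z: "z \<in> simple_summands C" for z
  proof -
    obtain S p where "minimal_partition C z S" "p \<in> S" "inclusion_matrix scalars C 1 z = card S"
      using summand_card[OF z] .
    then have "inclusion_matrix scalars C 1 z \<noteq> 0" by (auto simp: minimal_partition_def)
    then show ?thesis using z by (auto simp: R_def simple_summands_scalars)
  qed
  have "(u, Inl 1) \<in> (R \<union> R\<inverse>)\<^sup>* \<and> (Inl 1, u) \<in> (R \<union> R\<inverse>)\<^sup>*"
    if "u \<in> Inl ` simple_summands scalars \<union> Inr ` simple_summands C" for u
    using that edge unfolding simple_summands_scalars by auto
  then show ?thesis
    unfolding connected_inclusion_def Let_def R_def[symmetric] by (meson rtrancl_trans)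
qed

end

section \<open>Representatives and Weyl groups; the irreducible case\<close>

context regular_simple
begin

lemma card_reps: "card reps = card (carrier (generalized_Weyl_group B))"
  by (rule bij_betw_same_card[OF reps_bij])

lemma finite_reps_iff: "finite reps \<longleftrightarrow> finite (carrier (generalized_Weyl_group B))"
  by (rule bij_betw_finite[OF reps_bij])

lemma reps_nonempty: "reps \<noteq> {}"
  using reps_cover[OF N_one] by blast

lemma irreducible_Weyl_group:
  assumes "irreducible_inclusion B"
  shows "generalized_Weyl_group B = Weyl_group B"
proof -
  have CB: "C \<subseteq> B" using assms in_B by (auto simp: irreducible_inclusion_def scalars_def)
  have "unitary_group B <#>\<^bsub>normalizer_group B\<^esub> unitary_group C = unitary_group B"
    unfolding weyl_set_mult
  proof safe
    fix b k assume "b \<in> unitary_group B" "k \<in> unitary_group C"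
    then show "b * k \<in> unitary_group B"
      using CB by (intro unitary_group_mult B) (auto simp: mem_unitary_group)
  next
    fix b assume "b \<in> unitary_group B"
    moreover have "1 \<in> unitary_group C" by (simp add: mem_unitary_group in_C)
    ultimately show "\<exists>b' k. b = b' * k \<and> b' \<in> unitary_group B \<and> k \<in> unitary_group C"
      by (intro exI[of _ b] exI[of _ 1]) simp
  qed
  then show ?thesis by (simp add: generalized_Weyl_group_def Weyl_group_def)
qed

lemma irreducible_dim: "irreducible_inclusion B \<Longrightarrow> complex_vector.dim C = 1"
  using complex_vector.dim_span_eq_card_independent[of "{1::'a}"]
  by (simp add: irreducible_inclusion_def scalars_eq_span complex_vector.independent_insert
      complex_vector.independent_empty)

end

text \<open>Both indices are evaluated by the same trace \<tau>, giving \<open>card reps\<close>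
  times \<open>\<tau> D\<close> for \<open>E\<close> and \<open>card reps\<close> times
  \<open>card K\<close> for \<open>E\<tau>\<close>. Since \<open>card reps\<close> is positive it
  cancels, and minimality becomes the hypothesis of \<open>D_minimal\<close>.\<close>

lemma (in regular_basis) minimal_expectation_values:
  assumes min: "minimal_conditional_expectation B E"
  shows "\<And>x. x \<in> C \<Longrightarrow> \<phi> x = \<tau> x"
    and "watatani_index E = complex_of_real (real (card reps) * real (card K)) *\<^sub>C 1"
proof -
  have E': "conditional_expectation B E\<tau>" by (rule E_tau_conditional_expectation)
  \<comment> \<open>The construction is repeated for \<open>E\<tau>\<close>, with a basis
    \<open>L\<close> orthonormal for \<tau> instead of \<phi>. The set \<open>reps\<close> is
    shared.\<close>
  interpret X: regular_expectation B E\<tau> by unfold_locales (rule B E')+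
  have X_phi: "X.\<phi> x = \<tau> x" if "x \<in> C" for x by (rule X.phi_unique[OF that E_tau_C[OF that]])
  interpret XF: faithful_state C X.\<phi>
  proof (rule X.faithful_state_phi)
    show "x = 0" if "x \<in> C" "E\<tau> (x\<^sup>\<star> * x) = 0" for x
      using tau_positive_faithful(2)[OF that(1)] E_tau_C[of "x\<^sup>\<star> * x"] that in_C by (auto simp: complex_vector.scale_eq_0_iff)
  qed
  have "card L \<le> card K" if "XF.orthonormal L" for L
    using complex_vector.independent_span_bound[OF K_fin XF.orthonormal_independent[OF that]]
      XF.orthonormalD(2)[OF that] C_eq_span by auto
  then obtain L where L: "XF.orthonormal L" "\<And>x. x \<in> C \<Longrightarrow> x = (\<Sum>k\<in>L. X.\<phi> (x * k\<^sup>\<star>) *\<^sub>C k)"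
    using XF.orthonormal_basis_exists by metis
  interpret Y: regular_basis B E\<tau> L
    by unfold_locales (fact L finite_reps)+
  have inv: "\<tau> (w\<^sup>\<star> * x * w) = \<tau> x" if "w \<in> N" "x \<in> C" for w x
    using that by (intro tau_Ad N_unitary N_conj_C)
  note index = watatani_index_trace[OF tau_linear tau_one inv tau_comm]
    and index' = Y.watatani_index_trace[OF tau_linear tau_one inv tau_comm]
  obtain r where r: "watatani_index E = complex_of_real r *\<^sub>C 1" using watatani_index_scalar by blast
  obtain r' where r': "watatani_index E\<tau> = complex_of_real r' *\<^sub>C 1" using Y.watatani_index_scalar by blast
  \<comment> \<open>Both numbers are the dimension of \<open>C\<close>, and each
    \<open>k * k\<^sup>\<star>\<close> with \<open>k\<close> in \<open>L\<close> has trace 1 by the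
    choice of \<open>L\<close>.\<close>
  have "card L = card K" using Y.dim_C dim_C by simp
  moreover have "(\<Sum>k\<in>L. \<tau> (k * k\<^sup>\<star>)) = (\<Sum>k\<in>L. 1)"
  proof (intro sum.cong refl)
    fix k assume k: "k \<in> L"
    have "k * k\<^sup>\<star> \<in> C" by (intro in_C Y.K_C k)
    then show "\<tau> (k * k\<^sup>\<star>) = 1" using X_phi Y.K_on[OF k k] by simp
  qed
  ultimately have "complex_of_real r' = of_nat (card reps) * of_nat (card K)"
    using index'[OF _ _ _ _ r'] by simp
  then have "complex_of_real r' = complex_of_real (real (card reps) * real (card K))" by simp
  then have r'_eq: "r' = real (card reps) * real (card K)" by (simp only: of_real_eq_iff)
  have "(\<Sum>k\<in>K. \<tau> (k * k\<^sup>\<star>)) = \<tau> D"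
    unfolding D_def by (intro linear_on_sum[OF sub tau_linear, symmetric] in_C K_C)
  then have r_eq: "complex_of_real r = of_nat (card reps) * \<tau> D" using index[OF _ _ _ _ r] by simp
  have "cstar_le (watatani_index E) (watatani_index E\<tau>)"
    using min E' Y.finite_index_E unfolding minimal_conditional_expectation_def by blast
  then have "r \<le> r'"
    unfolding cstar_le_def r r'
    by (simp add: cstar_positive_scaleC_one_iff complex_nonneg_Reals_iff flip: complex_vector.scale_left_diff_distrib of_real_diff)
  moreover have "r = real (card reps) * Re (\<tau> D)" using arg_cong[OF r_eq, of Re] by simp
  moreover have "card reps > 0" using reps_nonempty finite_reps by (simp add: card_gt_0_iff)
  ultimately have le: "Re (\<tau> D) \<le> card K" using r'_eq by simp
  show phi: "\<phi> x = \<tau> x" if "x \<in> C" for x by (rule D_minimal[OF le that])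
  have "(\<Sum>k\<in>K. \<tau> (k * k\<^sup>\<star>)) = (\<Sum>k\<in>K. 1)"
  proof (intro sum.cong refl)
    fix k assume k: "k \<in> K"
    have "k * k\<^sup>\<star> \<in> C" by (intro in_C K_C k)
    then show "\<tau> (k * k\<^sup>\<star>) = 1" using phi K_on[OF k k] by simp
  qed
  then have "complex_of_real r = of_nat (card reps) * of_nat (card K)" using index[OF _ _ _ _ r] by simp
  then show "watatani_index E = complex_of_real (real (card reps) * real (card K)) *\<^sub>C 1"
    using r by simp
qed

theorem theorem3p8:
  fixes B :: "'a::cstar_algebra set" and E\<^sub>0 :: "'a \<Rightarrow> 'a"
  assumes "unital_cstar_subalgebra B"
    and "simple_cstar_algebra (UNIV :: 'a set)"
    and "simple_cstar_algebra B"
    and "regular_inclusion B"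
    and "\<exists>E. conditional_expectation B E \<and> finite_index E"
    and "minimal_conditional_expectation B E\<^sub>0"
  shows "(\<exists>L. two_sided_orthonormal_quasi_basis E\<^sub>0 L) \<and>
    (\<exists>\<tau>\<^sub>0. (\<forall>x\<in>centralizer B. E\<^sub>0 x = \<tau>\<^sub>0 x *\<^sub>C 1) \<and>
        Markov_trace scalars (centralizer B) \<tau>\<^sub>0 (real (complex_vector.dim (centralizer B))) \<and>
        (\<forall>\<tau> \<beta>. Markov_trace scalars (centralizer B) \<tau> \<beta> \<longrightarrow> (\<forall>x\<in>centralizer B. \<tau> x = \<tau>\<^sub>0 x))) \<and>
    connected_inclusion scalars (centralizer B) \<and>
    watatani_index E\<^sub>0 = of_real (minimal_index B) \<and>
    finite (carrier (generalized_Weyl_group B)) \<and>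
    minimal_index B =
      real (card (carrier (generalized_Weyl_group B))) * real (complex_vector.dim (centralizer B)) \<and>
    minimal_index B \<in> \<int> \<and>
    real (card (carrier (generalized_Weyl_group B))) \<le> minimal_index B \<and>
    (irreducible_inclusion B \<longrightarrow>
        finite (carrier (Weyl_group B)) \<and> minimal_index B = real (card (carrier (Weyl_group B))))"
proof -
  interpret regular_expectation B E\<^sub>0
    using assms by unfold_locales (auto simp: minimal_conditional_expectation_def)
  have fin: "finite_index E\<^sub>0" using assms by (simp add: minimal_conditional_expectation_def)
  obtain K where "orthonormal_basis C \<phi> K" using orthonormal_basis_exists[OF fin] .
  then interpret orthonormal_basis C \<phi> K .
  interpret regular_basis B E\<^sub>0 K by unfold_locales (rule finite_reps[OF fin])
  note phi = minimal_expectation_values(1)[OF assms(6)]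
    and index = minimal_expectation_values(2)[OF assms(6)]
  define n where "n = real (card reps) * real (card K)"
  have index_n: "watatani_index E\<^sub>0 = of_real n"
    using index unfolding n_def by (simp add: of_real_def scaleR_scaleC)
  have "minimal_index B = n"
    unfolding minimal_index_def
  proof (rule the_equality)
    show "\<exists>E. minimal_conditional_expectation B E \<and> watatani_index E = of_real n"
      using assms(6) index_n by blast
    fix r assume "\<exists>E. minimal_conditional_expectation B E \<and> watatani_index E = of_real r"
    then obtain F where F: "minimal_conditional_expectation B F" "watatani_index F = of_real r" by blast
    \<comment> \<open>The indices of two minimal expectations are each below the other, so the
      described number is well defined.\<close>
    have "cstar_le (of_real n :: 'a) (of_real r)" "cstar_le (of_real r :: 'a) (of_real n)"
      using F(1) assms(6) unfolding F(2)[symmetric] index_n[symmetric] minimal_conditional_expectation_def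
      by blast+
    then have "n \<le> r" "r \<le> n"
      unfolding cstar_le_def of_real_diff[symmetric] by (simp_all add: of_real_def cstar_positive_scaleR_one_iff flip: scaleR_left_diff_distrib)
    then show "r = n" by simp
  qed
  then have min_eq: "minimal_index B =
      real (card (carrier (generalized_Weyl_group B))) * real (complex_vector.dim C)"
    by (simp add: n_def card_reps dim_C)
  have "two_sided_orthonormal_quasi_basis E\<^sub>0 V"
  proof (rule two_sided)
    show "\<phi> (w\<^sup>\<star> * x * w) = \<phi> x" if "w \<in> N" "x \<in> C" for w x
      using tau_Ad[OF N_unitary[OF that(1)] N_conj_C[OF that(1)] that(2)] phi N_conj_C(2)[OF that] that by simp
    show "\<phi> (x * y) = \<phi> (y * x)" if "x \<in> C" "y \<in> C" for x y
      using tau_comm[OF that] phi that in_C by metis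
  qed
  moreover have "\<forall>x\<in>C. E\<^sub>0 x = \<tau> x *\<^sub>C 1" using E_C phi by simp
  moreover have "finite (carrier (generalized_Weyl_group B))" using finite_reps finite_reps_iff by simp
  moreover have "minimal_index B \<in> \<int>" unfolding min_eq by (simp flip: of_nat_mult)
  moreover have "real (card (carrier (generalized_Weyl_group B))) \<le> minimal_index B"
    unfolding min_eq dim_C using card_pos by (simp add: mult_le_cancel_left1)
  moreover have "watatani_index E\<^sub>0 = of_real (minimal_index B)"
    using index_n \<open>minimal_index B = n\<close> by simp
  moreover have "finite (carrier (Weyl_group B)) \<and> minimal_index B = real (card (carrier (Weyl_group B)))"
    if "irreducible_inclusion B"
    using \<open>finite (carrier (generalized_Weyl_group B))\<close>
    by (simp add: min_eq irreducible_dim[OF that] flip: irreducible_Weyl_group[OF that])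
  ultimately show ?thesis
    using Markov_tau Markov_unique connected min_eq by blast
qed

end
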